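(* Let $\pi$ be the trivial representation of $\mathrm{GL}_2(F)$. Then $\Theta(\pi)$ is isomorphic to the normalized induced representation $I(|\cdot|^{1/2},|\cdot|^{-1/2})$, which has length $2$: $\Theta(\pi)$ has a unique irreducible subrepresentation, isomorphic to the Steinberg representation of $\mathrm{GL}_2(F)$, and the corresponding quotient is the trivial representation.
   Context: $F$ is a nonarchimedean local field of characteristic $0$ with normalized absolute value $|\cdot|$. The Weil representation of $\mathrm{GL}_2(F)\times\mathrm{GL}_2(F)$ is $\omega_{2,2}:=\mathcal S(M_{2\times 2}(F))\otimes(|\det|^{-1}\boxtimes|\det|)$, where $\mathcal S$ denotes locally constant compactly supported functions and $((g_1,g_2)f)(M)=f(g_1^{-1}Mg_2)$. For an irreducible representation $\pi$ of the first factor, $\Theta(\pi):=(\omega_{2,2}\otimes\pi^\vee)_{\mathrm{GL}_2(F)}$ (maximal quotient on which the first $\mathrm{GL}_2(F)$ acts trivially), a representation of the second $\mathrm{GL}_2(F)$. For characters $\chi_1,\chi_2$ of $F^\times$, $I(\chi_1,\chi_2)$ is the space of smooth $f$ on $\mathrm{GL}_2(F)$ with $f\left(\begin{pmatrix}a&x\\0&b\end{pmatrix}g\right)=\chi_1(a)\chi_2(b)|a/b|^{1/2}f(g)$, with $\mathrm{GL}_2(F)$ acting by right translation. The Steinberg representation is the unique irreducible subrepresentation of $I(|\cdot|^{1/2},|\cdot|^{-1/2})$. *)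

theory Defs
  imports "HOL-Analysis.Analysis" "HOL-Library.Function_Algebras"
begin

text \<open>The field F is a type of class field_char_0 (characteristic 0), equipped with
  a function nv :: F => real which is the normalized absolute value. The predicate below
  says: nv is a nonarchimedean absolute value, F is complete for it, the residue field
  O/P is finite with q elements, and the value group is q^Z with a uniformizer of
  absolute value 1/q (normalization). Together these say F is a nonarchimedean local field.\<close>

definition integers_of :: "('a::field_char_0 \<Rightarrow> real) \<Rightarrow> 'a set" where
  "integers_of nv = {x. nv x \<le> 1}"

definition residue_classes :: "('a::field_char_0 \<Rightarrow> real) \<Rightarrow> 'a set set" where
  "residue_classes nv = (\<lambda>x. {y \<in> integers_of nv. nv (x - y) < 1}) ` integers_of nv"

definition nonarch_local_field :: "('a::field_char_0 \<Rightarrow> real) \<Rightarrow> bool" where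
  "nonarch_local_field nv \<longleftrightarrow>
     (\<forall>x. nv x \<ge> 0) \<and> (\<forall>x. nv x = 0 \<longleftrightarrow> x = 0) \<and>
     (\<forall>x y. nv (x * y) = nv x * nv y) \<and>
     (\<forall>x y. nv (x + y) \<le> max (nv x) (nv y)) \<and>
     (\<forall>X :: nat \<Rightarrow> 'a. (\<forall>e>0. \<exists>N. \<forall>m\<ge>N. \<forall>n\<ge>N. nv (X m - X n) < e) \<longrightarrow>
          (\<exists>L. \<forall>e>0. \<exists>N. \<forall>n\<ge>N. nv (X n - L) < e)) \<and>
     finite (residue_classes nv) \<and>
     (let q = card (residue_classes nv) in
        q \<ge> 2 \<and> (\<exists>w. nv w = 1 / real q) \<and>
        (\<forall>x. x \<noteq> 0 \<longrightarrow> (\<exists>k::int. nv x = real q powi k)))"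

type_synonym 'a mat2 = "'a ^ 2 ^ 2"

definition GL2 :: "'a::field_char_0 mat2 set" where
  "GL2 = {g. invertible g}"

definition mat2 :: "'a::zero \<Rightarrow> 'a \<Rightarrow> 'a \<Rightarrow> 'a \<Rightarrow> 'a mat2" where
  "mat2 a b c d = (\<chi> i j. if i = 1 then (if j = 1 then a else b) else (if j = 1 then c else d))"

text \<open>sup-norm of a matrix w.r.t. nv (defines the topology on M_2(F) and GL_2(F)).\<close>
definition mnv :: "('a::field_char_0 \<Rightarrow> real) \<Rightarrow> 'a mat2 \<Rightarrow> real" where
  "mnv nv M = Max (range (\<lambda>(i, j). nv (M $ i $ j)))"

definition cscale :: "complex \<Rightarrow> ('b \<Rightarrow> complex) \<Rightarrow> ('b \<Rightarrow> complex)" where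
  "cscale c f = (\<lambda>x. c * f x)"

definition cspan :: "('b \<Rightarrow> complex) set \<Rightarrow> ('b \<Rightarrow> complex) set" where
  "cspan A = {v. \<exists>S c. finite S \<and> S \<subseteq> A \<and> v = (\<Sum>u\<in>S. cscale (c u) u)}"

definition csubspace :: "('b \<Rightarrow> complex) set \<Rightarrow> bool" where
  "csubspace U \<longleftrightarrow> 0 \<in> U \<and> (\<forall>f\<in>U. \<forall>g\<in>U. f + g \<in> U) \<and> (\<forall>c. \<forall>f\<in>U. cscale c f \<in> U)"

definition schwartz :: "('a::field_char_0 \<Rightarrow> real) \<Rightarrow> ('a mat2 \<Rightarrow> complex) set" where
  "schwartz nv = {f.
      (\<forall>M. \<exists>e>0. \<forall>N. mnv nv (N - M) < e \<longrightarrow> f N = f M) \<and>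
      (\<exists>R. \<forall>M. f M \<noteq> 0 \<longrightarrow> mnv nv M \<le> R)}"

definition weil :: "('a::field_char_0 \<Rightarrow> real) \<Rightarrow> 'a mat2 \<Rightarrow> 'a mat2 \<Rightarrow>
    ('a mat2 \<Rightarrow> complex) \<Rightarrow> ('a mat2 \<Rightarrow> complex)" where
  "weil nv g1 g2 f = (\<lambda>M. complex_of_real (inverse (nv (det g1)) * nv (det g2)) *
        f (matrix_inv g1 ** M ** g2))"

text \<open>Theta of the trivial representation: pi^vee is trivial, so omega (x) pi^vee = omega, and
  Theta(pi) is the space of coinvariants S / W of the first GL_2 factor, where W is the
  complex span of the vectors omega(g,1) f - f; the second GL_2 acts on it via omega(1,g).\<close>
definition theta_triv_kernel :: "('a::field_char_0 \<Rightarrow> real) \<Rightarrow> ('a mat2 \<Rightarrow> complex) set" where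
  "theta_triv_kernel nv =
     cspan {weil nv g (mat 1) f - f | g f. g \<in> GL2 \<and> f \<in> schwartz nv}"

text \<open>Functions on GL_2(F) are encoded as functions on matrices vanishing off GL_2(F).\<close>
definition ind_rep :: "('a::field_char_0 \<Rightarrow> real) \<Rightarrow> ('a \<Rightarrow> complex) \<Rightarrow> ('a \<Rightarrow> complex) \<Rightarrow>
    ('a mat2 \<Rightarrow> complex) set" where
  "ind_rep nv chi1 chi2 = {f.
      (\<forall>g. g \<notin> GL2 \<longrightarrow> f g = 0) \<and>
      (\<exists>e>0. \<forall>g\<in>GL2. \<forall>k. mnv nv (k - mat 1) < e \<longrightarrow> f (g ** k) = f g) \<and>
      (\<forall>a b x g. a \<noteq> 0 \<longrightarrow> b \<noteq> 0 \<longrightarrow> g \<in> GL2 \<longrightarrow>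
         f (mat2 a x 0 b ** g) =
           chi1 a * chi2 b * complex_of_real (nv (a / b) powr (1/2)) * f g)}"

definition right_transl :: "'a::field_char_0 mat2 \<Rightarrow> ('a mat2 \<Rightarrow> complex) \<Rightarrow> ('a mat2 \<Rightarrow> complex)" where
  "right_transl h f = (\<lambda>g. f (g ** h))"

definition absc :: "('a::field_char_0 \<Rightarrow> real) \<Rightarrow> real \<Rightarrow> 'a \<Rightarrow> complex" where
  "absc nv s = (\<lambda>x. complex_of_real (nv x powr s))"

definition I_half :: "('a::field_char_0 \<Rightarrow> real) \<Rightarrow> ('a mat2 \<Rightarrow> complex) set" where
  "I_half nv = ind_rep nv (absc nv (1/2)) (absc nv (-1/2))"

definition subrep :: "('a::field_char_0 mat2 \<Rightarrow> complex) set \<Rightarrow> ('a mat2 \<Rightarrow> complex) set \<Rightarrow> bool" where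
  "subrep U V \<longleftrightarrow> U \<subseteq> V \<and> csubspace U \<and>
     (\<forall>h\<in>GL2. \<forall>f\<in>U. right_transl h f \<in> U)"

definition irreducible_subrep :: "('a::field_char_0 mat2 \<Rightarrow> complex) set \<Rightarrow> ('a mat2 \<Rightarrow> complex) set \<Rightarrow> bool" where
  "irreducible_subrep U V \<longleftrightarrow> subrep U V \<and> U \<noteq> {0} \<and>
     (\<forall>U'. subrep U' U \<longrightarrow> U' = {0} \<or> U' = U)"

definition steinberg :: "('a::field_char_0 \<Rightarrow> real) \<Rightarrow> ('a mat2 \<Rightarrow> complex) set" where
  "steinberg nv = (THE U. irreducible_subrep U (I_half nv))"

end

theory Submission
  imports Defs
begin

text \<open>The orbits of the first factor on rank one matrices \<open>v w\<close> (\<open>v\<close> a column, \<open>w\<close> a row) are the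
  fibres over the line spanned by \<open>w\<close>, and on each of them \<open>f \<mapsto> \<integral> f(v w) dv\<close> is the functional with the right
  equivariance; as a function of \<open>w\<close> it is homogeneous of degree \<open>-2\<close>, which gives the map to
  \<open>I(|.|\<^sup>1\<^sup>/\<^sup>2, |.|\<^sup>-\<^sup>1\<^sup>/\<^sup>2)\<close>. The origin and the open orbit do not contribute to the coinvariants: scaling
  removes \<open>f(0)\<close>, and the indicator of \<open>GL\<^sub>2(O)\<close> lies in the kernel by inclusion-exclusion over sublattices.
  A function in the kernel of the map is folded by scaling onto the matrices of norm 1 and averaged over
  \<open>GL\<^sub>2(O)\<close>; it then vanishes near the singular matrices and is a finite combination of right
  translates of that indicator.

  The induced representation consists of densities on the projective line, and the total mass is an
  invariant functional whose kernel is the Steinberg representation. A nonzero vector of mass 0 in a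
  subrepresentation is made constant on a big disc by a dilation and on its complement by averaging over
  unipotents; zooming in and rotating produce all differences of normalized disc indicators, which span the
  densities of mass 0.\<close>

section \<open>Nonarchimedean local fields\<close>

text \<open>The open orbit is the delicate point. On functions supported in \<open>GL2\<close> alone
  the coinvariants are one-dimensional: the functional is the integral of \<open>f |det|\<close>
  against Haar measure of the group. It does not extend to all Schwartz functions, because for the
  indicator of \<open>M_2(O)\<close> the integral of \<open>|det|^s\<close> is a multiple of
  \<open>1 / ((1 - q^-s) (1 - q^(1-s)))\<close>, which has a pole at \<open>s = 1\<close>. The
  inclusion-exclusion coefficients add up to \<open>(1 - q^-s) (1 - q^(1-s))\<close>, so they cancel
  there and the extra functional dies.

  The field carries only the function \<open>nv\<close>, neither a topology nor a measure.
  Compactness is therefore used as finiteness of the image of a uniformly locally constant map, and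
  averages over compact groups are sums over the finite set of translates of one function.
  Completeness enters once, where pointwise local constancy is made uniform.

  \<open>steinberg\<close> is a definite description, so it can be identified with the densities of
  mass 0 only after these have been shown to lie in every nonzero subrepresentation.\<close>

locale local_field =
  fixes nv :: "'a::field_char_0 \<Rightarrow> real"
  assumes local_field: "nonarch_local_field nv"
begin

definition q :: real where "q = real (card (residue_classes nv))"

lemma nv_nonneg [simp]: "nv x \<ge> 0"
  and nv_eq_0 [simp]: "nv x = 0 \<longleftrightarrow> x = 0"
  and nv_mult: "nv (x * y) = nv x * nv y"
  and nv_add: "nv (x + y) \<le> max (nv x) (nv y)"
  and finite_residue: "finite (residue_classes nv)"
  and q_ge_2: "q \<ge> 2"
  and ex_uniformizer: "\<exists>w. nv w = 1 / q"
  using local_field unfolding nonarch_local_field_def Let_def q_def by auto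

lemma nv_value: "x \<noteq> 0 \<Longrightarrow> \<exists>k::int. nv x = q powi k"
  using local_field unfolding nonarch_local_field_def Let_def q_def by auto

lemma nv_complete:
  assumes "\<And>e. e > 0 \<Longrightarrow> \<exists>N. \<forall>m\<ge>N. \<forall>n\<ge>N. nv (X m - X n) < e"
  shows "\<exists>L. \<forall>e>0. \<exists>N. \<forall>n\<ge>N. nv (X (n::nat) - L) < e"
  using local_field assms unfolding nonarch_local_field_def Let_def by blast

lemma nv_0 [simp]: "nv 0 = 0" by simp

lemma nv_pos [simp]: "nv x > 0 \<longleftrightarrow> x \<noteq> 0"
  using nv_nonneg[of x] nv_eq_0[of x] by linarith

lemma nv_1 [simp]: "nv 1 = 1"
  using nv_mult[of 1 1] nv_eq_0[of 1] by simp

lemma nv_minus [simp]: "nv (- x) = nv x"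
proof -
  have "nv (-1) * nv (-1) = 1" using nv_mult[of "-1" "-1"] by simp
  hence "nv (-1) = 1" using nv_nonneg[of "-1"] by (metis abs_of_nonneg abs_mult_self_eq real_sqrt_abs2 real_sqrt_one)
  thus ?thesis using nv_mult[of "-1" x] by simp
qed

lemma nv_diff_commute: "nv (x - y) = nv (y - x)"
  using nv_minus[of "x - y"] by simp

lemma nv_inverse: "nv (inverse x) = inverse (nv x)"
proof (cases "x = 0")
  case False
  hence "nv x * nv (inverse x) = 1" using nv_mult[of x "inverse x"] by simp
  thus ?thesis by (metis inverse_unique)
qed simp

lemma nv_divide: "nv (x / y) = nv x / nv y"
  by (simp add: divide_inverse nv_mult nv_inverse)

lemma nv_power: "nv (x ^ n) = nv x ^ n"
  by (induction n) (auto simp: nv_mult)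

lemma nv_powi: "nv (x powi n) = nv x powi n"
  by (auto simp: power_int_def nv_power nv_inverse power_inverse)

lemma nv_add_le: "nv x \<le> r \<Longrightarrow> nv y \<le> r \<Longrightarrow> nv (x + y) \<le> r"
  using nv_add[of x y] by linarith

lemma nv_diff_le: "nv x \<le> r \<Longrightarrow> nv y \<le> r \<Longrightarrow> nv (x - y) \<le> r"
  using nv_add_le[of x r "- y"] by simp

lemma nv_add_less: "nv x < r \<Longrightarrow> nv y < r \<Longrightarrow> nv (x + y) < r"
  using nv_add[of x y] by linarith

lemma nv_diff_less: "nv x < r \<Longrightarrow> nv y < r \<Longrightarrow> nv (x - y) < r"
  using nv_add_less[of x r "- y"] by simp

lemma nv_mult_le: "nv x \<le> r \<Longrightarrow> nv y \<le> s \<Longrightarrow> nv (x * y) \<le> r * s"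
  unfolding nv_mult by (intro mult_mono) (auto intro: order_trans[OF nv_nonneg])

lemma nv_mult_le_1: "nv x \<le> r \<Longrightarrow> nv y \<le> 1 \<Longrightarrow> nv (x * y) \<le> r"
  using nv_mult_le[of x r y 1] by simp

lemma nv_triangle_le: "nv (x - y) \<le> r \<Longrightarrow> nv (y - z) \<le> r \<Longrightarrow> nv (x - z) \<le> r"
  using nv_add_le[of "x - y" r "y - z"] by simp

lemma nv_add_absorb: "nv y < nv x \<Longrightarrow> nv (x + y) = nv x"
  using nv_add[of x y] nv_add[of "x + y" "- y"] by auto

lemma nv_diff_absorb: "nv y < nv x \<Longrightarrow> nv (x - y) = nv x"
  using nv_add_absorb[of "- y" x] by simp

lemma nv_eq_if_close: "nv (x - y) < nv y \<Longrightarrow> nv x = nv y"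
  using nv_add_absorb[of "x - y" y] by simp

lemma q_pos [simp]: "q > 0" and q_ge_0 [simp]: "q \<ge> 0" and q_gt_1: "q > 1" and q_nz [simp]: "q \<noteq> 0"
  using q_ge_2 by auto

section \<open>The uniformizer and the discrete value group\<close>

definition unif :: 'a where "unif = (SOME w. nv w = 1 / q)"

lemma nv_unif: "nv unif = 1 / q"
  unfolding unif_def by (rule someI_ex[OF ex_uniformizer])

lemma unif_nz [simp]: "unif \<noteq> 0"
  using nv_unif nv_eq_0[of unif] by auto

lemma q_powi_le_iff: "q powi m \<le> q powi n \<longleftrightarrow> m \<le> n"
  using q_gt_1 by (meson linorder_not_le power_int_strict_increasing power_int_increasing less_imp_le)

lemma q_powi_less_iff: "q powi m < q powi n \<longleftrightarrow> m < n"
  using q_powi_le_iff[of n m] by linarith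

lemma nv_unif_powi: "nv (unif powi (- k)) = q powi k"
  by (simp add: nv_inverse nv_powi nv_unif power_int_minus power_int_inverse flip: inverse_eq_divide)

text \<open>Discreteness of the value group: a strict inequality of norms already gains a factor
  \<open>q\<close>. Hence an open ball is the closed ball of the next smaller radius.\<close>

lemma nv_less_iff:
  assumes "y \<noteq> 0"
  shows "nv x < nv y \<longleftrightarrow> nv x \<le> nv y / q"
proof (cases "x = 0")
  case False
  obtain k where k: "nv x = q powi k" using nv_value[OF False] by auto
  obtain l where l: "nv y = q powi l" using nv_value[OF assms] by auto
  have "q powi l / q = q powi (l - 1)" by (simp add: power_int_diff)
  thus ?thesis unfolding k l using q_powi_le_iff q_powi_less_iff by auto
qed (use assms q_pos in \<open>simp add: divide_nonneg_pos\<close>)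

lemma nv_less_1_iff: "nv x < 1 \<longleftrightarrow> nv x \<le> 1 / q"
  using nv_less_iff[of 1 x] by simp

text \<open>One representative is chosen from each residue class. The ultrametric inequality
  recovers the class from any of its members, so the choice is injective and the number of digits is
  \<open>q\<close>.\<close>

lemma ex_digits:
  "\<exists>R. finite R \<and> real (card R) = q \<and> R \<subseteq> {x. nv x \<le> 1} \<and>
       (\<forall>x. nv x \<le> 1 \<longrightarrow> (\<exists>!r. r \<in> R \<and> nv (x - r) < 1))"
proof -
  let ?cl = "\<lambda>x. {y \<in> integers_of nv. nv (x - y) < 1}"
  have self: "x \<in> ?cl x" if "nv x \<le> 1" for x using that by (simp add: integers_of_def)
  have eq1: "nv (y - z) < 1" if "nv (x - y) < 1" "nv (x - z) < 1" for x y z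
    using nv_diff_less[OF that(2,1)] by simp
  have eq: "?cl x = ?cl y" if "nv (x - y) < 1" for x y
    using that eq1[of x y] eq1[of y x] by (auto simp: nv_diff_commute[of y x])
  define f where "f = (\<lambda>C::'a set. SOME x. nv x \<le> 1 \<and> C = ?cl x)"
  have f: "nv (f C) \<le> 1 \<and> C = ?cl (f C)" if "C \<in> residue_classes nv" for C
    unfolding f_def
    by (rule someI_ex) (use that in \<open>auto simp: residue_classes_def integers_of_def\<close>)
  let ?R = "f ` residue_classes nv"
  have inj: "inj_on f (residue_classes nv)"
  proof (rule inj_onI)
    fix C D assume h: "C \<in> residue_classes nv" "D \<in> residue_classes nv" "f C = f D"
    have "C = ?cl (f C)" using f[OF h(1)] by (rule conjunct2)
    also have "\<dots> = D" unfolding h(3) using f[OF h(2)] by (metis (no_types))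
    finally show "C = D" .
  qed
  have "\<exists>!r. r \<in> ?R \<and> nv (x - r) < 1" if x: "nv x \<le> 1" for x
  proof -
    have C: "?cl x \<in> residue_classes nv" using x by (auto simp: residue_classes_def integers_of_def)
    have fx: "nv (f (?cl x)) \<le> 1" "?cl x = ?cl (f (?cl x))" using f[OF C] by auto
    show ?thesis
    proof (rule ex1I[of _ "f (?cl x)"])
      have "f (?cl x) \<in> ?cl x" using self[OF fx(1)] fx(2) by blast
      thus "f (?cl x) \<in> ?R \<and> nv (x - f (?cl x)) < 1" using C by auto
    next
      fix r assume r: "r \<in> ?R \<and> nv (x - r) < 1"
      then obtain C' where C': "C' \<in> residue_classes nv" "r = f C'" by auto
      have "?cl x = ?cl r" using eq r by blast
      also have "\<dots> = C'" using f[OF C'(1)] C'(2) by auto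
      finally show "r = f (?cl x)" using C' by simp
    qed
  qed
  moreover have "card ?R = card (residue_classes nv)" by (rule card_image[OF inj])
  ultimately show ?thesis using finite_residue f by (intro exI[of _ ?R]) (auto simp: q_def)
qed

text \<open>Haar measure on \<open>F\<close> is replaced by Riemann sums over transversals: \<open>transv r s S\<close> says that
  \<open>S\<close> represents the ball of radius \<open>r\<close> modulo the ball of radius \<open>s\<close>.\<close>

definition transv :: "real \<Rightarrow> real \<Rightarrow> 'a set \<Rightarrow> bool" where
  "transv r s S \<longleftrightarrow> finite S \<and> S \<subseteq> {x. nv x \<le> r} \<and>
     (\<forall>x. nv x \<le> r \<longrightarrow> (\<exists>!y. y \<in> S \<and> nv (x - y) \<le> s))"

lemma transv_scale:
  assumes "transv r s S" "a \<noteq> 0"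
  shows "transv (nv a * r) (nv a * s) ((*) a ` S)"
proof -
  have pos: "nv a > 0" using assms by simp
  have "\<exists>!y. y \<in> (*) a ` S \<and> nv (x - y) \<le> nv a * s" if x: "nv x \<le> nv a * r" for x
  proof -
    have "nv (x / a) \<le> r" using x pos by (simp add: nv_divide divide_simps mult.commute)
    then obtain y where y: "y \<in> S" "nv (x / a - y) \<le> s"
        "\<And>z. z \<in> S \<Longrightarrow> nv (x / a - z) \<le> s \<Longrightarrow> z = y"
      using assms(1) unfolding transv_def by blast
    have e: "nv (x - a * z) \<le> nv a * s \<longleftrightarrow> nv (x / a - z) \<le> s" for z
    proof -
      have "x - a * z = a * (x / a - z)" using assms by (simp add: field_simps)
      thus ?thesis using pos by (simp add: nv_mult)
    qed
    show ?thesis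
    proof (rule ex1I[of _ "a * y"])
      show "a * y \<in> (*) a ` S \<and> nv (x - a * y) \<le> nv a * s" unfolding e using y by blast
      show "z = a * y" if "z \<in> (*) a ` S \<and> nv (x - z) \<le> nv a * s" for z
        using that y(3) e by blast
    qed
  qed
  thus ?thesis using assms pos unfolding transv_def by (auto simp: nv_mult)
qed

text \<open>Expansion in powers of the uniformizer: a point of the larger ball is a leading digit
  times an element \<open>a\<close> of norm \<open>q ^ Suc n\<close>, plus a point of the smaller
  ball. Each step multiplies the size by \<open>q\<close>.\<close>

lemma ex_transv_powi_1: "\<exists>S. transv (q ^ n) 1 S \<and> real (card S) = q ^ n"
proof (induction n)
  case 0
  have "transv 1 1 {0}" unfolding transv_def by auto
  thus ?case by (intro exI[of _ "{0}"]) auto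
next
  case (Suc n)
  then obtain S where S: "transv (q ^ n) 1 S" "real (card S) = q ^ n" by auto
  obtain R where R: "finite R" "real (card R) = q" "R \<subseteq> {x. nv x \<le> 1}"
    "\<And>x. nv x \<le> 1 \<Longrightarrow> \<exists>!r. r \<in> R \<and> nv (x - r) < 1" using ex_digits by blast
  define a where "a = inverse unif ^ Suc n"
  have a: "nv a = q ^ Suc n" "a \<noteq> 0"
    by (simp_all add: a_def nv_power nv_inverse nv_unif divide_inverse nv_mult)
  let ?f = "\<lambda>(r, y). a * r + y"
  let ?S = "?f ` (R \<times> S)"
  have Sr: "nv y \<le> q ^ n" if "y \<in> S" for y using S(1) that by (auto simp: transv_def)
  have qq: "q ^ n < q ^ Suc n" using q_gt_1 by simp
  have q1: "1 \<le> q ^ n" using q_gt_1 by (simp add: one_le_power)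
  \<comment> \<open>The remainders and the allowed error have norm at most \<open>q ^ n\<close>,
    strictly below \<open>nv a\<close>, so the leading digits agree modulo the maximal ideal. This
    tolerance covers both equality, for injectivity, and distance 1, for uniqueness of the
    representative.\<close>
  have ur: "r = r'" if "r \<in> R" "r' \<in> R" "nv y \<le> q ^ n" "nv y' \<le> q ^ n"
      "nv ((a * r + y) - (a * r' + y')) \<le> q ^ n" for r r' y y'
  proof -
    have "a * (r - r') = ((a * r + y) - (a * r' + y')) - (y - y')" by (simp add: algebra_simps)
    hence "nv (a * (r - r')) \<le> q ^ n" using that by (metis nv_diff_le)
    hence "nv (a * (r - r')) < nv a" using a(1) qq by linarith
    hence "nv a * nv (r - r') < nv a * 1" by (simp add: nv_mult)
    hence "nv (r - r') < 1" using a(2) mult_less_cancel_left_pos nv_pos by blast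
    moreover have "nv r \<le> 1" using R that by auto
    ultimately show ?thesis using R(4)[of r] that by auto
  qed
  have inj: "inj_on ?f (R \<times> S)"
  proof (rule inj_onI, clarify)
    fix r y r' y' assume h: "r \<in> R" "y \<in> S" "r' \<in> R" "y' \<in> S" "a * r + y = a * r' + y'"
    have "r = r'" by (rule ur[of r r' y y']) (use h Sr q1 in auto)
    thus "r = r' \<and> y = y'" using h by simp
  qed
  have card: "real (card ?S) = q ^ Suc n" using card_image[OF inj] R S by (simp add: card_cartesian_product)
  have sub: "nv (a * r + y) \<le> q ^ Suc n" if "r \<in> R" "y \<in> S" for r y
  proof (rule nv_add_le)
    have "nv r \<le> 1" using R that by auto
    thus "nv (a * r) \<le> q ^ Suc n" using a by (simp add: nv_mult mult_left_le)
    show "nv y \<le> q ^ Suc n" using Sr[OF that(2)] qq by linarith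
  qed
  have ex: "\<exists>!z. z \<in> ?S \<and> nv (x - z) \<le> 1" if x: "nv x \<le> q ^ Suc n" for x
  proof -
    have "nv (x / a) \<le> 1" using x a by (simp add: nv_divide)
    then obtain r where r: "r \<in> R" "nv (x / a - r) < 1" using R(4) by blast
    have "nv (x / a - r) \<le> 1 / q" using r nv_less_1_iff by blast
    hence "nv a * nv (x / a - r) \<le> q ^ Suc n * (1 / q)"
      unfolding a(1) by (intro mult_left_mono) auto
    hence "nv (a * (x / a - r)) \<le> q ^ n" by (simp add: nv_mult)
    moreover have "a * (x / a - r) = x - a * r" using a by (simp add: field_simps)
    ultimately have "nv (x - a * r) \<le> q ^ n" by simp
    then obtain y where y: "y \<in> S" "nv (x - a * r - y) \<le> 1"
      using S(1) unfolding transv_def by blast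
    show ?thesis
    proof (rule ex1I[of _ "a * r + y"])
      show "a * r + y \<in> ?S \<and> nv (x - (a * r + y)) \<le> 1" using r y by (auto simp: diff_diff_eq)
    next
      fix z assume z: "z \<in> ?S \<and> nv (x - z) \<le> 1"
      then obtain r' y' where z': "r' \<in> R" "y' \<in> S" "z = a * r' + y'" by auto
      have d: "nv ((a * r + y) - z) \<le> 1"
        using nv_diff_le[of "x - z" 1 "x - (a * r + y)"] z y by (simp add: diff_diff_eq)
      have rr: "r = r'" using ur[of r r' y y'] z' r y Sr d q1 by auto
      have "nv (y - y') \<le> 1" using d z' rr by simp
      hence "y' = y" using S(1) y z' Sr[of y] unfolding transv_def
        by (metis diff_self nv_0 zero_le_one)
      thus "z = a * r + y" using z' rr by simp
    qed
  qed
  show ?case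
    by (intro exI[of _ ?S] conjI card) (use R S sub ex in \<open>auto simp: transv_def\<close>)
qed

lemma ex_transv_powi:
  assumes "s = nv b" "b \<noteq> 0"
  shows "\<exists>S. transv (q ^ n * s) s S \<and> real (card S) = q ^ n"
proof -
  obtain S where S: "transv (q ^ n) 1 S" "real (card S) = q ^ n" using ex_transv_powi_1 by auto
  have "inj_on ((*) b) S" using assms by (auto intro: inj_onI)
  thus ?thesis using transv_scale[OF S(1) assms(2)] S(2) assms(1)
    by (intro exI[of _ "(*) b ` S"]) (auto simp: card_image mult.commute[of "q ^ n"])
qed

text \<open>Sending a point of one transversal to its representative in the other is injective,
  because a ball of radius \<open>s\<close> meets a transversal only once. This transfers the size
  of the constructed transversals to all others.\<close>

lemma transv_card_unique:
  assumes "transv r s S" "transv r s S'"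
  shows "card S = card S'"
proof -
  have le: "card S \<le> card S'" if a: "transv r s S" "transv r s S'" for S S'
  proof -
    define h where "h = (\<lambda>x. THE y. y \<in> S' \<and> nv (x - y) \<le> s)"
    have h: "h x \<in> S' \<and> nv (x - h x) \<le> s" if "x \<in> S" for x
      unfolding h_def by (rule theI') (use a that in \<open>auto simp: transv_def\<close>)
    have "inj_on h S"
    proof (rule inj_onI)
      fix x y assume xy: "x \<in> S" "y \<in> S" "h x = h y"
      have "nv (h x - x) \<le> s" "nv (h x - y) \<le> s" using h[of x] h[of y] xy by (auto simp: nv_diff_commute)
      moreover have "nv (h x) \<le> r" using h[OF xy(1)] a by (auto simp: transv_def)
      ultimately show "x = y" using a(1) xy unfolding transv_def by blast
    qed
    thus ?thesis using h a by (intro card_inj_on_le[of h]) (auto simp: transv_def)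
  qed
  show ?thesis using le[OF assms] le[OF assms(2,1)] by simp
qed

lemma transv_card:
  assumes "transv (nv a) (nv b) S" "a \<noteq> 0" "b \<noteq> 0" "nv b \<le> nv a"
  shows "real (card S) = nv a / nv b"
proof -
  obtain k where k: "nv a = q powi k" using nv_value assms by blast
  obtain l where l: "nv b = q powi l" using nv_value assms by blast
  have lk: "l \<le> k" using assms k l q_powi_le_iff by auto
  have e: "q ^ nat (k - l) * nv b = nv a"
    using lk by (simp add: k l flip: power_int_add power_int_of_nat)
  obtain S' where S': "transv (q ^ nat (k - l) * nv b) (nv b) S'" "real (card S') = q ^ nat (k - l)"
    using ex_transv_powi[OF refl assms(3)] by blast
  have "card S = card S'" using transv_card_unique[OF assms(1)] S'(1) e by simp
  thus ?thesis using S' e assms by (simp add: divide_simps)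
qed

lemma ex_nv_ge: "\<exists>a. a \<noteq> 0 \<and> nv a \<ge> r"
proof -
  obtain n where "r < q ^ n" using real_arch_pow[OF q_gt_1] by blast
  moreover have "nv (inverse unif ^ n) = q ^ n" by (simp add: nv_power nv_inverse nv_unif)
  ultimately show ?thesis by (intro exI[of _ "inverse unif ^ n"]) auto
qed

lemma ex_nv_le: "s > 0 \<Longrightarrow> \<exists>a. a \<noteq> 0 \<and> nv a \<le> s"
proof -
  assume s: "s > 0"
  obtain a where a: "a \<noteq> 0" "nv a \<ge> inverse s" using ex_nv_ge by blast
  show ?thesis by (rule exI[of _ "inverse a"])
    (use a s le_imp_inverse_le[of "inverse s" "nv a"] in \<open>auto simp: nv_inverse\<close>)
qed

lemma ex_transv:
  assumes "a \<noteq> 0" "b \<noteq> 0" "nv b \<le> nv a"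
  shows "\<exists>S. transv (nv a) (nv b) S"
proof -
  obtain k where k: "nv a = q powi k" using nv_value assms by blast
  obtain l where l: "nv b = q powi l" using nv_value assms by blast
  have lk: "l \<le> k" using assms k l q_powi_le_iff by auto
  have e: "q ^ nat (k - l) * nv b = nv a"
    using lk by (simp add: k l flip: power_int_add power_int_of_nat)
  show ?thesis using ex_transv_powi[OF refl assms(2), of "nat (k - l)"] e by auto
qed

section \<open>Integration on the field and on the plane\<close>

text \<open>A Schwartz function comes with an explicit support radius and an explicit invariance
  radius: exactly the data that a Riemann sum needs.\<close>

definition level :: "('a \<Rightarrow> complex) \<Rightarrow> real \<Rightarrow> real \<Rightarrow> bool" where
  "level \<phi> r s \<longleftrightarrow> (\<forall>x. \<phi> x \<noteq> 0 \<longrightarrow> nv x \<le> r) \<and> (\<forall>x u. nv u \<le> s \<longrightarrow> \<phi> (x + u) = \<phi> x)"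

definition sch1 :: "('a \<Rightarrow> complex) \<Rightarrow> bool" where
  "sch1 \<phi> \<longleftrightarrow> (\<exists>r. \<exists>s>0. level \<phi> r s)"

lemma level_mono: "level \<phi> r s \<Longrightarrow> r \<le> r' \<Longrightarrow> s' \<le> s \<Longrightarrow> level \<phi> r' s'"
  unfolding level_def by force

lemma level_close: "level \<phi> r s \<Longrightarrow> nv (y - x) \<le> s \<Longrightarrow> \<phi> y = \<phi> x"
  unfolding level_def by (metis add.commute diff_add_cancel)

text \<open>Each coarse ball on which the function does not vanish splits into
  \<open>nv b / nv b'\<close> fine balls. Only the two mesh radii are compared; the support radii
  \<open>nv a\<close> and \<open>nv a'\<close> are unrelated.\<close>

lemma riemann_sum_refine:
  assumes nz: "a \<noteq> 0" "b \<noteq> 0" "a' \<noteq> 0" "b' \<noteq> 0" and le: "nv b \<le> nv a" "nv b' \<le> nv b"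
    and lev: "level \<phi> (nv a) (nv b)" "level \<phi> (nv a') (nv b')"
    and S: "transv (nv a) (nv b) S" and S': "transv (nv a') (nv b') S'"
  shows "of_real (nv b) * sum \<phi> S = of_real (nv b') * sum \<phi> S'"
proof -
  let ?A = "\<lambda>x. {y \<in> S'. nv (y - x) \<le> nv b}"
  have fin: "finite S" "finite S'" using S S' by (auto simp: transv_def)
  have disj: "?A x \<inter> ?A x' = {}" if "x \<in> S" "x' \<in> S" "x \<noteq> x'" for x x'
  proof (rule ccontr)
    assume "?A x \<inter> ?A x' \<noteq> {}"
    then obtain y where y: "nv (y - x) \<le> nv b" "nv (y - x') \<le> nv b" by blast
    have "nv x \<le> nv a" using S that by (auto simp: transv_def)
    hence "nv y \<le> nv a" using nv_add_le[of "y - x" "nv a" x] y le by simp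
    thus False using S that y unfolding transv_def by blast
  qed
  have sub: "{y \<in> S'. \<phi> y \<noteq> 0} \<subseteq> (\<Union>x\<in>S. ?A x)"
  proof clarify
    fix y assume y: "y \<in> S'" "\<phi> y \<noteq> 0"
    hence "nv y \<le> nv a" using lev by (auto simp: level_def)
    then obtain x where "x \<in> S" "nv (y - x) \<le> nv b" using S unfolding transv_def by blast
    thus "y \<in> (\<Union>x\<in>S. ?A x)" using y by blast
  qed
  \<comment> \<open>The count is claimed only after multiplication by \<open>\<phi> x\<close>: where
    this is nonzero, the whole coarse ball lies in the support, hence within \<open>nv a'\<close>,
    and is therefore covered by \<open>S'\<close>.\<close>
  have card: "of_nat (card (?A x)) * \<phi> x = of_real (nv b / nv b') * \<phi> x" if x: "x \<in> S" for x
  proof (cases "\<phi> x = 0")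
    case False
    have "transv (nv b) (nv b') ((\<lambda>y. y - x) ` ?A x)"
      unfolding transv_def
    proof (intro conjI allI impI)
      show "finite ((\<lambda>y. y - x) ` ?A x)" using fin by auto
      show "(\<lambda>y. y - x) ` ?A x \<subseteq> {x. nv x \<le> nv b}" by auto
      fix z assume z: "nv z \<le> nv b"
      have "\<phi> (x + z) = \<phi> x" using lev(1) z by (auto simp: level_def)
      hence "nv (x + z) \<le> nv a'" using lev(2) False by (auto simp: level_def)
      then obtain y where y: "y \<in> S'" "nv (x + z - y) \<le> nv b'"
          "\<And>y'. y' \<in> S' \<Longrightarrow> nv (x + z - y') \<le> nv b' \<Longrightarrow> y' = y"
        using S' unfolding transv_def by blast
      have e: "z - (y - x) = x + z - y" for y by simp
      have "nv (z - (x + z - y)) \<le> nv b" using nv_diff_le[OF z, of "x + z - y"] y(2) le by linarith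
      hence "nv (y - x) \<le> nv b" by simp
      thus "\<exists>!w. w \<in> (\<lambda>y. y - x) ` ?A x \<and> nv (z - w) \<le> nv b'"
      proof (intro ex1I[of _ "y - x"])
        show "y - x \<in> (\<lambda>y. y - x) ` ?A x \<and> nv (z - (y - x)) \<le> nv b'"
          unfolding e using y \<open>nv (y - x) \<le> nv b\<close> by blast
        fix w assume "w \<in> (\<lambda>y. y - x) ` ?A x \<and> nv (z - w) \<le> nv b'"
        then obtain v where "v \<in> S'" "w = v - x" "nv (z - (v - x)) \<le> nv b'" by blast
        thus "w = y - x" using y(3)[of v] unfolding e by blast
      qed
    qed
    hence "real (card ((\<lambda>y. y - x) ` ?A x)) = nv b / nv b'" using transv_card nz le by blast
    moreover have "card ((\<lambda>y. y - x) ` ?A x) = card (?A x)" by (rule card_image) (auto intro: inj_onI)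
    ultimately have "real (card (?A x)) = nv b / nv b'" by simp
    hence "complex_of_real (real (card (?A x))) = of_real (nv b / nv b')" by (rule arg_cong)
    thus ?thesis by simp
  qed simp
  have "sum \<phi> S' = sum \<phi> (\<Union>x\<in>S. ?A x)"
    by (rule sum.mono_neutral_right) (use fin sub in auto)
  also have "\<dots> = (\<Sum>x\<in>S. \<Sum>y\<in>?A x. \<phi> y)"
    by (rule sum.UNION_disjoint) (use fin disj in auto)
  also have "\<dots> = (\<Sum>x\<in>S. of_real (nv b / nv b') * \<phi> x)"
  proof (rule sum.cong[OF refl])
    fix x assume x: "x \<in> S"
    have "\<phi> y = \<phi> x" if "y \<in> ?A x" for y
      using level_close[OF lev(1), of y x] that by simp
    hence "(\<Sum>y\<in>?A x. \<phi> y) = (\<Sum>y\<in>?A x. \<phi> x)" by (intro sum.cong) auto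
    thus "(\<Sum>y\<in>?A x. \<phi> y) = of_real (nv b / nv b') * \<phi> x" using card[OF x] by simp
  qed
  also have "\<dots> = of_real (nv b / nv b') * sum \<phi> S" by (simp only: sum_distrib_left)
  finally show ?thesis using nz by simp
qed

lemma riemann_sum_unique:
  assumes "a \<noteq> 0" "b \<noteq> 0" "a' \<noteq> 0" "b' \<noteq> 0" and "nv b \<le> nv a" "nv b' \<le> nv a'"
    and "level \<phi> (nv a) (nv b)" "level \<phi> (nv a') (nv b')"
    and "transv (nv a) (nv b) S" and "transv (nv a') (nv b') S'"
  shows "of_real (nv b) * sum \<phi> S = of_real (nv b') * sum \<phi> S'"
  using riemann_sum_refine[OF assms(1-5) _ assms(7-10)]
    riemann_sum_refine[OF assms(3,4,1,2,6) _ assms(8,7,10,9)] by fastforce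

text \<open>The Haar integral giving the ring of integers volume 1, as the common value of all
  admissible Riemann sums. It is meaningful only for functions satisfying
  \<open>sch1\<close>.\<close>

definition integ :: "('a \<Rightarrow> complex) \<Rightarrow> complex" where
  "integ \<phi> = (THE c. \<exists>a b S. a \<noteq> 0 \<and> b \<noteq> 0 \<and> nv b \<le> nv a \<and> level \<phi> (nv a) (nv b) \<and>
     transv (nv a) (nv b) S \<and> c = of_real (nv b) * sum \<phi> S)"

lemma integ_eq:
  assumes "a \<noteq> 0" "b \<noteq> 0" "nv b \<le> nv a" "level \<phi> (nv a) (nv b)" "transv (nv a) (nv b) S"
  shows "integ \<phi> = of_real (nv b) * sum \<phi> S"
  unfolding integ_def
proof (rule the_equality)
  show "\<exists>a' b' S'. a' \<noteq> 0 \<and> b' \<noteq> 0 \<and> nv b' \<le> nv a' \<and> level \<phi> (nv a') (nv b') \<and>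
     transv (nv a') (nv b') S' \<and> of_real (nv b) * sum \<phi> S = of_real (nv b') * sum \<phi> S'"
    using assms by (intro exI[of _ a] exI[of _ b] exI[of _ S]) simp
next
  fix c assume "\<exists>a b S. a \<noteq> 0 \<and> b \<noteq> 0 \<and> nv b \<le> nv a \<and> level \<phi> (nv a) (nv b) \<and>
     transv (nv a) (nv b) S \<and> c = of_real (nv b) * sum \<phi> S"
  thus "c = of_real (nv b) * sum \<phi> S" using assms riemann_sum_unique by blast
qed

lemma ex_radii:
  assumes "s > 0"
  shows "\<exists>a b. a \<noteq> 0 \<and> b \<noteq> 0 \<and> nv b \<le> nv a \<and> r \<le> nv a \<and> nv b \<le> s"
proof -
  obtain b where b: "b \<noteq> 0" "nv b \<le> s" using ex_nv_le[OF assms] by blast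
  obtain a where "a \<noteq> 0" "nv a \<ge> max r (nv b)" using ex_nv_ge by blast
  thus ?thesis using b by (intro exI[of _ a] exI[of _ b]) auto
qed

lemma sch1_pairE:
  assumes "sch1 \<phi>" "sch1 \<psi>"
  obtains a b S where "a \<noteq> 0" "b \<noteq> 0" "nv b \<le> nv a" "level \<phi> (nv a) (nv b)" "level \<psi> (nv a) (nv b)"
    "transv (nv a) (nv b) S" "r0 \<le> nv a"
proof -
  obtain r s r' s' where h: "s > 0" "s' > 0" "level \<phi> r s" "level \<psi> r' s'"
    using assms unfolding sch1_def by blast
  obtain a b where ab: "a \<noteq> 0" "b \<noteq> 0" "nv b \<le> nv a" "max r0 (max r r') \<le> nv a" "nv b \<le> min s s'"
    using ex_radii[of "min s s'" "max r0 (max r r')"] h by auto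
  obtain S where "transv (nv a) (nv b) S" using ex_transv ab by blast
  thus ?thesis using that[of a b S] ab h level_mono[OF h(3), of "nv a" "nv b"]
      level_mono[OF h(4), of "nv a" "nv b"] by auto
qed

lemma sch1_add: "sch1 \<phi> \<Longrightarrow> sch1 \<psi> \<Longrightarrow> sch1 (\<lambda>x. \<phi> x + \<psi> x)"
  by (erule (1) sch1_pairE[of _ _ 0]) (unfold sch1_def level_def, metis (no_types, lifting) add_0 nv_pos)

lemma sch1_cmult: "sch1 \<phi> \<Longrightarrow> sch1 (\<lambda>x. c * \<phi> x)"
  unfolding sch1_def level_def by (metis mult_zero_right)

lemma integ_add:
  assumes "sch1 \<phi>" "sch1 \<psi>"
  shows "integ (\<lambda>x. \<phi> x + \<psi> x) = integ \<phi> + integ \<psi>"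
proof -
  obtain a b S where h: "a \<noteq> 0" "b \<noteq> 0" "nv b \<le> nv a" "level \<phi> (nv a) (nv b)" "level \<psi> (nv a) (nv b)"
    "transv (nv a) (nv b) S" using sch1_pairE[OF assms] by metis
  have "level (\<lambda>x. \<phi> x + \<psi> x) (nv a) (nv b)"
    using h(4,5) unfolding level_def by (metis add_0)
  thus ?thesis using integ_eq[OF h(1-3) _ h(6)] h(4,5) by (simp only: sum.distrib distrib_left)
qed

lemma integ_cmult:
  assumes "sch1 \<phi>"
  shows "integ (\<lambda>x. c * \<phi> x) = c * integ \<phi>"
proof -
  obtain a b S where h: "a \<noteq> 0" "b \<noteq> 0" "nv b \<le> nv a" "level \<phi> (nv a) (nv b)"
    "transv (nv a) (nv b) S" using sch1_pairE[OF assms assms] by metis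
  have "level (\<lambda>x. c * \<phi> x) (nv a) (nv b)"
    using h(4) unfolding level_def by (metis mult_zero_right)
  thus ?thesis using integ_eq[OF h(1-3) _ h(5)] h(4)
    by (simp only: sum_distrib_left[symmetric] mult.left_commute)
qed

lemma transv_translate:
  assumes "transv r s S" "nv t \<le> r"
  shows "transv r s ((\<lambda>x. x + t) ` S)"
proof -
  have "\<exists>!y. y \<in> (\<lambda>x. x + t) ` S \<and> nv (x - y) \<le> s" if x: "nv x \<le> r" for x
  proof -
    have "nv (x - t) \<le> r" using x assms nv_diff_le by blast
    then obtain y where y: "y \<in> S" "nv (x - t - y) \<le> s" "\<And>z. z \<in> S \<Longrightarrow> nv (x - t - z) \<le> s \<Longrightarrow> z = y"
      using assms(1) unfolding transv_def by blast
    have e: "x - (z + t) = x - t - z" for z by simp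
    show ?thesis
    proof (rule ex1I[of _ "y + t"])
      show "y + t \<in> (\<lambda>x. x + t) ` S \<and> nv (x - (y + t)) \<le> s" unfolding e using y by blast
      fix w assume "w \<in> (\<lambda>x. x + t) ` S \<and> nv (x - w) \<le> s"
      then obtain v where "v \<in> S" "w = v + t" "nv (x - (v + t)) \<le> s" by blast
      thus "w = y + t" using y(3)[of v] unfolding e by blast
    qed
  qed
  thus ?thesis using assms nv_add_le unfolding transv_def by auto
qed

lemma level_affine:
  assumes "level \<phi> r s" "e \<noteq> 0" "nv t \<le> r"
  shows "level (\<lambda>y. \<phi> (e * y + t)) (r / nv e) (s / nv e)"
  unfolding level_def
proof (intro conjI allI impI)
  fix x assume "\<phi> (e * x + t) \<noteq> 0"
  hence "nv (e * x + t) \<le> r" using assms by (auto simp: level_def)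
  hence "nv (e * x) \<le> r" using nv_diff_le[of "e * x + t" r t] assms by simp
  thus "nv x \<le> r / nv e" using assms by (simp add: nv_mult field_simps)
next
  fix x u assume "nv u \<le> s / nv e"
  hence "nv (e * u) \<le> s" using assms by (simp add: nv_mult field_simps)
  hence "\<phi> ((e * x + t) + e * u) = \<phi> (e * x + t)" using assms by (auto simp: level_def)
  thus "\<phi> (e * (x + u) + t) = \<phi> (e * x + t)" by (simp add: algebra_simps)
qed

text \<open>The substitution is applied to the transversal itself. The support radius is first
  enlarged to contain \<open>t\<close>, so that translation by \<open>t\<close> preserves the
  ball.\<close>

lemma integ_affine:
  assumes "sch1 \<phi>" "e \<noteq> 0"
  shows "integ (\<lambda>y. \<phi> (e * y + t)) = integ \<phi> / of_real (nv e)"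
proof -
  obtain a b S where h: "a \<noteq> 0" "b \<noteq> 0" "nv b \<le> nv a" "level \<phi> (nv a) (nv b)"
    "transv (nv a) (nv b) S" "nv t \<le> nv a" using sch1_pairE[OF assms(1,1)] by metis
  let ?T = "(\<lambda>x. x + - t) ` S" let ?S = "(*) (1 / e) ` ?T"
  have "transv (nv a) (nv b) ?T" using h transv_translate[of "nv a" "nv b" S "- t"] by simp
  hence S: "transv (nv (a / e)) (nv (b / e)) ?S"
    using transv_scale[of "nv a" "nv b" ?T "1 / e"] assms by (simp add: nv_divide)
  have l: "level (\<lambda>y. \<phi> (e * y + t)) (nv (a / e)) (nv (b / e))"
    using level_affine[OF h(4) assms(2) h(6)] by (simp add: nv_divide)
  have "integ (\<lambda>y. \<phi> (e * y + t)) = of_real (nv (b / e)) * sum (\<lambda>y. \<phi> (e * y + t)) ?S"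
    by (rule integ_eq[OF _ _ _ l S]) (use h assms in \<open>auto simp: nv_divide divide_right_mono\<close>)
  also have "sum (\<lambda>y. \<phi> (e * y + t)) ?S = sum \<phi> S"
    unfolding image_image using assms
    by (subst sum.reindex) (auto intro!: inj_onI simp: field_simps)
  also have "of_real (nv (b / e)) * sum \<phi> S = integ \<phi> / of_real (nv e)"
    using integ_eq[OF h(1-5)] by (simp add: nv_divide)
  finally show ?thesis .
qed

lemma level_ball: "level (\<lambda>x. if nv x \<le> nv a then 1 else 0) (nv a) (nv a)"
proof -
  have "nv (x + u) \<le> nv a \<longleftrightarrow> nv x \<le> nv a" if "nv u \<le> nv a" for x u
    using nv_add_le[of x "nv a" u] nv_diff_le[of "x + u" "nv a" u] that by auto
  thus ?thesis unfolding level_def by auto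
qed

lemma sch1_ball: "a \<noteq> 0 \<Longrightarrow> sch1 (\<lambda>x. if nv x \<le> nv a then 1 else 0)"
  unfolding sch1_def using level_ball[of a] by (metis nv_pos)

lemma integ_ball:
  assumes "a \<noteq> 0"
  shows "integ (\<lambda>x. if nv x \<le> nv a then 1 else 0) = of_real (nv a)"
proof -
  have "transv (nv a) (nv a) {0}" unfolding transv_def by auto
  thus ?thesis using integ_eq[OF assms assms order_refl level_ball] by simp
qed

lemma sphere_eq:
  assumes "a \<noteq> 0"
  shows "(\<lambda>x. if nv x = nv a then 1 else (0::complex)) =
     (\<lambda>x. (if nv x \<le> nv a then 1 else 0) + (-1) * (if nv x \<le> nv (a * unif) then 1 else 0))"
proof
  fix x
  have "nv x \<le> nv (a * unif) \<longleftrightarrow> nv x < nv a"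
    using nv_less_iff[OF assms, of x] by (simp add: nv_mult nv_unif)
  thus "(if nv x = nv a then 1 else (0::complex)) =
     (if nv x \<le> nv a then 1 else 0) + (-1) * (if nv x \<le> nv (a * unif) then 1 else 0)" by auto
qed

lemma sch1_sphere: "a \<noteq> 0 \<Longrightarrow> sch1 (\<lambda>x. if nv x = nv a then 1 else 0)"
  by (subst sphere_eq, assumption) (intro sch1_add sch1_cmult sch1_ball; simp)

lemma integ_sphere:
  assumes "a \<noteq> 0"
  shows "integ (\<lambda>x. if nv x = nv a then 1 else 0) = of_real (nv a * (1 - 1 / q))"
proof -
  have nz: "a * unif \<noteq> 0" using assms by simp
  have "integ (\<lambda>x. if nv x = nv a then 1 else 0) = of_real (nv a) + (-1) * of_real (nv (a * unif))"
    unfolding sphere_eq[OF assms] integ_add[OF sch1_ball[OF assms] sch1_cmult[OF sch1_ball[OF nz]]]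
      integ_cmult[OF sch1_ball[OF nz]] integ_ball[OF assms] integ_ball[OF nz] by (rule refl)
  thus ?thesis by (simp add: nv_mult nv_unif algebra_simps)
qed

section \<open>Integration on the plane and linear substitutions\<close>

definition level2 :: "('a \<Rightarrow> 'a \<Rightarrow> complex) \<Rightarrow> real \<Rightarrow> real \<Rightarrow> bool" where
  "level2 \<phi> r s \<longleftrightarrow> (\<forall>x y. \<phi> x y \<noteq> 0 \<longrightarrow> nv x \<le> r \<and> nv y \<le> r) \<and>
     (\<forall>x y u v. nv u \<le> s \<longrightarrow> nv v \<le> s \<longrightarrow> \<phi> (x + u) (y + v) = \<phi> x y)"

definition sch2 :: "('a \<Rightarrow> 'a \<Rightarrow> complex) \<Rightarrow> bool" where
  "sch2 \<phi> \<longleftrightarrow> (\<exists>r. \<exists>s>0. level2 \<phi> r s)"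

definition integ2 :: "('a \<Rightarrow> 'a \<Rightarrow> complex) \<Rightarrow> complex" where
  "integ2 \<phi> = integ (\<lambda>x. integ (\<phi> x))"

lemma level2_mono: "level2 \<phi> r s \<Longrightarrow> r \<le> r' \<Longrightarrow> s' \<le> s \<Longrightarrow> level2 \<phi> r' s'"
  unfolding level2_def by (meson order_trans)

lemma sch2_pairE:
  assumes "sch2 \<phi>" "sch2 \<psi>"
  obtains a b S where "a \<noteq> 0" "b \<noteq> 0" "nv b \<le> nv a" "level2 \<phi> (nv a) (nv b)" "level2 \<psi> (nv a) (nv b)"
    "transv (nv a) (nv b) S"
proof -
  obtain r s r' s' where h: "s > 0" "s' > 0" "level2 \<phi> r s" "level2 \<psi> r' s'"
    using assms unfolding sch2_def by blast
  obtain a b where ab: "a \<noteq> 0" "b \<noteq> 0" "nv b \<le> nv a" "max r r' \<le> nv a" "nv b \<le> min s s'"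
    using ex_radii[of "min s s'" "max r r'"] h by auto
  obtain S where "transv (nv a) (nv b) S" using ex_transv ab by blast
  thus ?thesis using that[of a b S] ab h level2_mono[OF h(3), of "nv a" "nv b"]
      level2_mono[OF h(4), of "nv a" "nv b"] by auto
qed

lemma sch2_add:
  assumes "sch2 \<phi>" "sch2 \<psi>" shows "sch2 (\<lambda>x y. \<phi> x y + \<psi> x y)"
proof -
  obtain a b S where h: "a \<noteq> 0" "b \<noteq> 0" "nv b \<le> nv a" "level2 \<phi> (nv a) (nv b)" "level2 \<psi> (nv a) (nv b)"
    "transv (nv a) (nv b) S" using sch2_pairE[OF assms] by metis
  hence "level2 (\<lambda>x y. \<phi> x y + \<psi> x y) (nv a) (nv b)" unfolding level2_def by (metis add_0)
  thus ?thesis using h(2) unfolding sch2_def by (metis nv_pos)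
qed

lemma sch2_cmult: "sch2 \<phi> \<Longrightarrow> sch2 (\<lambda>x y. c * \<phi> x y)"
  unfolding sch2_def level2_def by (metis mult_zero_right)

lemma sch2_swap: "sch2 \<phi> \<Longrightarrow> sch2 (\<lambda>x y. \<phi> y x)"
  unfolding sch2_def level2_def by metis

lemma sch1_zero: "sch1 (\<lambda>_. 0)"
  unfolding sch1_def level_def by (intro exI[of _ 0] exI[of _ 1]) auto

lemma integ_zero: "integ (\<lambda>_. 0) = 0"
  using integ_cmult[OF sch1_zero, of 0] by simp

lemma level2_slice: "level2 \<phi> r s \<Longrightarrow> s \<ge> 0 \<Longrightarrow> level (\<phi> x) r s"
  unfolding level2_def level_def by (metis add_0_right nv_0)

lemma level2_integ:
  assumes "level2 \<phi> r s" "s \<ge> 0"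
  shows "level (\<lambda>x. integ (\<phi> x)) r s"
proof -
  have "nv x \<le> r" if "integ (\<phi> x) \<noteq> 0" for x
  proof (rule ccontr)
    assume "\<not> nv x \<le> r"
    hence "\<phi> x = (\<lambda>_. 0)" using assms unfolding level2_def by blast
    thus False using that integ_zero by simp
  qed
  moreover have "integ (\<phi> (x + u)) = integ (\<phi> x)" if "nv u \<le> s" for x u
  proof -
    have "\<phi> (x + u) = \<phi> x"
    proof
      show "\<phi> (x + u) y = \<phi> x y" for y
        using assms that unfolding level2_def by (metis add_0_right nv_0)
    qed
    thus ?thesis by simp
  qed
  ultimately show ?thesis unfolding level_def by blast
qed

lemma sch2_slice: "sch2 \<phi> \<Longrightarrow> sch1 (\<phi> x)"
  unfolding sch2_def sch1_def using level2_slice less_imp_le by blast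

lemma sch2_integ: "sch2 \<phi> \<Longrightarrow> sch1 (\<lambda>x. integ (\<phi> x))"
  unfolding sch2_def sch1_def using level2_integ less_imp_le by blast

lemma integ2_add: "sch2 \<phi> \<Longrightarrow> sch2 \<psi> \<Longrightarrow> integ2 (\<lambda>x y. \<phi> x y + \<psi> x y) = integ2 \<phi> + integ2 \<psi>"
  unfolding integ2_def by (simp add: integ_add sch2_slice sch2_integ)

lemma integ2_cmult: "sch2 \<phi> \<Longrightarrow> integ2 (\<lambda>x y. c * \<phi> x y) = c * integ2 \<phi>"
  unfolding integ2_def by (simp add: integ_cmult sch2_slice sch2_integ)

lemma integ2_zero: "integ2 (\<lambda>_ _. 0) = 0"
  unfolding integ2_def by (simp add: integ_zero)

lemma integ2_eq:
  assumes "a \<noteq> 0" "b \<noteq> 0" "nv b \<le> nv a" "level2 \<phi> (nv a) (nv b)" "transv (nv a) (nv b) S"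
  shows "integ2 \<phi> = of_real (nv b) * of_real (nv b) * (\<Sum>x\<in>S. \<Sum>y\<in>S. \<phi> x y)"
proof -
  have "integ2 \<phi> = of_real (nv b) * (\<Sum>x\<in>S. integ (\<phi> x))"
    unfolding integ2_def by (rule integ_eq[OF assms(1-3) level2_integ[OF assms(4)] assms(5)]) simp
  also have "(\<Sum>x\<in>S. integ (\<phi> x)) = (\<Sum>x\<in>S. of_real (nv b) * (\<Sum>y\<in>S. \<phi> x y))"
    by (intro sum.cong refl integ_eq[OF assms(1-3) level2_slice[OF assms(4)] assms(5)]) simp
  finally show ?thesis by (simp add: sum_distrib_left mult.assoc)
qed

text \<open>Fubini is the exchange of a finite double sum, since one transversal serves both
  variables.\<close>

lemma integ2_swap:
  assumes "sch2 \<phi>"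
  shows "integ2 (\<lambda>x y. \<phi> y x) = integ2 \<phi>"
proof -
  obtain a b S where h: "a \<noteq> 0" "b \<noteq> 0" "nv b \<le> nv a" "level2 \<phi> (nv a) (nv b)"
    "transv (nv a) (nv b) S" using sch2_pairE[OF assms assms] by metis
  have "level2 (\<lambda>x y. \<phi> y x) (nv a) (nv b)" using h(4) unfolding level2_def by blast
  from integ2_eq[OF h(1-3) this h(5)] integ2_eq[OF h(1-5)] show ?thesis
    using sum.swap[of "\<lambda>x y. \<phi> x y" S S] by simp
qed

text \<open>Cramer's rule recovers \<open>x\<close> and \<open>y\<close> from the two linear forms
  and so bounds the support; the bound \<open>C\<close> on the entries controls the invariance
  radius.\<close>

lemma sch2_linear:
  assumes "sch2 \<phi>" and D: "a * d - b * c \<noteq> 0"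
  shows "sch2 (\<lambda>x y. \<phi> (a * x + b * y) (c * x + d * y))"
proof -
  obtain r s where h: "s > 0" "level2 \<phi> r s" using assms unfolding sch2_def by blast
  define C where "C = max (max (nv a) (nv b)) (max (nv c) (nv d))"
  have C: "nv a \<le> C" "nv b \<le> C" "nv c \<le> C" "nv d \<le> C" by (auto simp: C_def)
  have "C > 0"
  proof (rule ccontr)
    assume "\<not> C > 0"
    hence "nv a \<le> 0" "nv b \<le> 0" using C by linarith+
    hence "nv a = 0" "nv b = 0" using nv_nonneg[of a] nv_nonneg[of b] by linarith+
    thus False using D by simp
  qed
  show ?thesis unfolding sch2_def level2_def
  proof (rule exI[of _ "C * r / nv (a * d - b * c)"], rule exI[of _ "s / C"], intro conjI allI impI)
    show "0 < s / C" using h \<open>C > 0\<close> by simp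
    fix x y
    assume "\<phi> (a * x + b * y) (c * x + d * y) \<noteq> 0"
    hence r: "nv (a * x + b * y) \<le> r" "nv (c * x + d * y) \<le> r" using h unfolding level2_def by auto
    have "(a * d - b * c) * x = d * (a * x + b * y) - b * (c * x + d * y)" by (simp add: algebra_simps)
    hence "nv ((a * d - b * c) * x) \<le> C * r" using r C by (simp only:) (intro nv_diff_le nv_mult_le)
    thus "nv x \<le> C * r / nv (a * d - b * c)" using D by (simp add: nv_mult pos_le_divide_eq mult.commute)
    have "(a * d - b * c) * y = a * (c * x + d * y) - c * (a * x + b * y)" by (simp add: algebra_simps)
    hence "nv ((a * d - b * c) * y) \<le> C * r" using r C by (simp only:) (intro nv_diff_le nv_mult_le)
    thus "nv y \<le> C * r / nv (a * d - b * c)" using D by (simp add: nv_mult pos_le_divide_eq mult.commute)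
  next
    fix x y u v assume uv: "nv u \<le> s / C" "nv v \<le> s / C"
    have s: "s = C * (s / C)" using \<open>C > 0\<close> by simp
    have "nv (a * u + b * v) \<le> s" "nv (c * u + d * v) \<le> s"
      by (subst s, intro nv_add_le nv_mult_le C uv)+
    hence "\<phi> ((a * x + b * y) + (a * u + b * v)) ((c * x + d * y) + (c * u + d * v)) =
      \<phi> (a * x + b * y) (c * x + d * y)" using h unfolding level2_def by blast
    thus "\<phi> (a * (x + u) + b * (y + v)) (c * (x + u) + d * (y + v)) = \<phi> (a * x + b * y) (c * x + d * y)"
      by (simp add: algebra_simps)
  qed
qed

lemma integ2_shear:
  assumes "sch2 \<phi>" "e \<noteq> 0"
  shows "integ2 (\<lambda>x y. \<phi> x (t * x + e * y)) = integ2 \<phi> / of_real (nv e)"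
proof -
  have "integ (\<lambda>y. \<phi> x (t * x + e * y)) = inverse (of_real (nv e)) * integ (\<phi> x)" for x
    using integ_affine[OF sch2_slice[OF assms(1)] assms(2), of x "t * x"]
    by (simp add: add.commute divide_inverse mult.commute)
  thus ?thesis unfolding integ2_def
    by (simp add: integ_cmult[OF sch2_integ[OF assms(1)]] divide_inverse mult.commute)
qed

text \<open>With pivot \<open>a\<close> the map is the composite of
  \<open>(x, y) -> (a x + b y, y)\<close> and \<open>(X, y) -> (X, c/a X + e y)\<close>, where
  \<open>e\<close> is the Schur complement. Each factor changes one variable only, and
  \<open>e * a\<close> is the determinant.\<close>

lemma integ2_linear_aux:
  assumes "sch2 \<phi>" and D: "a * d - b * c \<noteq> 0" and a: "a \<noteq> 0"
  shows "integ2 (\<lambda>x y. \<phi> (a * x + b * y) (c * x + d * y)) = integ2 \<phi> / of_real (nv (a * d - b * c))"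
proof -
  define e where "e = d - b * c / a"
  have e: "e * a = a * d - b * c" using a by (simp add: e_def field_simps)
  have e0: "e \<noteq> 0" using e D by auto
  define \<psi> where "\<psi> = (\<lambda>X y. \<phi> X (c / a * X + e * y))"
  have \<psi>: "sch2 \<psi>" using sch2_linear[OF assms(1), of 1 e 0 "c / a"] e0 by (simp add: \<psi>_def)
  have "(\<lambda>x y. \<phi> (a * x + b * y) (c * x + d * y)) = (\<lambda>x y. \<psi> (b * y + a * x) y)"
  proof (intro ext)
    fix x y
    have "c / a * (b * y + a * x) + e * y = c * x + d * y" using a by (simp add: e_def field_simps)
    thus "\<phi> (a * x + b * y) (c * x + d * y) = \<psi> (b * y + a * x) y"
      unfolding \<psi>_def by (simp add: add.commute)
  qed
  hence "integ2 (\<lambda>x y. \<phi> (a * x + b * y) (c * x + d * y)) = integ2 (\<lambda>x y. \<psi> (b * y + a * x) y)"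
    by (rule arg_cong)
  also have "\<dots> = integ2 (\<lambda>y x. \<psi> (b * y + a * x) y)"
    by (rule integ2_swap[symmetric]) (use sch2_linear[OF \<psi>, of a 1 b 0] a in \<open>simp add: add.commute\<close>)
  also have "\<dots> = integ2 (\<lambda>y x. \<psi> x y) / of_real (nv a)"
    using integ2_shear[OF sch2_swap[OF \<psi>] a, of b] by simp
  also have "integ2 (\<lambda>y x. \<psi> x y) = integ2 \<psi>" by (rule integ2_swap[OF \<psi>])
  also have "integ2 \<psi> = integ2 \<phi> / of_real (nv e)"
    unfolding \<psi>_def by (rule integ2_shear[OF assms(1) e0])
  finally show ?thesis unfolding e[symmetric] nv_mult by simp
qed

text \<open>If \<open>a\<close> vanishes then \<open>b\<close> does not, and exchanging the
  integration variables makes \<open>b\<close> the pivot.\<close>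

lemma integ2_linear:
  assumes "sch2 \<phi>" and D: "a * d - b * c \<noteq> 0"
  shows "integ2 (\<lambda>x y. \<phi> (a * x + b * y) (c * x + d * y)) = integ2 \<phi> / of_real (nv (a * d - b * c))"
proof (cases "a = 0")
  case False thus ?thesis using integ2_linear_aux assms by blast
next
  case True
  hence b: "b \<noteq> 0" using D by auto
  have "integ2 (\<lambda>x y. \<phi> (a * x + b * y) (c * x + d * y)) = integ2 (\<lambda>x y. \<phi> (a * y + b * x) (c * y + d * x))"
    by (rule integ2_swap[OF sch2_linear[OF assms], symmetric])
  also have "\<dots> = integ2 (\<lambda>x y. \<phi> (b * x + a * y) (d * x + c * y))" by (simp add: add.commute)
  also have "\<dots> = integ2 \<phi> / of_real (nv (b * c - a * d))"
    by (rule integ2_linear_aux) (use assms b in \<open>auto simp: mult.commute\<close>)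
  finally show ?thesis by (simp add: nv_diff_commute)
qed

lemma sch2_prod:
  assumes "sch1 f" "sch1 g" shows "sch2 (\<lambda>x y. f x * g y)"
proof -
  obtain a b S where h: "a \<noteq> 0" "b \<noteq> 0" "nv b \<le> nv a" "level f (nv a) (nv b)" "level g (nv a) (nv b)"
    "transv (nv a) (nv b) S" using sch1_pairE[OF assms] by metis
  have "level2 (\<lambda>x y. f x * g y) (nv a) (nv b)"
    using h(4,5) unfolding level_def level2_def by auto
  thus ?thesis using h unfolding sch2_def by (metis nv_pos)
qed

lemma integ2_prod:
  assumes "sch1 f" "sch1 g" shows "integ2 (\<lambda>x y. f x * g y) = integ f * integ g"
  using integ_cmult[OF assms(1), of "integ g"] unfolding integ2_def
  by (simp add: integ_cmult[OF assms(2)] mult.commute)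

end

section \<open>Matrices and Schwartz functions\<close>

lemma mat2_nth [simp]:
  "mat2 a b c d $ 1 $ 1 = a" "mat2 a b c d $ 1 $ 2 = b"
  "mat2 a b c d $ 2 $ 1 = c" "mat2 a b c d $ 2 $ 2 = d"
  by (simp_all add: mat2_def)

lemma mat2_eq_iff: "M = N \<longleftrightarrow> M $ 1 $ 1 = N $ 1 $ 1 \<and> M $ 1 $ 2 = N $ 1 $ 2 \<and>
    M $ 2 $ 1 = N $ 2 $ 1 \<and> M $ 2 $ 2 = (N :: 'a::zero mat2) $ 2 $ 2"
  by (simp add: vec_eq_iff forall_2)

lemma mat2_eta: "mat2 (M $ 1 $ 1) (M $ 1 $ 2) (M $ 2 $ 1) (M $ 2 $ 2) = M"
  by (simp add: mat2_eq_iff)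

lemma mat2_cases: obtains a b c d where "M = mat2 a b c d"
  using mat2_eta by metis

lemma mat2_mult: "mat2 a b c d ** mat2 a' b' c' d' =
    mat2 (a * a' + b * c') (a * b' + b * d') (c * a' + d * c') (c * b' + d * (d' :: 'a::field_char_0))"
  by (simp add: mat2_eq_iff matrix_matrix_mult_def sum_2)

lemma mat2_add: "mat2 a b c d + mat2 a' b' c' d' = mat2 (a + a') (b + b') (c + c') (d + (d' :: 'a::field_char_0))"
  by (simp add: mat2_eq_iff)

lemma mat2_diff: "mat2 a b c d - mat2 a' b' c' d' = mat2 (a - a') (b - b') (c - c') (d - (d' :: 'a::field_char_0))"
  by (simp add: mat2_eq_iff)

lemma mat2_inject [simp]: "mat2 a b c d = mat2 a' b' c' d' \<longleftrightarrow> a = a' \<and> b = b' \<and> c = c' \<and> d = d'"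
  by (simp add: mat2_eq_iff)

lemma det_mat2 [simp]: "det (mat2 a b c d) = a * d - b * (c :: 'a::field_char_0)"
  by (simp add: det_2)

lemma mat_1_mat2: "mat 1 = mat2 1 0 0 (1 :: 'a::field_char_0)"
  by (simp add: mat2_eq_iff mat_def)

lemma zero_mat2: "0 = mat2 0 0 0 (0 :: 'a::field_char_0)"
  by (simp add: mat2_eq_iff)

lemma GL2_iff: "g \<in> GL2 \<longleftrightarrow> det g \<noteq> 0"
  by (simp add: GL2_def invertible_det_nz)

lemma GL2_mult: "g \<in> GL2 \<Longrightarrow> h \<in> GL2 \<Longrightarrow> g ** h \<in> GL2"
  by (simp add: GL2_iff det_mul)

lemma GL2_inv:
  assumes "g \<in> GL2"
  shows "matrix_inv g \<in> GL2" "g ** matrix_inv g = mat 1" "matrix_inv g ** g = mat 1"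
    "det (matrix_inv g) = inverse (det g)"
proof -
  show 1: "g ** matrix_inv g = mat 1" "matrix_inv g ** g = mat 1"
    using someI_ex[of "\<lambda>h. g ** h = mat 1 \<and> h ** g = mat 1"] assms
    by (auto simp: GL2_def invertible_def matrix_inv_def)
  have "det g * det (matrix_inv g) = 1" using arg_cong[OF 1(1), of det] by (simp add: det_mul)
  thus "det (matrix_inv g) = inverse (det g)" "matrix_inv g \<in> GL2"
    using inverse_unique[of "det g" "det (matrix_inv g)"] by (auto simp: GL2_iff)
qed

lemma GL2_inv_inv: "g \<in> GL2 \<Longrightarrow> matrix_inv (matrix_inv g) = g"
  using GL2_inv[of g] GL2_inv[of "matrix_inv g"]
  by (metis matrix_mul_assoc matrix_mul_lid matrix_mul_rid)

lemma mnv_le_iff: "mnv nv M \<le> r \<longleftrightarrow> nv (M $ 1 $ 1) \<le> r \<and> nv (M $ 1 $ 2) \<le> r \<and>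
    nv (M $ 2 $ 1) \<le> r \<and> nv (M $ 2 $ 2) \<le> r"
proof -
  have "mnv nv M \<le> r \<longleftrightarrow> (\<forall>x \<in> range (\<lambda>(i, j). nv (M $ i $ j)). x \<le> r)"
    unfolding mnv_def by (subst Max_le_iff) auto
  thus ?thesis by (simp add: forall_2)
qed

lemma mnv_mat2: "mnv nv (mat2 a b c d) = max (max (nv a) (nv b)) (max (nv c) (nv d))"
proof (rule antisym)
  show "mnv nv (mat2 a b c d) \<le> max (max (nv a) (nv b)) (max (nv c) (nv d))"
    by (auto simp: mnv_le_iff)
  have "nv a \<le> mnv nv (mat2 a b c d) \<and> nv b \<le> mnv nv (mat2 a b c d) \<and>
    nv c \<le> mnv nv (mat2 a b c d) \<and> nv d \<le> mnv nv (mat2 a b c d)"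
    using mnv_le_iff[of nv "mat2 a b c d" "mnv nv (mat2 a b c d)"] by simp
  thus "max (max (nv a) (nv b)) (max (nv c) (nv d)) \<le> mnv nv (mat2 a b c d)" by simp
qed

lemma matrix_inv_mat2:
  fixes a b c d :: "'a::field_char_0"
  assumes "a * d - b * c \<noteq> 0"
  shows "matrix_inv (mat2 a b c d) =
    mat2 (d / (a * d - b * c)) (- b / (a * d - b * c)) (- c / (a * d - b * c)) (a / (a * d - b * c))"
    (is "_ = ?N")
proof -
  have g: "mat2 a b c d \<in> GL2" using assms by (simp add: GL2_iff)
  have "mat2 a b c d ** ?N = mat 1"
    using assms by (simp add: mat2_mult mat_1_mat2 divide_simps)
  hence "matrix_inv (mat2 a b c d) ** (mat2 a b c d ** ?N) = matrix_inv (mat2 a b c d)" by simp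
  thus ?thesis using GL2_inv(3)[OF g] by (simp add: matrix_mul_assoc)
qed

lemma finite_uniform_pos:
  assumes "finite F" "\<And>x. x \<in> F \<Longrightarrow> \<exists>s>(0::real). Q x s" "\<And>x s s'. Q x s \<Longrightarrow> 0 < s' \<Longrightarrow> s' \<le> s \<Longrightarrow> Q x s'"
  shows "\<exists>s>0. \<forall>x\<in>F. Q x s"
  using assms(1,2)
proof (induction F)
  case (insert x F)
  then obtain s where s: "s > 0" "\<forall>x\<in>F. Q x s" by auto
  obtain s' where s': "s' > 0" "Q x s'" using insert by auto
  show ?case
    by (rule exI[of _ "min s s'"]) (use s s' assms(3) in \<open>auto simp: min_def\<close>)
qed (auto intro: exI[of _ 1])

context local_field
begin

section \<open>Norms of matrices and the maximal compact subgroup\<close>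

abbreviation mn :: "'a mat2 \<Rightarrow> real" where "mn \<equiv> mnv nv"

lemma mn_entry_le: "mn M \<le> r \<Longrightarrow> nv (M $ i $ j) \<le> r"
  using mnv_le_iff[of nv M r] exhaust_2[of i] exhaust_2[of j] by auto

lemma mn_nonneg [simp]: "mn M \<ge> 0"
  using mn_entry_le[of M "mn M" 1 1] nv_nonneg[of "M $ 1 $ 1"] by linarith

lemma mn_0 [simp]: "mn 0 = 0" by (simp add: zero_mat2 mnv_mat2)

lemma mn_eq_0: "mn M = 0 \<longleftrightarrow> M = 0"
proof
  assume "mn M = 0"
  hence "nv (M $ i $ j) \<le> 0" for i j using mn_entry_le[of M 0] by simp
  hence "nv (M $ i $ j) = 0" for i j using nv_nonneg[of "M $ i $ j"] by (meson order_antisym)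
  thus "M = 0" by (simp add: vec_eq_iff)
qed simp

lemma mn_pos: "mn M > 0 \<longleftrightarrow> M \<noteq> 0"
  using mn_eq_0[of M] mn_nonneg[of M] by linarith

lemma mn_minus [simp]: "mn (- M) = mn M"
proof -
  have "mn (- M) \<le> r \<longleftrightarrow> mn M \<le> r" for r by (simp add: mnv_le_iff)
  thus ?thesis by (meson order_antisym order_refl)
qed

lemma mn_add_le: "mn M \<le> r \<Longrightarrow> mn N \<le> r \<Longrightarrow> mn (M + N) \<le> r"
  by (auto simp: mnv_le_iff intro: nv_add_le)

lemma mn_diff_le: "mn M \<le> r \<Longrightarrow> mn N \<le> r \<Longrightarrow> mn (M - N) \<le> r"
  by (auto simp: mnv_le_iff intro: nv_diff_le)

lemma mn_diff_commute: "mn (M - N) = mn (N - M)"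
  using mn_minus[of "M - N"] by simp

lemma mn_triangle_le: "mn (M - N) \<le> r \<Longrightarrow> mn (N - L) \<le> r \<Longrightarrow> mn (M - L) \<le> r"
  using mn_add_le[of "M - N" r "N - L"] by simp

lemma mn_mult_le: "mn (M ** N) \<le> mn M * mn N"
proof -
  have "nv (M $ i $ j * N $ k $ l) \<le> mn M * mn N" for i j k l
    unfolding nv_mult by (intro mult_mono) (auto intro: mn_entry_le)
  thus ?thesis by (auto simp: mnv_le_iff matrix_matrix_mult_def sum_2 intro!: nv_add_le)
qed

lemma mn_mult_le': "mn M \<le> r \<Longrightarrow> mn N \<le> s \<Longrightarrow> mn (M ** N) \<le> r * s"
  by (rule order_trans[OF mn_mult_le mult_mono]) (auto intro: order_trans[OF mn_nonneg])

lemma mn_scalar: "mn (mat2 a 0 0 a ** M) = nv a * mn M"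
proof -
  obtain x y z w where M: "M = mat2 x y z w" by (rule mat2_cases)
  show ?thesis unfolding M mat2_mult mnv_mat2
    by (simp add: nv_mult max_mult_distrib_left)
qed

lemma mn_value: "M \<noteq> 0 \<Longrightarrow> \<exists>k::int. mn M = q powi k"
proof -
  assume "M \<noteq> 0"
  hence p: "mn M > 0" by (simp add: mn_pos)
  have "\<exists>i j. mn M = nv (M $ i $ j)"
    using mnv_mat2[of nv "M $ 1 $ 1" "M $ 1 $ 2" "M $ 2 $ 1" "M $ 2 $ 2"]
    unfolding mat2_eta by (metis max_def)
  then obtain i j where "mn M = nv (M $ i $ j)" by blast
  thus ?thesis using nv_value[of "M $ i $ j"] p by auto
qed

lemma nv_det_le: "nv (det M) \<le> mn M * mn M"
proof -
  have "nv (M $ i $ j * M $ k $ l) \<le> mn M * mn M" for i j k l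
    unfolding nv_mult by (intro mult_mono) (auto intro: mn_entry_le)
  thus ?thesis unfolding det_2 by (intro nv_diff_le) auto
qed

text \<open>The adjugate has the same entries up to order and sign.\<close>

lemma mn_inv:
  assumes "g \<in> GL2"
  shows "mn (matrix_inv g) = mn g / nv (det g)"
proof -
  obtain a b c d where g: "g = mat2 a b c d" by (rule mat2_cases)
  have D: "a * d - b * c \<noteq> 0" using assms by (simp add: g GL2_iff)
  have "max (x / D) (y / D) = max x y / D" if "D > 0" for x y D :: real
    using that by (auto simp: max_def divide_le_cancel)
  note mx = this[of "nv (a * d - b * c)"]
  show ?thesis unfolding g matrix_inv_mat2[OF D] mnv_mat2 using D
    by (simp add: nv_divide mx max.commute max.left_commute max.assoc)
qed

text \<open>This is \<open>GL2(O)\<close>: with integral entries, a unit determinant makes the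
  inverse integral as well.\<close>

definition maxK :: "'a mat2 set" where "maxK = {k. mn k \<le> 1 \<and> nv (det k) = 1}"

lemma maxK_GL2: "k \<in> maxK \<Longrightarrow> k \<in> GL2"
  by (auto simp: maxK_def GL2_iff)

lemma maxK_mult: "k \<in> maxK \<Longrightarrow> l \<in> maxK \<Longrightarrow> k ** l \<in> maxK"
  using mn_mult_le'[of k 1 l 1] by (auto simp: maxK_def det_mul nv_mult)

lemma maxK_inv: "k \<in> maxK \<Longrightarrow> matrix_inv k \<in> maxK"
  using maxK_GL2[of k] GL2_inv(4)[of k] mn_inv[of k] by (auto simp: maxK_def nv_inverse)

lemma maxK_1: "mat 1 \<in> maxK"
  by (simp add: maxK_def mat_1_mat2 mnv_mat2)

lemma mn_maxK_left: "k \<in> maxK \<Longrightarrow> mn (k ** M) = mn M"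
proof -
  have le: "mn (k ** M) \<le> mn M" if "k \<in> maxK" for k M
    using that mn_mult_le'[of k 1 M "mn M"] by (auto simp: maxK_def)
  assume k: "k \<in> maxK"
  have "mn (matrix_inv k ** (k ** M)) \<le> mn (k ** M)" by (rule le[OF maxK_inv[OF k]])
  thus ?thesis using le[OF k, of M] GL2_inv(3)[OF maxK_GL2[OF k]] by (simp add: matrix_mul_assoc)
qed

lemma mn_maxK_right: "k \<in> maxK \<Longrightarrow> mn (M ** k) = mn M"
proof -
  have le: "mn (M ** k) \<le> mn M" if "k \<in> maxK" for k M
    using that mn_mult_le'[of M "mn M" k 1] by (auto simp: maxK_def)
  assume k: "k \<in> maxK"
  have "mn ((M ** k) ** matrix_inv k) \<le> mn (M ** k)" by (rule le[OF maxK_inv[OF k]])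
  thus ?thesis using le[OF k, of M] GL2_inv(2)[OF maxK_GL2[OF k]] by (simp flip: matrix_mul_assoc)
qed

lemma maxK_near_1: "mn (k - mat 1) < 1 \<Longrightarrow> k \<in> maxK"
proof -
  assume h: "mn (k - mat 1) < 1"
  obtain a b c d where k: "k = mat2 a b c d" by (rule mat2_cases)
  have l: "nv (a - 1) < 1" "nv b < 1" "nv c < 1" "nv (d - 1) < 1"
    using h by (auto simp: k mat_1_mat2 mat2_diff mnv_mat2)
  have a: "nv a = 1" using nv_eq_if_close[of a 1] l by simp
  have d: "nv d = 1" using nv_eq_if_close[of d 1] l by simp
  have "nv b * nv c < 1 * 1" using l by (intro mult_strict_mono') auto
  hence "nv (b * c) < nv (a * d)" by (simp add: nv_mult a d)
  hence "nv (a * d - b * c) = 1" using nv_diff_absorb[of "b * c" "a * d"] by (simp add: nv_mult a d)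
  thus ?thesis using l a d by (auto simp: maxK_def k mnv_mat2)
qed

section \<open>Compactness through finite nets\<close>

lemma finite_net:
  assumes "s > 0" "s \<le> r"
  shows "\<exists>F. finite F \<and> (\<forall>N\<in>F. mn N \<le> r) \<and> (\<forall>M. mn M \<le> r \<longrightarrow> (\<exists>N\<in>F. mn (M - N) \<le> s))"
proof -
  obtain a b where ab: "a \<noteq> 0" "b \<noteq> 0" "nv b \<le> nv a" "r \<le> nv a" "nv b \<le> s"
    using ex_radii[OF assms(1)] by blast
  obtain S where S: "transv (nv a) (nv b) S" using ex_transv[OF ab(1-3)] by blast
  have S': "\<exists>y\<in>S. nv (x - y) \<le> s" if x: "nv x \<le> r" for x
  proof -
    have "nv x \<le> nv a" using x ab by linarith
    then obtain y where "y \<in> S" "nv (x - y) \<le> nv b" using S unfolding transv_def by blast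
    thus ?thesis using ab(5) by (meson order_trans)
  qed
  let ?F = "(\<lambda>(x, y, z, w). mat2 x y z w) ` (S \<times> S \<times> S \<times> S)"
  have "finite ?F" using S by (auto simp: transv_def)
  moreover have "\<exists>N\<in>?F \<inter> {N. mn N \<le> r}. mn (M - N) \<le> s" if M: "mn M \<le> r" for M
  proof -
    obtain x y z w where e: "M = mat2 x y z w" by (rule mat2_cases)
    obtain x' y' z' w' where n: "x' \<in> S" "y' \<in> S" "z' \<in> S" "w' \<in> S"
      "nv (x - x') \<le> s" "nv (y - y') \<le> s" "nv (z - z') \<le> s" "nv (w - w') \<le> s"
      using M S' unfolding e mnv_mat2 by (metis max.bounded_iff)
    have d: "mn (M - mat2 x' y' z' w') \<le> s" using n by (simp add: e mat2_diff mnv_mat2)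
    have "mn (M - (M - mat2 x' y' z' w')) \<le> r" by (rule mn_diff_le[OF M]) (use d assms in linarith)
    thus ?thesis using n d by (intro bexI[of _ "mat2 x' y' z' w'"]) (auto simp: image_iff)
  qed
  ultimately show ?thesis by (intro exI[of _ "?F \<inter> {N. mn N \<le> r}"]) auto
qed

text \<open>The form in which compactness is used later: sums over cosets, discs or group elements
  are taken over the image of such a \<open>G\<close>, which is finite although \<open>X\<close> is
  not.\<close>

lemma finite_image_locally_const:
  assumes "s > 0" "\<And>M. M \<in> X \<Longrightarrow> mn M \<le> r"
    and "\<And>M N. M \<in> X \<Longrightarrow> N \<in> X \<Longrightarrow> mn (M - N) \<le> s \<Longrightarrow> G M = G N"
  shows "finite (G ` X)"
proof -
  obtain F where F: "finite F" "\<forall>M. mn M \<le> max r s \<longrightarrow> (\<exists>N\<in>F. mn (M - N) \<le> s)"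
    using finite_net[of s "max r s"] assms(1) by auto
  \<comment> \<open>The points of the net need not lie in \<open>X\<close>, so each is replaced by a
    nearby point of \<open>X\<close> when there is one.\<close>
  let ?c = "\<lambda>N. SOME M. M \<in> X \<and> mn (M - N) \<le> s"
  have "G ` X \<subseteq> (\<lambda>N. G (?c N)) ` F"
  proof clarify
    fix M assume M: "M \<in> X"
    have "mn M \<le> max r s" using assms(2)[OF M] by simp
    then obtain N where N: "N \<in> F" "mn (M - N) \<le> s" using F(2) by blast
    have c: "?c N \<in> X \<and> mn (?c N - N) \<le> s" by (rule someI[of _ M]) (use M N in auto)
    have "mn (M - ?c N) \<le> s" using mn_triangle_le[of M N s "?c N"] N c mn_diff_commute[of N "?c N"] by simp
    thus "G M \<in> (\<lambda>N. G (?c N)) ` F" using assms(3)[OF M, of "?c N"] c N by blast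
  qed
  thus ?thesis using F(1) finite_surj by blast
qed

lemma finite_image_locally_const_scalar:
  assumes "s > 0" "\<And>x. x \<in> X \<Longrightarrow> nv x \<le> r"
    and "\<And>x y. x \<in> X \<Longrightarrow> y \<in> X \<Longrightarrow> nv (x - y) \<le> s \<Longrightarrow> G x = G y"
  shows "finite (G ` X)"
proof -
  have "finite ((\<lambda>M. G (M $ 1 $ 1)) ` ((\<lambda>x. mat2 x 0 0 0) ` X))"
  proof (rule finite_image_locally_const[OF assms(1), of _ "max r 0"])
    show "mn M \<le> max r 0" if "M \<in> (\<lambda>x. mat2 x 0 0 0) ` X" for M
      using that assms(2) by (auto simp: mnv_mat2 max.coboundedI1)
  qed (use assms(3) in \<open>auto simp: mat2_diff mnv_mat2\<close>)
  thus ?thesis by (simp add: image_image)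
qed

section \<open>Schwartz functions with explicit radii\<close>

definition mlevel :: "('a mat2 \<Rightarrow> complex) \<Rightarrow> real \<Rightarrow> real \<Rightarrow> bool" where
  "mlevel f r s \<longleftrightarrow> (\<forall>M. f M \<noteq> 0 \<longrightarrow> mn M \<le> r) \<and> (\<forall>M N. mn N \<le> s \<longrightarrow> f (M + N) = f M)"

lemma mlevel_mono: "mlevel f r s \<Longrightarrow> r \<le> r' \<Longrightarrow> s' \<le> s \<Longrightarrow> mlevel f r' s'"
  unfolding mlevel_def by (meson order_trans)

lemma mlevel_close: "mlevel f r s \<Longrightarrow> mn (M - N) \<le> s \<Longrightarrow> f M = f N"
  unfolding mlevel_def by (metis add.commute diff_add_cancel)

text \<open>In an ultrametric space steps do not accumulate: the limit stays within the current
  bound \<open>t n\<close>, so no summability is required.\<close>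

lemma mat2_complete:
  assumes step: "\<And>n. mn (A (Suc n) - A n) \<le> t n" and t: "\<And>n. t (Suc n) \<le> t n" "t \<longlonglongrightarrow> 0"
  shows "\<exists>L. \<forall>n. mn (A n - L) \<le> t n"
proof -
  have t': "t m \<le> t n" if "n \<le> m" for m n using lift_Suc_antimono_le[of t, OF t(1) that] .
  have d: "mn (A m - A n) \<le> t n" if "n \<le> m" for m n
    using that
  proof (induction m rule: dec_induct)
    case base
    show ?case using order_trans[OF mn_nonneg assms(1)[of n]] by simp
  next
    case (step m)
    have "mn (A (Suc m) - A m) \<le> t n" using assms(1)[of m] t'[OF step(1)] by linarith
    thus ?case using step.IH mn_triangle_le by blast
  qed
  have lim: "\<exists>L. \<forall>n. nv (A n $ i $ j - L) \<le> t n" for i j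
  proof -
    have ex: "\<exists>N. t N < e" if "e > 0" for e
      using order_tendstoD(2)[OF t(2) that] by (auto simp: eventually_sequentially)
    have de: "nv (A m $ i $ j - A n $ i $ j) \<le> t n" if "n \<le> m" for m n
      using mn_entry_le[OF d[OF that], of i j] by simp
    have "\<exists>N. \<forall>m\<ge>N. \<forall>n\<ge>N. nv (A m $ i $ j - A n $ i $ j) < e" if e: "e > 0" for e
    proof -
      obtain N where N: "t N < e" using ex[OF e] by blast
      have "nv (A m $ i $ j - A n $ i $ j) < e" if "m \<ge> N" "n \<ge> N" for m n
      proof -
        have "nv (A m $ i $ j - A N $ i $ j) \<le> t N" "nv (A N $ i $ j - A n $ i $ j) \<le> t N"
          using de[OF that(1)] de[OF that(2)] by (auto simp: nv_diff_commute)
        thus ?thesis using nv_triangle_le N by (meson le_less_trans)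
      qed
      thus ?thesis by blast
    qed
    from nv_complete[of "\<lambda>n. A n $ i $ j", OF this] obtain L where
      L: "\<forall>e>0. \<exists>N. \<forall>n\<ge>N. nv (A n $ i $ j - L) < e" by blast
    have "nv (A n $ i $ j - L) \<le> t n" for n
    proof (rule ccontr)
      assume c: "\<not> ?thesis"
      have "t n \<ge> 0" using step[of n] mn_nonneg[of "A (Suc n) - A n"] by linarith
      hence "nv (A n $ i $ j - L) > 0" using c by linarith
      then obtain N where N: "\<forall>m\<ge>N. nv (A m $ i $ j - L) < nv (A n $ i $ j - L)" using L by blast
      let ?m = "max N n"
      have "nv (A n $ i $ j - A ?m $ i $ j) < nv (A n $ i $ j - L)"
        using de[of n ?m] c by (simp add: nv_diff_commute)
      moreover have "nv (A ?m $ i $ j - L) < nv (A n $ i $ j - L)" using N by simp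
      ultimately have "nv ((A n $ i $ j - A ?m $ i $ j) + (A ?m $ i $ j - L)) < nv (A n $ i $ j - L)"
        by (rule nv_add_less)
      thus False by simp
    qed
    thus ?thesis by blast
  qed
  then obtain L where L: "\<And>i j n. nv (A n $ i $ j - L i j) \<le> t n" by metis
  show ?thesis
    by (rule exI[of _ "mat2 (L 1 1) (L 1 2) (L 2 1) (L 2 2)"]) (simp add: mnv_le_iff L)
qed

text \<open>A nested ball argument. If a ball admits no uniform radius, then one of the finitely
  many smaller balls covering it admits none either. The centres of successively smaller bad balls
  converge, and local constancy at the limit makes a late ball good.\<close>

lemma locally_const_uniform:
  assumes f: "\<And>M. \<exists>e>0. \<forall>N. mn (N - M) < e \<longrightarrow> f N = f M"
  shows "\<exists>s>0. \<forall>M. mn M \<le> r \<longrightarrow> (\<forall>N. mn N \<le> s \<longrightarrow> f (M + N) = f M)"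
proof -
  define good where "good A t s \<longleftrightarrow> (\<forall>M. mn (M - A) \<le> t \<longrightarrow> (\<forall>N. mn N \<le> s \<longrightarrow> f (M + N) = f M))"
    for A t and s :: real
  define bad where "bad A t \<longleftrightarrow> \<not> (\<exists>s>0. good A t s)" for A t
  have step: "\<exists>A'. mn (A' - A) \<le> t \<and> bad A' t'" if "bad A t" "0 < t'" "t' \<le> t" for A t t'
  proof (rule ccontr)
    assume c: "\<not> ?thesis"
    obtain F where F: "finite F" "\<And>N. N \<in> F \<Longrightarrow> mn N \<le> t"
        "\<And>M. mn M \<le> t \<Longrightarrow> \<exists>N\<in>F. mn (M - N) \<le> t'"
      using finite_net[OF \<open>0 < t'\<close> \<open>t' \<le> t\<close>] by blast
    have "\<exists>s>0. good (A + N) t' s" if "N \<in> F" for N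
      using c F(2)[OF \<open>N \<in> F\<close>] unfolding bad_def by (metis add_diff_cancel_left')
    then have "\<exists>s>0. \<forall>N\<in>F. good (A + N) t' s"
      by (rule finite_uniform_pos[OF F(1), of "\<lambda>N s. good (A + N) t' s"]) (auto simp: good_def)
    then obtain s where s: "s > 0" "\<forall>N\<in>F. good (A + N) t' s" by blast
    have "good A t s" unfolding good_def
    proof (intro allI impI)
      fix M N assume M: "mn (M - A) \<le> t" and N: "mn N \<le> s"
      obtain N' where "N' \<in> F" "mn (M - A - N') \<le> t'" using F(3)[OF M] by blast
      thus "f (M + N) = f M" using s(2) N unfolding good_def by (metis diff_diff_eq)
    qed
    thus False using s \<open>bad A t\<close> unfolding bad_def by blast
  qed
  define t where "t n = max r 1 * (1/2) ^ n" for n :: nat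
  have tpos: "t n > 0" for n by (simp add: t_def)
  have tdec: "t (Suc n) \<le> t n" for n using tpos[of n] by (simp add: t_def)
  have t0: "t \<longlonglongrightarrow> 0" unfolding t_def by (rule tendsto_mult_right_zero) (rule LIMSEQ_power_zero, simp)
  have "\<not> bad 0 (t 0)"
  proof
    assume "bad 0 (t 0)"
    hence "\<exists>A. bad (A 0) (t 0) \<and> (\<forall>n. mn (A (Suc n) - A n) \<le> t n \<and> bad (A (Suc n)) (t (Suc n)))"
    proof -
      assume b0: "bad 0 (t 0)"
      have "\<exists>A. \<forall>n. bad (A n) (t n) \<and> mn (A (Suc n) - A n) \<le> t n"
        by (rule dependent_nat_choice) (use b0 step[OF _ tpos tdec] in auto)
      thus ?thesis by blast
    qed
    then obtain A where A: "\<And>n. bad (A n) (t n)" "\<And>n. mn (A (Suc n) - A n) \<le> t n"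
      by (metis not0_implies_Suc)
    obtain L where L: "\<And>n. mn (A n - L) \<le> t n" using mat2_complete[OF A(2) tdec t0] by blast
    obtain e where e: "e > 0" "\<And>N. mn (N - L) < e \<Longrightarrow> f N = f L" using f by blast
    obtain n where n: "t n < e" using order_tendstoD(2)[OF t0 e(1)] by (auto simp: eventually_sequentially)
    have "good (A n) (t n) (t n)" unfolding good_def
    proof (intro allI impI)
      fix M N assume M: "mn (M - A n) \<le> t n" and N: "mn N \<le> t n"
      have 1: "mn (M - L) \<le> t n" using mn_triangle_le[OF M L] .
      have 2: "mn (M + N - L) \<le> t n" using mn_add_le[OF 1 N] by (simp add: algebra_simps)
      show "f (M + N) = f M" using e(2)[of M] e(2)[of "M + N"] 1 2 n by simp
    qed
    thus False using A(1)[of n] tpos[of n] unfolding bad_def by blast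
  qed
  then obtain s where "s > 0" "good 0 (t 0) s" unfolding bad_def by blast
  thus ?thesis unfolding good_def t_def by (intro exI[of _ s]) auto
qed

text \<open>Pointwise local constancy together with bounded support yields a single pair of radii;
  all later arguments work with such a pair.\<close>

lemma schwartz_iff: "f \<in> schwartz nv \<longleftrightarrow> (\<exists>r. \<exists>s>0. mlevel f r s)"
proof
  assume "f \<in> schwartz nv"
  then obtain R where f: "\<And>M. \<exists>e>0. \<forall>N. mn (N - M) < e \<longrightarrow> f N = f M" "\<And>M. f M \<noteq> 0 \<Longrightarrow> mn M \<le> R"
    unfolding schwartz_def by blast
  obtain s where s: "s > 0" "\<And>M N. mn M \<le> max R 1 \<Longrightarrow> mn N \<le> s \<Longrightarrow> f (M + N) = f M"
    using locally_const_uniform[of f "max R 1", OF f(1)] by blast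
  \<comment> \<open>A perturbation of norm at most 1 cannot cross the boundary of the ball of radius
    \<open>max R 1\<close>, and outside that ball \<open>f\<close> vanishes.\<close>
  have "f (M + N) = f M" if N: "mn N \<le> min s 1" for M N
  proof (cases "mn M \<le> max R 1")
    case False
    have "\<not> mn (M + N) \<le> max R 1"
    proof
      assume "mn (M + N) \<le> max R 1"
      hence "mn (M + N - N) \<le> max R 1" using N by (intro mn_diff_le) auto
      thus False using False by simp
    qed
    hence "f (M + N) = 0" "f M = 0" using f(2)[of M] f(2)[of "M + N"] False by (auto simp: le_max_iff_disj)
    thus ?thesis by simp
  qed (use s N in auto)
  hence "mlevel f R (min s 1)" unfolding mlevel_def using f(2) by blast
  thus "\<exists>r. \<exists>s>0. mlevel f r s" using s(1) by (intro exI[of _ R] exI[of _ "min s 1"]) auto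
next
  assume "\<exists>r. \<exists>s>0. mlevel f r s"
  then obtain r s where h: "s > 0" "mlevel f r s" by blast
  have "f N = f M" if "mn (N - M) < s" for M N using mlevel_close[OF h(2), of N M] that by simp
  thus "f \<in> schwartz nv" unfolding schwartz_def using h by (auto simp: mlevel_def)
qed

end

section \<open>The map to the induced representation\<close>

lemma cscale_apply [simp]: "cscale c f x = c * f x"
  by (simp add: cscale_def)

interpretation cvec: vector_space "cscale :: complex \<Rightarrow> ('b \<Rightarrow> complex) \<Rightarrow> ('b \<Rightarrow> complex)"
  by unfold_locales (auto simp: fun_eq_iff algebra_simps)

lemma csubspace_eq: "csubspace U \<longleftrightarrow> cvec.subspace U"
  by (simp add: csubspace_def cvec.subspace_def)

lemma cspan_eq: "cspan A = cvec.span A"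
  unfolding cspan_def cvec.span_explicit by blast

lemma sum_fun_at: "(\<Sum>i\<in>I. f i) x = (\<Sum>i\<in>I. f i x :: complex)"
  by (induction I rule: infinite_finite_induct) auto

lemma matrix_inv_1: "matrix_inv (mat 1) = (mat 1 :: 'a::field_char_0 mat2)"
  by (simp add: mat_1_mat2 matrix_inv_mat2)

lemma mat2_mult_distribs:
  fixes A B C :: "'a::field_char_0 mat2"
  shows "(A + B) ** C = A ** C + B ** C" "C ** (A + B) = C ** A + C ** B"
    "(A - B) ** C = A ** C - B ** C" "C ** (A - B) = C ** A - C ** B"
  by (simp_all add: mat2_eq_iff matrix_matrix_mult_def sum_2 algebra_simps)

context local_field
begin

section \<open>The two actions and the kernel of the coinvariants\<close>

lemma schwartz_subspace: "cvec.subspace (schwartz nv)"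
proof (rule cvec.subspaceI)
  show "0 \<in> schwartz nv" unfolding schwartz_iff mlevel_def by (intro exI[of _ 0] exI[of _ 1]) auto
next
  fix f g assume "f \<in> schwartz nv" "g \<in> schwartz nv"
  then obtain r s r' s' where h: "s > 0" "mlevel f r s" "s' > 0" "mlevel g r' s'"
    unfolding schwartz_iff by blast
  have "mlevel f (max r r') (min s s')" "mlevel g (max r r') (min s s')"
    using h by (auto elim!: mlevel_mono)
  hence "mlevel (f + g) (max r r') (min s s')"
    unfolding mlevel_def by (metis add_0 plus_fun_apply)
  thus "f + g \<in> schwartz nv" unfolding schwartz_iff using h by (metis min_less_iff_conj)
next
  fix c f assume "f \<in> schwartz nv"
  thus "cscale c f \<in> schwartz nv" unfolding schwartz_iff mlevel_def cscale_def by (metis mult_zero_right)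
qed

lemma schwartz_comp:
  assumes "f \<in> schwartz nv" "g \<in> GL2" "h \<in> GL2"
  shows "(\<lambda>M. f (g ** M ** h)) \<in> schwartz nv"
proof -
  obtain r s where f: "s > 0" "mlevel f r s" using assms unfolding schwartz_iff by blast
  let ?g = "matrix_inv g" and ?h = "matrix_inv h"
  have nz: "mn g > 0" "mn h > 0" using assms by (auto simp: mn_pos GL2_iff det_2)
  show ?thesis unfolding schwartz_iff mlevel_def
  proof (rule exI[of _ "mn ?g * r * mn ?h"], rule exI[of _ "s / (mn g * mn h)"], intro conjI allI impI)
    show "s / (mn g * mn h) > 0" using nz f by simp
    fix M assume "f (g ** M ** h) \<noteq> 0"
    hence "mn (g ** M ** h) \<le> r" using f unfolding mlevel_def by blast
    hence "mn (?g ** (g ** M ** h) ** ?h) \<le> mn ?g * r * mn ?h" by (intro mn_mult_le') auto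
    moreover have "?g ** (g ** M ** h) ** ?h = (?g ** g) ** M ** (h ** ?h)" by (simp add: matrix_mul_assoc)
    ultimately show "mn M \<le> mn ?g * r * mn ?h" by (simp add: GL2_inv assms)
  next
    fix M N assume N: "mn N \<le> s / (mn g * mn h)"
    have "mn (g ** N ** h) \<le> mn g * (s / (mn g * mn h)) * mn h" by (intro mn_mult_le' N) auto
    hence "mn (g ** N ** h) \<le> s" using nz by simp
    hence "f (g ** M ** h + g ** N ** h) = f (g ** M ** h)" using f unfolding mlevel_def by blast
    thus "f (g ** (M + N) ** h) = f (g ** M ** h)" by (simp add: mat2_mult_distribs)
  qed
qed

lemma schwartz_comp_left: "f \<in> schwartz nv \<Longrightarrow> g \<in> GL2 \<Longrightarrow> (\<lambda>M. f (g ** M)) \<in> schwartz nv"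
  using schwartz_comp[of f g "mat 1"] by (simp add: GL2_iff mat_1_mat2 flip: mat_1_mat2)

lemma schwartz_comp_right: "f \<in> schwartz nv \<Longrightarrow> h \<in> GL2 \<Longrightarrow> (\<lambda>M. f (M ** h)) \<in> schwartz nv"
  using schwartz_comp[of f "mat 1" h] by (simp add: GL2_iff mat_1_mat2 flip: mat_1_mat2)

lemma GL2_1: "mat 1 \<in> (GL2 :: 'a mat2 set)"
  by (simp add: GL2_iff mat_1_mat2)

lemma schwartz_weil:
  assumes "f \<in> schwartz nv" "g \<in> GL2" "h \<in> GL2"
  shows "weil nv g h f \<in> schwartz nv"
proof -
  have "cscale (of_real (inverse (nv (det g)) * nv (det h))) (\<lambda>M. f (matrix_inv g ** M ** h)) \<in> schwartz nv"
    using cvec.subspace_scale[OF schwartz_subspace schwartz_comp[OF assms(1) GL2_inv(1)[OF assms(2)] assms(3)]] .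
  thus ?thesis by (simp add: weil_def cscale_def)
qed

abbreviation W :: "('a mat2 \<Rightarrow> complex) set" where "W \<equiv> theta_triv_kernel nv"

lemma W_subspace: "cvec.subspace W"
  unfolding theta_triv_kernel_def cspan_eq by (rule cvec.subspace_span)

lemma W_schwartz: "W \<subseteq> schwartz nv"
  unfolding theta_triv_kernel_def cspan_eq
  by (rule cvec.span_minimal[OF _ schwartz_subspace])
    (auto intro!: cvec.subspace_diff[OF schwartz_subspace] schwartz_weil GL2_1)

text \<open>The working rule modulo \<open>W\<close>: translating the argument on the left by
  \<open>g\<close> amounts to multiplying by \<open>|det g|^-1\<close>. It follows from a generator
  for the inverse of \<open>g\<close>.\<close>

lemma W_translate:
  assumes "f \<in> schwartz nv" "g \<in> GL2"
  shows "(\<lambda>M. f (g ** M)) - cscale (of_real (inverse (nv (det g)))) f \<in> W"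
proof -
  have g: "matrix_inv g \<in> GL2" "matrix_inv (matrix_inv g) = g" "det (matrix_inv g) = inverse (det g)" "det g \<noteq> 0"
    using assms GL2_inv GL2_inv_inv by (auto simp: GL2_iff)
  have "weil nv (matrix_inv g) (mat 1) f - f \<in> W"
    unfolding theta_triv_kernel_def cspan_eq using assms g by (intro cvec.span_base) blast
  hence "cscale (of_real (inverse (nv (det g)))) (weil nv (matrix_inv g) (mat 1) f - f) \<in> W"
    by (rule cvec.subspace_scale[OF W_subspace])
  also have "cscale (of_real (inverse (nv (det g)))) (weil nv (matrix_inv g) (mat 1) f - f) =
    (\<lambda>M. f (g ** M)) - cscale (of_real (inverse (nv (det g)))) f"
    using g by (auto simp: fun_eq_iff weil_def nv_inverse mat_1_mat2 right_diff_distrib simp flip: mat_1_mat2)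
  finally show ?thesis .
qed

text \<open>The two actions commute, so a right translate of a generator is the generator of the
  translated function.\<close>

lemma W_right:
  assumes "w \<in> W" "h \<in> GL2"
  shows "(\<lambda>M. w (M ** h)) \<in> W"
proof -
  let ?V = "{w. (\<lambda>M. w (M ** h)) \<in> W}"
  have "W \<subseteq> ?V"
    unfolding theta_triv_kernel_def cspan_eq
  proof (rule cvec.span_minimal)
    have "(\<lambda>M. w (M ** h) + w' (M ** h)) = (\<lambda>M. w (M ** h)) + (\<lambda>M. w' (M ** h))" for w w' :: "'a mat2 \<Rightarrow> complex"
      by auto
    moreover have "(\<lambda>M. c * w (M ** h)) = cscale c (\<lambda>M. w (M ** h))" for c and w :: "'a mat2 \<Rightarrow> complex"
      by auto
    ultimately show "cvec.subspace {w. (\<lambda>M. w (M ** h)) \<in> cvec.span {weil nv g (mat 1) f - f |g f. g \<in> GL2 \<and> f \<in> schwartz nv}}"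
      by (intro cvec.subspaceI) (auto intro: cvec.span_add cvec.span_scale cvec.span_zero simp: zero_fun_def[symmetric])
    have "(\<lambda>M. (weil nv g (mat 1) f - f) (M ** h)) = weil nv g (mat 1) (\<lambda>M. f (M ** h)) - (\<lambda>M. f (M ** h))" for g f
      by (auto simp: weil_def fun_eq_iff matrix_mul_assoc)
    thus "{weil nv g (mat 1) f - f |g f. g \<in> GL2 \<and> f \<in> schwartz nv} \<subseteq>
      {w. (\<lambda>M. w (M ** h)) \<in> cvec.span {weil nv g (mat 1) f - f |g f. g \<in> GL2 \<and> f \<in> schwartz nv}}"
      using schwartz_comp_right[OF _ assms(2)] by (clarsimp intro!: cvec.span_base) blast
  qed
  thus ?thesis using assms by blast
qed

section \<open>Integration over columns\<close>

definition row_fun :: "('a mat2 \<Rightarrow> complex) \<Rightarrow> 'a \<Rightarrow> 'a \<Rightarrow> 'a \<Rightarrow> 'a \<Rightarrow> complex" where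
  "row_fun f c d = (\<lambda>x y. f (mat2 (x * c) (x * d) (y * c) (y * d)))"

lemma sch2_row_fun:
  assumes "f \<in> schwartz nv" "c \<noteq> 0 \<or> d \<noteq> 0"
  shows "sch2 (row_fun f c d)"
proof -
  obtain r s where f: "s > 0" "mlevel f r s" using assms unfolding schwartz_iff by blast
  define C where "C = max (nv c) (nv d)"
  have C: "C > 0" using assms(2) by (auto simp: C_def less_max_iff_disj)
  have mnC: "mn (mat2 (x * c) (x * d) (y * c) (y * d)) = max (nv x) (nv y) * C" for x y
  proof -
    have "max (nv x) (nv y) * C = max (nv x * C) (nv y * C)"
      using C by (simp add: max_mult_distrib_right)
    moreover have "nv z * C = max (nv z * nv c) (nv z * nv d)" for z
      by (simp add: C_def max_mult_distrib_left)
    ultimately show ?thesis by (simp add: mnv_mat2 nv_mult)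
  qed
  show ?thesis unfolding sch2_def level2_def
  proof (rule exI[of _ "r / C"], rule exI[of _ "s / C"], intro conjI allI impI)
    show "s / C > 0" using f C by simp
    fix x y assume "row_fun f c d x y \<noteq> 0"
    hence "max (nv x) (nv y) * C \<le> r" using f(2) unfolding mlevel_def row_fun_def mnC[symmetric] by blast
    hence "max (nv x) (nv y) \<le> r / C" using C by (simp only: pos_le_divide_eq)
    thus "nv x \<le> r / C" "nv y \<le> r / C" by auto
  next
    fix x y u v assume "nv u \<le> s / C" "nv v \<le> s / C"
    hence "max (nv u) (nv v) \<le> s / C" by simp
    hence "mn (mat2 (u * c) (u * d) (v * c) (v * d)) \<le> s" unfolding mnC using C by (simp only: pos_le_divide_eq)
    hence "f (mat2 (x * c) (x * d) (y * c) (y * d) + mat2 (u * c) (u * d) (v * c) (v * d)) =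
      f (mat2 (x * c) (x * d) (y * c) (y * d))" using f(2) unfolding mlevel_def by blast
    thus "row_fun f c d (x + u) (y + v) = row_fun f c d x y"
      by (simp add: row_fun_def mat2_add ring_distribs)
  qed
qed

text \<open>The integral of \<open>f(v w)\<close> over columns \<open>v\<close>, where
  \<open>w\<close> is the bottom row of \<open>g\<close>. The factor \<open>|det g|\<close> turns a
  function of the bottom row, homogeneous of degree -2, into an element of the induced
  representation; it also produces the value 0 off \<open>GL2\<close> that the encoding
  demands.\<close>

definition T :: "('a mat2 \<Rightarrow> complex) \<Rightarrow> 'a mat2 \<Rightarrow> complex" where
  "T f g = of_real (nv (det g)) * integ2 (row_fun f (g $ 2 $ 1) (g $ 2 $ 2))"

lemma row_nonzero: "det g \<noteq> 0 \<Longrightarrow> g $ 2 $ 1 \<noteq> 0 \<or> g $ 2 $ 2 \<noteq> 0" for g :: "'a mat2"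
  by (auto simp: det_2)

lemma T_add:
  assumes "f \<in> schwartz nv" "f' \<in> schwartz nv"
  shows "T (f + f') = T f + T f'"
proof
  fix g :: "'a mat2"
  show "T (f + f') g = (T f + T f') g"
  proof (cases "det g = 0")
    case False
    note s = sch2_row_fun[OF _ row_nonzero[OF False]]
    have "row_fun (f + f') c d = (\<lambda>x y. row_fun f c d x y + row_fun f' c d x y)" for c d
      by (simp add: row_fun_def)
    thus ?thesis using integ2_add[OF s[OF assms(1)] s[OF assms(2)]] by (simp add: T_def distrib_left)
  qed (simp add: T_def)
qed

lemma T_cscale:
  assumes "f \<in> schwartz nv"
  shows "T (cscale c f) = cscale c (T f)"
proof
  fix g :: "'a mat2"
  show "T (cscale c f) g = cscale c (T f) g"
  proof (cases "det g = 0")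
    case False
    have "row_fun (cscale c f) c' d = (\<lambda>x y. c * row_fun f c' d x y)" for c' d
      by (simp add: row_fun_def)
    thus ?thesis using integ2_cmult[OF sch2_row_fun[OF assms row_nonzero[OF False]]] by (simp add: T_def)
  qed (simp add: T_def)
qed

lemma T_diff: "f \<in> schwartz nv \<Longrightarrow> f' \<in> schwartz nv \<Longrightarrow> T (f - f') = T f - T f'"
  using T_add[of f "cscale (-1) f'"] T_cscale[of f' "-1"] cvec.subspace_scale[OF schwartz_subspace, of f' "-1"]
  by simp

lemma T_right:
  assumes "f \<in> schwartz nv" "h \<in> GL2"
  shows "T (weil nv (mat 1) h f) = right_transl h (T f)"
proof
  fix g :: "'a mat2"
  obtain a b c d where g: "g = mat2 a b c d" by (rule mat2_cases)
  obtain a' b' c' d' where h: "h = mat2 a' b' c' d'" by (rule mat2_cases)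
  let ?c = "c * a' + d * c'" and ?d = "c * b' + d * d'"
  show "T (weil nv (mat 1) h f) g = right_transl h (T f) g"
  proof (cases "det g = 0")
    case False
    hence "det (g ** h) \<noteq> 0" using assms by (simp add: det_mul GL2_iff)
    hence cd: "?c \<noteq> 0 \<or> ?d \<noteq> 0" using row_nonzero[of "g ** h"] by (simp add: g h mat2_mult)
    have "row_fun (weil nv (mat 1) h f) c d = (\<lambda>x y. of_real (nv (det h)) * row_fun f ?c ?d x y)"
      by (auto simp: row_fun_def weil_def fun_eq_iff matrix_inv_1 simp del: det_mat2)
        (simp add: mat_1_mat2 h mat2_mult algebra_simps)
    thus ?thesis using integ2_cmult[OF sch2_row_fun[OF assms(1) cd], of "of_real (nv (det h))"]
      by (simp add: T_def right_transl_def det_mul nv_mult) (simp add: g h mat2_mult)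
  qed (simp add: T_def right_transl_def det_mul)
qed

text \<open>The Jacobian of the substitution by the inverse of \<open>k\<close> on columns is
  cancelled by the factor \<open>|det k|^-1\<close> of the Weil representation.\<close>

lemma T_left:
  assumes "f \<in> schwartz nv" "k \<in> GL2"
  shows "T (weil nv k (mat 1) f) = T f"
proof
  fix g :: "'a mat2"
  obtain a b c d where k: "matrix_inv k = mat2 a b c d" by (rule mat2_cases)
  let ?u = "g $ 2 $ 1" and ?v = "g $ 2 $ 2"
  show "T (weil nv k (mat 1) f) g = T f g"
  proof (cases "det g = 0")
    case False
    note s = sch2_row_fun[OF assms(1) row_nonzero[OF False]]
    have dk: "det k \<noteq> 0" using assms by (simp add: GL2_iff)
    have D: "a * d - b * c = inverse (det k)" using GL2_inv(4)[OF assms(2)] by (simp add: k)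
    have D0: "a * d - b * c \<noteq> 0" using D dk by simp
    have "row_fun (weil nv k (mat 1) f) ?u ?v =
        (\<lambda>x y. of_real (inverse (nv (det k))) * row_fun f ?u ?v (a * x + b * y) (c * x + d * y))"
      by (simp add: row_fun_def weil_def fun_eq_iff k mat2_mult)
        (simp add: algebra_simps mat_1_mat2 mat2_mult)
    hence "integ2 (row_fun (weil nv k (mat 1) f) ?u ?v) =
        integ2 (\<lambda>x y. of_real (inverse (nv (det k))) * row_fun f ?u ?v (a * x + b * y) (c * x + d * y))"
      by (rule arg_cong)
    also have "\<dots> = of_real (inverse (nv (det k))) * (integ2 (row_fun f ?u ?v) / of_real (nv (inverse (det k))))"
      using integ2_cmult[OF sch2_linear[OF s D0]] integ2_linear[OF s D0] by (simp add: D)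
    also have "\<dots> = integ2 (row_fun f ?u ?v)" using dk by (simp add: nv_inverse)
    finally show ?thesis by (simp add: T_def)
  qed (simp add: T_def)
qed

lemma T_0: "T 0 = 0"
  using T_cscale[OF cvec.subspace_0[OF schwartz_subspace], of 0] by simp

lemma kerT_subspace: "cvec.subspace {f \<in> schwartz nv. T f = 0}"
  using cvec.subspace_0[OF schwartz_subspace] cvec.subspace_add[OF schwartz_subspace]
    cvec.subspace_scale[OF schwartz_subspace]
  by (intro cvec.subspaceI) (auto simp: T_add T_cscale T_0)

lemma W_kerT: "W \<subseteq> {f \<in> schwartz nv. T f = 0}"
  unfolding theta_triv_kernel_def cspan_eq
  by (rule cvec.span_minimal[OF _ kerT_subspace])
    (auto simp: T_diff T_left schwartz_weil GL2_1 intro!: cvec.subspace_diff[OF schwartz_subspace])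

text \<open>The two half powers and the square root of the modulus combine to
  \<open>|a| / |b|\<close>; this is the only form of the inducing character used afterwards.\<close>

lemma half_char:
  assumes "a \<noteq> 0" "b \<noteq> 0"
  shows "absc nv (1/2) a * absc nv (-1/2) b * complex_of_real (nv (a / b) powr (1/2)) = of_real (nv a / nv b)"
proof -
  have p: "nv a > 0" "nv b > 0" using assms by auto
  have "nv a powr (1/2) * nv b powr (-1/2) * nv (a / b) powr (1/2) =
    (nv a powr (1/2) * nv a powr (1/2)) / (nv b powr (1/2) * nv b powr (1/2))"
    using p by (simp add: nv_divide powr_divide powr_minus_divide)
  also have "\<dots> = nv a / nv b" using p by (simp flip: powr_add)
  finally show ?thesis unfolding absc_def of_real_mult[symmetric] by simp
qed

text \<open>An estimate is needed only inside the support radius: \<open>maxK\<close> preserves the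
  norm, so outside both values vanish.\<close>

lemma schwartz_right_smooth:
  assumes "f \<in> schwartz nv"
  shows "\<exists>e>0. \<forall>k. mn (k - mat 1) < e \<longrightarrow> k \<in> maxK \<and> (\<forall>M. f (M ** k) = f M)"
proof -
  obtain r s where f: "s > 0" "mlevel f r s" using assms unfolding schwartz_iff by blast
  define r' where "r' = max r 1"
  have r': "r' > 0" by (simp add: r'_def)
  have "k \<in> maxK \<and> f (M ** k) = f M" if k: "mn (k - mat 1) < min 1 (s / r')" for k M
  proof
    show K: "k \<in> maxK" using maxK_near_1 k by simp
    show "f (M ** k) = f M"
    proof (cases "mn M \<le> r'")
      case True
      have "mn (M ** (k - mat 1)) \<le> r' * (s / r')" by (rule mn_mult_le') (use True k in auto)
      moreover have "M ** (k - mat 1) = M ** k - M" by (simp add: mat2_mult_distribs)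
      ultimately show ?thesis using mlevel_close[OF f(2)] r' by simp
    next
      case False
      hence "\<not> mn M \<le> r" "\<not> mn (M ** k) \<le> r" using mn_maxK_right[OF K] by (auto simp: r'_def)
      hence "f M = 0" "f (M ** k) = 0" using f(2) unfolding mlevel_def by blast+
      thus ?thesis by simp
    qed
  qed
  thus ?thesis using f r' by (intro exI[of _ "min 1 (s / r')"]) auto
qed

lemma T_in_I_half:
  assumes f: "f \<in> schwartz nv"
  shows "T f \<in> I_half nv"
  unfolding I_half_def ind_rep_def mem_Collect_eq
proof (intro conjI allI impI)
  fix g :: "'a mat2" assume "g \<notin> GL2" thus "T f g = 0" by (simp add: T_def GL2_iff)
next
  obtain e where e: "e > 0" "\<And>k M. mn (k - mat 1) < e \<Longrightarrow> k \<in> maxK \<and> f (M ** k) = f M"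
    using schwartz_right_smooth[OF f] by blast
  have "T f (g ** k) = T f g" if k: "mn (k - mat 1) < e" for g k
  proof -
    obtain a b c d where g: "g = mat2 a b c d" by (rule mat2_cases)
    obtain a' b' c' d' where h: "k = mat2 a' b' c' d'" by (rule mat2_cases)
    have "row_fun f ((g ** k) $ 2 $ 1) ((g ** k) $ 2 $ 2) = (\<lambda>x y. f (mat2 (x * c) (x * d) (y * c) (y * d) ** k))"
      by (simp add: row_fun_def g h mat2_mult fun_eq_iff algebra_simps)
    also have "\<dots> = row_fun f c d" using e(2)[OF k] by (simp add: row_fun_def)
    finally show ?thesis using e(2)[OF k] by (simp add: T_def det_mul nv_mult maxK_def) (simp add: g)
  qed
  thus "\<exists>e>0. \<forall>g\<in>GL2. \<forall>k. mn (k - mat 1) < e \<longrightarrow> T f (g ** k) = T f g" using e(1) by blast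
next
  fix a b x :: 'a and g :: "'a mat2" assume ab: "a \<noteq> 0" "b \<noteq> 0" and g: "g \<in> GL2"
  obtain p q' c d where gm: "g = mat2 p q' c d" by (rule mat2_cases)
  have "c \<noteq> 0 \<or> d \<noteq> 0" using row_nonzero[of g] g by (simp add: GL2_iff gm)
  note s = sch2_row_fun[OF f this]
  have "row_fun f (b * c) (b * d) = (\<lambda>x y. row_fun f c d (b * x + 0 * y) (0 * x + b * y))"
    by (simp add: row_fun_def mult.assoc mult.left_commute)
  hence "integ2 (row_fun f (b * c) (b * d)) = integ2 (row_fun f c d) / of_real (nv (b * b - 0 * 0))"
    using integ2_linear[OF s, of b b 0 0] ab by simp
  moreover have "det (mat2 a x 0 b ** g) = a * b * det g" by (simp add: det_mul)
  ultimately show "T f (mat2 a x 0 b ** g) = absc nv (1/2) a * absc nv (-1/2) b * complex_of_real (nv (a / b) powr (1/2)) * T f g"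
    unfolding half_char[OF ab] T_def using ab by (simp add: nv_mult gm mat2_mult)
qed

section \<open>Densities on the projective line\<close>

text \<open>An element of the induced representation is determined by its values on representatives of
  the bottom rows; dividing out the determinant gives a function on \<open>F\<^sup>2 - 0\<close> that is homogeneous of
  degree \<open>-2\<close>, that is, a density on the projective line.\<close>

definition lift :: "('a \<Rightarrow> 'a \<Rightarrow> complex) \<Rightarrow> 'a mat2 \<Rightarrow> complex" where
  "lift F g = of_real (nv (det g)) * F (g $ 2 $ 1) (g $ 2 $ 2)"

text \<open>Of the two obvious completions of the row, the one whose determinant has norm
  \<open>max (nv c) (nv d)\<close>; a primitive row is thus completed inside
  \<open>maxK\<close>.\<close>

definition row_mat :: "'a \<Rightarrow> 'a \<Rightarrow> 'a mat2" where
  "row_mat c d = (if nv c \<le> nv d then mat2 1 0 c d else mat2 0 1 c d)"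

definition dens :: "('a mat2 \<Rightarrow> complex) \<Rightarrow> 'a \<Rightarrow> 'a \<Rightarrow> complex" where
  "dens f c d = f (row_mat c d) / of_real (nv (det (row_mat c d)))"

definition homog :: "('a \<Rightarrow> 'a \<Rightarrow> complex) \<Rightarrow> bool" where
  "homog F \<longleftrightarrow> (\<forall>b c d. b \<noteq> 0 \<longrightarrow> c \<noteq> 0 \<or> d \<noteq> 0 \<longrightarrow> F (b * c) (b * d) = F c d / of_real (nv b * nv b))"

definition rsmooth :: "('a \<Rightarrow> 'a \<Rightarrow> complex) \<Rightarrow> bool" where
  "rsmooth F \<longleftrightarrow> (\<exists>e>0. \<forall>k. mn (k - mat 1) < e \<longrightarrow> (\<forall>c d. c \<noteq> 0 \<or> d \<noteq> 0 \<longrightarrow>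
     F (c * k $ 1 $ 1 + d * k $ 2 $ 1) (c * k $ 1 $ 2 + d * k $ 2 $ 2) = F c d))"

lemma row_mat_row [simp]: "row_mat c d $ 2 $ 1 = c" "row_mat c d $ 2 $ 2 = d"
  by (auto simp: row_mat_def)

lemma nv_det_row_mat: "nv (det (row_mat c d)) = max (nv c) (nv d)"
  by (auto simp: row_mat_def)

lemma max_nv_pos: "max (nv c) (nv d) > 0 \<longleftrightarrow> c \<noteq> 0 \<or> d \<noteq> 0"
  by (auto simp: less_max_iff_disj)

lemma row_mat_GL2: "c \<noteq> 0 \<or> d \<noteq> 0 \<Longrightarrow> row_mat c d \<in> GL2"
  using nv_det_row_mat[of c d] max_nv_pos[of c d] by (auto simp: GL2_iff)

lemma row_mat_maxK: "max (nv c) (nv d) = 1 \<Longrightarrow> row_mat c d \<in> maxK"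
  using nv_det_row_mat[of c d] by (auto simp: maxK_def row_mat_def mnv_mat2)

lemma mult_row2: "(g ** k) $ 2 $ 1 = g $ 2 $ 1 * k $ 1 $ 1 + g $ 2 $ 2 * k $ 2 $ 1"
  "(g ** k) $ 2 $ 2 = g $ 2 $ 1 * k $ 1 $ 2 + g $ 2 $ 2 * k $ 2 $ 2" for g k :: "'a mat2"
  by (simp_all add: matrix_matrix_mult_def sum_2)

lemma I_half_borel:
  assumes "f \<in> I_half nv" "a \<noteq> 0" "b \<noteq> 0" "g \<in> GL2"
  shows "f (mat2 a x 0 b ** g) = of_real (nv a / nv b) * f g"
proof -
  have "\<forall>a b x g. a \<noteq> 0 \<longrightarrow> b \<noteq> 0 \<longrightarrow> g \<in> GL2 \<longrightarrow> f (mat2 a x 0 b ** g) =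
    absc nv (1/2) a * absc nv (-1/2) b * complex_of_real (nv (a / b) powr (1/2)) * f g"
    using assms(1) unfolding I_half_def ind_rep_def mem_Collect_eq by (elim conjE)
  hence "f (mat2 a x 0 b ** g) = absc nv (1/2) a * absc nv (-1/2) b * complex_of_real (nv (a / b) powr (1/2)) * f g"
    using assms(2-4) by simp
  thus ?thesis unfolding half_char[OF assms(2,3)] .
qed

lemma I_half_off: "f \<in> I_half nv \<Longrightarrow> g \<notin> GL2 \<Longrightarrow> f g = 0"
  unfolding I_half_def ind_rep_def mem_Collect_eq by (elim conjE) simp

lemma I_half_smooth:
  assumes "f \<in> I_half nv"
  shows "\<exists>e>0. \<forall>g\<in>GL2. \<forall>k. mn (k - mat 1) < e \<longrightarrow> f (g ** k) = f g"
  using assms unfolding I_half_def ind_rep_def mem_Collect_eq by (elim conjE)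

lemma lift_dens:
  assumes f: "f \<in> I_half nv"
  shows "lift (dens f) = f"
proof
  fix g :: "'a mat2"
  obtain p q' c d where g: "g = mat2 p q' c d" by (rule mat2_cases)
  show "lift (dens f) g = f g"
  proof (cases "det g = 0")
    case True
    thus ?thesis using I_half_off[OF f, of g] by (simp add: lift_def GL2_iff)
  next
    case False
    hence cd: "c \<noteq> 0 \<or> d \<noteq> 0" using row_nonzero[of g] by (simp add: g)
    have D: "p * d - q' * c \<noteq> 0" using False g by simp
    have dpos: "nv (det (row_mat c d)) > 0" unfolding nv_det_row_mat max_nv_pos by (rule cd)
    \<comment> \<open>Two invertible matrices with the same bottom row differ by a left factor with
      bottom row \<open>(0, 1)\<close>, on which the inducing character is just
      \<open>|\<alpha>|\<close>.\<close>
    obtain \<alpha> x where a: "g = mat2 \<alpha> x 0 1 ** row_mat c d"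
    proof (cases "nv c \<le> nv d")
      case True
      hence "d \<noteq> 0" using cd by (metis nv_0 nv_pos not_less)
      thus ?thesis using that[of "p - q' * c / d" "q' / d"] True by (simp add: row_mat_def g mat2_mult)
    next
      case False
      hence "c \<noteq> 0" using nv_nonneg[of d] by auto
      thus ?thesis using that[of "q' - p * d / c" "p / c"] False by (simp add: row_mat_def g mat2_mult)
    qed
    have det: "det g = \<alpha> * det (row_mat c d)" by (simp add: a det_mul)
    hence "\<alpha> \<noteq> 0" using False by auto
    hence "f g = of_real (nv \<alpha>) * f (row_mat c d)"
      using I_half_borel[OF f _ _ row_mat_GL2[OF cd], of \<alpha> 1 x] a by simp
    thus ?thesis using dpos unfolding lift_def dens_def det
      by (simp add: g nv_mult)
  qed
qed

lemma homog_dens: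
  assumes f: "f \<in> I_half nv"
  shows "homog (dens f)"
  unfolding homog_def
proof (intro allI impI)
  fix b c d :: 'a assume h: "b \<noteq> 0" "c \<noteq> 0 \<or> d \<noteq> 0"
  have "row_mat (b * c) (b * d) = mat2 1 0 0 b ** row_mat c d"
    using h by (simp add: row_mat_def nv_mult mat2_mult)
  thus "dens f (b * c) (b * d) = dens f c d / of_real (nv b * nv b)"
    using I_half_borel[OF f _ h(1) row_mat_GL2[OF h(2)], of 1 0] by (simp add: dens_def det_mul nv_mult)
qed

lemma rsmooth_dens:
  assumes f: "f \<in> I_half nv"
  shows "rsmooth (dens f)"
proof -
  obtain e where e: "e > 0" "\<And>g k. g \<in> GL2 \<Longrightarrow> mn (k - mat 1) < e \<Longrightarrow> f (g ** k) = f g"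
    using I_half_smooth[OF f] by blast
  have "dens f (c * k $ 1 $ 1 + d * k $ 2 $ 1) (c * k $ 1 $ 2 + d * k $ 2 $ 2) = dens f c d"
    if k: "mn (k - mat 1) < min e 1" and cd: "c \<noteq> 0 \<or> d \<noteq> 0" for k c d
  proof -
    let ?g = "row_mat c d"
    have "nv (det k) = 1" using maxK_near_1[of k] k by (simp add: maxK_def)
    moreover have "lift (dens f) (?g ** k) = lift (dens f) ?g"
      unfolding lift_dens[OF f] using e(2)[OF row_mat_GL2[OF cd]] k by simp
    moreover have "det ?g \<noteq> 0" using row_mat_GL2[OF cd] by (simp add: GL2_iff)
    ultimately show ?thesis by (simp add: lift_def det_mul nv_mult mult_row2)
  qed
  thus ?thesis unfolding rsmooth_def using e(1) by (intro exI[of _ "min e 1"]) auto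
qed

lemma lift_in_I_half:
  assumes h: "homog F" and s: "rsmooth F"
  shows "lift F \<in> I_half nv"
  unfolding I_half_def ind_rep_def mem_Collect_eq
proof (intro conjI allI impI)
  fix g :: "'a mat2" assume "g \<notin> GL2" thus "lift F g = 0" by (simp add: lift_def GL2_iff)
next
  obtain e where e: "e > 0" "\<And>k c d. mn (k - mat 1) < e \<Longrightarrow> c \<noteq> 0 \<or> d \<noteq> 0 \<Longrightarrow>
     F (c * k $ 1 $ 1 + d * k $ 2 $ 1) (c * k $ 1 $ 2 + d * k $ 2 $ 2) = F c d"
    using s unfolding rsmooth_def by blast
  have "lift F (g ** k) = lift F g" if "g \<in> GL2" "mn (k - mat 1) < min e 1" for g k
  proof -
    have "nv (det k) = 1" using maxK_near_1[of k] that by (simp add: maxK_def)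
    thus ?thesis using e(2)[of k "g $ 2 $ 1" "g $ 2 $ 2"] that row_nonzero[of g]
      by (simp add: lift_def det_mul nv_mult mult_row2 GL2_iff)
  qed
  thus "\<exists>e>0. \<forall>g\<in>GL2. \<forall>k. mn (k - mat 1) < e \<longrightarrow> lift F (g ** k) = lift F g"
    using e(1) by (intro exI[of _ "min e 1"]) auto
next
  fix a b x :: 'a and g :: "'a mat2" assume ab: "a \<noteq> 0" "b \<noteq> 0" and g: "g \<in> GL2"
  have "F (b * g $ 2 $ 1) (b * g $ 2 $ 2) = F (g $ 2 $ 1) (g $ 2 $ 2) / of_real (nv b * nv b)"
    using h row_nonzero[of g] ab g unfolding homog_def by (simp add: GL2_iff)
  thus "lift F (mat2 a x 0 b ** g) = absc nv (1/2) a * absc nv (-1/2) b * complex_of_real (nv (a / b) powr (1/2)) * lift F g"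
    unfolding half_char[OF ab] using ab by (simp add: lift_def det_mul nv_mult mult_row2)
qed

lemma max_nv_add:
  assumes "nv x < max (nv c) (nv d)" "nv y < max (nv c) (nv d)"
  shows "max (nv (c + x)) (nv (d + y)) = max (nv c) (nv d)"
proof (cases "nv c \<le> nv d")
  case True
  thus ?thesis using assms nv_add_absorb[of y d] nv_add[of c x] by auto
next
  case False
  thus ?thesis using assms nv_add_absorb[of x c] nv_add[of d y] by auto
qed

text \<open>An additive perturbation \<open>E\<close> of a primitive row is realized by right
  multiplication with \<open>1 + g^-1 E\<close>, where \<open>g\<close> in \<open>maxK\<close>
  completes the row. Since \<open>g\<close> preserves norms, this matrix is as close to 1 as
  \<open>E\<close> is to 0.\<close>

lemma rsmooth_level:
  assumes "rsmooth F"
  shows "\<exists>s>0. s < 1 \<and> (\<forall>c d x y. max (nv c) (nv d) = 1 \<longrightarrow> nv x \<le> s \<longrightarrow> nv y \<le> s \<longrightarrow> F (c + x) (d + y) = F c d)"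
proof -
  obtain e where e: "e > 0" "\<And>k c d. mn (k - mat 1) < e \<Longrightarrow> c \<noteq> 0 \<or> d \<noteq> 0 \<Longrightarrow>
     F (c * k $ 1 $ 1 + d * k $ 2 $ 1) (c * k $ 1 $ 2 + d * k $ 2 $ 2) = F c d"
    using assms unfolding rsmooth_def by blast
  have "F (c + x) (d + y) = F c d"
    if cd: "max (nv c) (nv d) = 1" and xy: "nv x \<le> min e 1 / 2" "nv y \<le> min e 1 / 2" for c d x y
  proof -
    let ?g = "row_mat c d" let ?k = "mat 1 + matrix_inv ?g ** mat2 0 0 x y"
    have g: "?g \<in> maxK" using row_mat_maxK[OF cd] .
    have "mn (?k - mat 1) = mn (mat2 0 0 x y)" using mn_maxK_left[OF maxK_inv[OF g]] by simp
    also have "\<dots> < e" using xy e(1) by (simp add: mnv_mat2)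
    finally have k: "mn (?k - mat 1) < e" .
    have "?g ** ?k = ?g + mat2 0 0 x y"
      using GL2_inv(2)[OF maxK_GL2[OF g]] by (simp add: mat2_mult_distribs matrix_mul_assoc)
    hence "(?g ** ?k) $ 2 $ 1 = c + x" "(?g ** ?k) $ 2 $ 2 = d + y" by simp_all
    moreover have "c \<noteq> 0 \<or> d \<noteq> 0" using cd by auto
    ultimately show ?thesis using e(2)[OF k, of c d] unfolding mult_row2 row_mat_row by simp
  qed
  thus ?thesis using e(1) by (intro exI[of _ "min e 1 / 2"]) auto
qed

text \<open>The preimage is supported on matrices with primitive first row and integral second row,
  where it depends on the first row only. On \<open>v w\<close> the two conditions separate into a
  sphere for \<open>x\<close> and a ball for \<open>y\<close>, and homogeneity makes the value
  constant there.\<close>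

lemma T_surj:
  assumes f: "f \<in> I_half nv"
  shows "\<exists>\<phi> \<in> schwartz nv. T \<phi> = f"
proof -
  define F where "F = dens f"
  have hom: "homog F" and sm: "rsmooth F" using homog_dens[OF f] rsmooth_dens[OF f] by (auto simp: F_def)
  \<comment> \<open>The volume of the units of the ring of integers, hence of the unit sphere over
    which \<open>x\<close> is integrated.\<close>
  define \<kappa> where "\<kappa> = complex_of_real (1 - 1 / q)"
  have \<kappa>: "\<kappa> \<noteq> 0" using q_gt_1 by (simp add: \<kappa>_def)
  define \<phi> where "\<phi> M = (if max (nv (M $ 1 $ 1)) (nv (M $ 1 $ 2)) = 1 \<and> max (nv (M $ 2 $ 1)) (nv (M $ 2 $ 2)) \<le> 1
     then F (M $ 1 $ 1) (M $ 1 $ 2) / \<kappa> else 0)" for M :: "'a mat2"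
  obtain s where s: "s > 0" "s < 1" "\<And>c d x y. max (nv c) (nv d) = 1 \<Longrightarrow> nv x \<le> s \<Longrightarrow> nv y \<le> s \<Longrightarrow> F (c + x) (d + y) = F c d"
    using rsmooth_level[OF sm] by blast
  have "mlevel \<phi> 1 s"
    unfolding mlevel_def
  proof (intro conjI allI impI)
    fix M assume "\<phi> M \<noteq> 0"
    thus "mn M \<le> 1" unfolding \<phi>_def mnv_le_iff by (auto split: if_splits)
  next
    fix M N :: "'a mat2" assume N: "mn N \<le> s"
    have n: "nv (N $ i $ j) \<le> s" for i j using N mn_entry_le by blast
    have A: "max (nv (c + N $ i $ j)) (nv (d + N $ k $ l)) = 1 \<longleftrightarrow> max (nv c) (nv d) = 1" for c d i j k l
    proof
      assume "max (nv c) (nv d) = 1"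
      thus "max (nv (c + N $ i $ j)) (nv (d + N $ k $ l)) = 1"
        using max_nv_add[of "N $ i $ j" c d "N $ k $ l"] n[of i j] n[of k l] s(2) by auto
    next
      assume "max (nv (c + N $ i $ j)) (nv (d + N $ k $ l)) = 1"
      thus "max (nv c) (nv d) = 1"
        using max_nv_add[of "- N $ i $ j" "c + N $ i $ j" "d + N $ k $ l" "- N $ k $ l"] n[of i j] n[of k l] s(2) by simp
    qed
    have B: "nv (c + N $ i $ j) \<le> 1 \<longleftrightarrow> nv c \<le> 1" for c i j
      using nv_add_le[of c 1 "N $ i $ j"] nv_diff_le[of "c + N $ i $ j" 1 "N $ i $ j"] n[of i j] s(2) by auto
    have "F (M $ 1 $ 1 + N $ 1 $ 1) (M $ 1 $ 2 + N $ 1 $ 2) = F (M $ 1 $ 1) (M $ 1 $ 2)"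
      if "max (nv (M $ 1 $ 1)) (nv (M $ 1 $ 2)) = 1" using s(3)[OF that n n] .
    thus "\<phi> (M + N) = \<phi> M" unfolding \<phi>_def using A B by simp
  qed
  hence \<phi>: "\<phi> \<in> schwartz nv" unfolding schwartz_iff using s(1) by blast
  have "T \<phi> g = lift F g" for g
  proof (cases "det g = 0")
    case False
    let ?c = "g $ 2 $ 1" and ?d = "g $ 2 $ 2"
    have cd: "?c \<noteq> 0 \<or> ?d \<noteq> 0" using row_nonzero[OF False] .
    obtain b where b: "max (nv ?c) (nv ?d) = nv b" by (metis max_def)
    hence b0: "b \<noteq> 0" using cd max_nv_pos[of ?c ?d] by auto
    hence ib: "inverse b \<noteq> 0" by simp
    have mx: "max (nv (x * ?c)) (nv (x * ?d)) = nv x * nv b" for x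
      unfolding b[symmetric] by (simp add: nv_mult max_mult_distrib_left)
    have e1: "nv x * nv b = 1 \<longleftrightarrow> nv x = nv (inverse b)" and e2: "nv x * nv b \<le> 1 \<longleftrightarrow> nv x \<le> nv (inverse b)" for x
      using b0 unfolding nv_inverse unfolding inverse_eq_divide by (simp_all add: eq_divide_eq pos_le_divide_eq)
    let ?cst = "F ?c ?d * of_real (nv b * nv b) / \<kappa>"
    have "row_fun \<phi> ?c ?d = (\<lambda>x y. ?cst * ((if nv x = nv (inverse b) then 1 else 0) * (if nv y \<le> nv (inverse b) then 1 else 0)))"
    proof (intro ext)
      fix x y
      have "F (x * ?c) (x * ?d) = F ?c ?d * of_real (nv b * nv b)" if "nv x = nv (inverse b)"
      proof -
        have "x \<noteq> 0" using that ib by (metis nv_eq_0)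
        thus ?thesis using hom cd that unfolding homog_def by (simp add: nv_inverse divide_inverse)
      qed
      thus "row_fun \<phi> ?c ?d x y = ?cst * ((if nv x = nv (inverse b) then 1 else 0) * (if nv y \<le> nv (inverse b) then 1 else 0))"
        unfolding row_fun_def \<phi>_def mat2_nth mx e1 e2 by simp
    qed
    hence "integ2 (row_fun \<phi> ?c ?d) = ?cst * (of_real (nv (inverse b) * (1 - 1 / q)) * of_real (nv (inverse b)))"
      using integ2_cmult[OF sch2_prod[OF sch1_sphere[OF ib] sch1_ball[OF ib]]]
        integ2_prod[OF sch1_sphere[OF ib] sch1_ball[OF ib]] integ_sphere[OF ib] integ_ball[OF ib] by (simp only:)
    also have "\<dots> = F ?c ?d" using b0 \<kappa> unfolding \<kappa>_def[symmetric] of_real_mult nv_inverse of_real_inverse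
      by (simp add: field_simps)
    finally show ?thesis by (simp add: T_def lift_def)
  qed (simp add: T_def lift_def)
  hence "T \<phi> = f" using lift_dens[OF f] by (auto simp: F_def)
  thus ?thesis using \<phi> by blast
qed

text \<open>The closure properties are inherited from the Schwartz space, of which
  \<open>I_half\<close> is the image under the linear map \<open>T\<close>.\<close>

lemma I_half_subspace: "cvec.subspace (I_half nv)"
proof -
  have "I_half nv = T ` schwartz nv" using T_surj T_in_I_half by blast
  thus ?thesis using cvec.subspace_0[OF schwartz_subspace] cvec.subspace_add[OF schwartz_subspace]
      cvec.subspace_scale[OF schwartz_subspace] T_0 T_add T_cscale
    by (auto intro!: cvec.subspaceI) (metis image_eqI)+
qed

lemma I_half_right: "f \<in> I_half nv \<Longrightarrow> h \<in> GL2 \<Longrightarrow> right_transl h f \<in> I_half nv"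
  using T_surj[of f] T_right schwartz_weil[OF _ GL2_1] T_in_I_half by metis

end

section \<open>The kernel\<close>

text \<open>The supports of the distinct functions \<open>\<kappa> x\<close> partition the support
  of \<open>F\<close>. The sum runs over the image of \<open>\<kappa>\<close>, because many centres
  share one function; the coefficient is read off at a chosen centre. It serves for cosets of
  \<open>maxK\<close> and for discs on the projective line.\<close>

lemma finite_decomposition:
  fixes \<kappa> :: "'i \<Rightarrow> 'b \<Rightarrow> complex"
  assumes fin: "finite (\<kappa> ` X)"
    and cover: "\<And>m. F m \<noteq> 0 \<Longrightarrow> \<exists>x\<in>X. \<kappa> x m \<noteq> 0"
    and uniq: "\<And>x y m. x \<in> X \<Longrightarrow> y \<in> X \<Longrightarrow> \<kappa> x m \<noteq> 0 \<Longrightarrow> \<kappa> y m \<noteq> 0 \<Longrightarrow> \<kappa> x = \<kappa> y"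
    and val: "\<And>x m. x \<in> X \<Longrightarrow> \<kappa> x m \<noteq> 0 \<Longrightarrow> F m = c x * \<kappa> x m"
  shows "F = (\<Sum>k\<in>\<kappa> ` X. cscale (c (inv_into X \<kappa> k)) k)"
proof
  fix m
  have inv: "inv_into X \<kappa> k \<in> X" "\<kappa> (inv_into X \<kappa> k) = k" if "k \<in> \<kappa> ` X" for k
    using that by (auto simp: inv_into_into f_inv_into_f)
  show "F m = (\<Sum>k\<in>\<kappa> ` X. cscale (c (inv_into X \<kappa> k)) k) m"
  proof (cases "\<exists>k\<in>\<kappa> ` X. k m \<noteq> 0")
    case False
    hence "F m = 0" using cover by blast
    moreover have "(\<Sum>k\<in>\<kappa> ` X. c (inv_into X \<kappa> k) * k m) = 0"
      using False by (intro sum.neutral) auto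
    ultimately show ?thesis by (simp add: sum_fun_at)
  next
    case True
    then obtain k where k: "k \<in> \<kappa> ` X" "k m \<noteq> 0" by blast
    have "l m = 0" if l: "l \<in> \<kappa> ` X - {k}" for l
    proof (rule ccontr)
      assume lm: "l m \<noteq> 0"
      have "\<kappa> (inv_into X \<kappa> l) = \<kappa> (inv_into X \<kappa> k)"
        by (rule uniq[of _ _ m]) (use inv[of l] inv[OF k(1)] l lm k in auto)
      thus False using inv[of l] inv[OF k(1)] l by auto
    qed
    hence "(\<Sum>l\<in>\<kappa> ` X - {k}. c (inv_into X \<kappa> l) * l m) = 0" by (intro sum.neutral) auto
    hence "(\<Sum>k\<in>\<kappa> ` X. cscale (c (inv_into X \<kappa> k)) k) m = c (inv_into X \<kappa> k) * k m"
      unfolding sum_fun_at cscale_apply by (subst sum.remove[OF fin k(1)]) simp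
    thus ?thesis using val[OF inv(1)[OF k(1)], of m] inv(2)[OF k(1)] k(2) by simp
  qed
qed

text \<open>Substitute for invariance of Haar measure: a translation permutes a finite set of
  translates and so fixes their sum.\<close>

lemma sum_invariant:
  fixes O' :: "('b \<Rightarrow> complex) set"
  assumes "finite O'" "inj_on \<tau> O'" "\<tau> ` O' \<subseteq> O'"
  shows "(\<Sum>\<phi>\<in>O'. \<tau> \<phi>) = \<Sum>O'"
  using sum.reindex[OF assms(2), of "\<lambda>x. x"] endo_inj_surj[OF assms(1,3,2)] by simp

context local_field
begin

section \<open>The open orbit\<close>

definition ball1 :: "'a mat2 \<Rightarrow> complex" where
  "ball1 M = (if mn M \<le> 1 then 1 else 0)"

definition indK :: "'a mat2 \<Rightarrow> complex" where
  "indK M = (if M \<in> maxK then 1 else 0)"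

lemma ball1_schwartz: "ball1 \<in> schwartz nv"
proof -
  have "mn (M + N) \<le> 1 \<longleftrightarrow> mn M \<le> 1" if "mn N \<le> 1" for M N
    using mn_add_le[of M 1 N] mn_diff_le[of "M + N" 1 N] that by auto
  hence "mlevel ball1 1 1" by (auto simp: mlevel_def ball1_def)
  thus ?thesis unfolding schwartz_iff by (intro exI[of _ 1]) auto
qed

lemma nv_div_unif: "nv (x / unif) \<le> 1 \<longleftrightarrow> nv x < 1"
  unfolding nv_less_1_iff by (simp add: nv_divide nv_unif field_simps)

text \<open>This counts the digits \<open>r\<close> for which \<open>(a, b)\<close> is congruent to
  \<open>r (c, d)\<close>. If \<open>(c, d)\<close> vanishes modulo the maximal ideal,
  \<open>r\<close> has no influence. Otherwise a unit entry of \<open>(c, d)\<close> determines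
  \<open>r\<close>, and \<open>d (a - r c) - c (b - r d) = a d - b c\<close> turns the other
  congruence into vanishing of the determinant.\<close>

lemma digit_count:
  assumes R: "finite R" "real (card R) = q" "R \<subseteq> {x. nv x \<le> 1}"
    "\<And>x. nv x \<le> 1 \<Longrightarrow> \<exists>!r. r \<in> R \<and> nv (x - r) < 1"
    and le: "nv a \<le> 1" "nv b \<le> 1" "nv c \<le> 1" "nv d \<le> 1"
  shows "(\<Sum>r\<in>R. if nv (a - r * c) < 1 \<and> nv (b - r * d) < 1 then 1 else 0) =
    (if nv c < 1 \<and> nv d < 1 then (if nv a < 1 \<and> nv b < 1 then complex_of_real q else 0)
     else if nv (a * d - b * c) < 1 then 1 else 0)"
proof (cases "nv c < 1 \<and> nv d < 1")
  case True
  have "nv (x - r * y) < 1 \<longleftrightarrow> nv x < 1" if "nv y < 1" "r \<in> R" for x y r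
  proof -
    have "nv r * nv y \<le> 1 * nv y" using R(3) that by (intro mult_right_mono) auto
    hence "nv (r * y) < 1" using that by (simp add: nv_mult)
    thus ?thesis using nv_diff_less[of x 1 "r * y"] nv_add_less[of "x - r * y" 1 "r * y"] by auto
  qed
  hence "(\<Sum>r\<in>R. if nv (a - r * c) < 1 \<and> nv (b - r * d) < 1 then 1 else 0) =
      (\<Sum>r\<in>R. if nv a < 1 \<and> nv b < 1 then 1 else (0::complex))"
    using True by (intro sum.cong) auto
  moreover have "of_nat (card R) = complex_of_real q" using R(2) by (metis of_real_of_nat_eq)
  ultimately show ?thesis using True by simp
next
  case False
  have main: "(\<Sum>r\<in>R. if nv (a - r * c) < 1 \<and> nv (b - r * d) < 1 then 1 else (0::complex)) =
     (if nv (a * d - b * c) < 1 then 1 else 0)"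
    if le: "nv a \<le> 1" "nv b \<le> 1" "nv c = 1" "nv d \<le> 1" for a b c d
  proof -
    have "nv (a / c) \<le> 1" using le by (simp add: nv_divide)
    then obtain r0 where r0: "r0 \<in> R" "nv (a / c - r0) < 1" "\<And>r. r \<in> R \<Longrightarrow> nv (a / c - r) < 1 \<Longrightarrow> r = r0"
      using R(4) by blast
    have c0: "c \<noteq> 0" using le by auto
    have eq: "nv (a - r * c) = nv (a / c - r)" for r
    proof -
      have "a - r * c = c * (a / c - r)" using c0 by (simp add: field_simps)
      thus ?thesis using le by (simp add: nv_mult)
    qed
    have "nv d * nv (a - r0 * c) < 1"
      using le(4) r0(2) mult_left_le_one_le[of "nv (a - r0 * c)" "nv d"] unfolding eq by auto
    hence small: "nv (d * (a - r0 * c)) < 1" by (simp add: nv_mult)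
    have "nv (a * d - b * c) < 1 \<longleftrightarrow> nv (c * (b - r0 * d)) < 1"
    proof
      assume "nv (a * d - b * c) < 1"
      from nv_diff_less[OF small this] show "nv (c * (b - r0 * d)) < 1" by (simp add: algebra_simps)
    next
      assume "nv (c * (b - r0 * d)) < 1"
      from nv_diff_less[OF small this] show "nv (a * d - b * c) < 1" by (simp add: algebra_simps)
    qed
    hence det: "nv (a * d - b * c) < 1 \<longleftrightarrow> nv (b - r0 * d) < 1" using le by (simp add: nv_mult)
    have "(\<Sum>r\<in>R. if nv (a - r * c) < 1 \<and> nv (b - r * d) < 1 then 1 else (0::complex)) =
      (\<Sum>r\<in>R. if r = r0 then (if nv (b - r0 * d) < 1 then 1 else 0) else 0)"
    proof (rule sum.cong[OF refl])
      fix r assume "r \<in> R"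
      hence "nv (a - r * c) < 1 \<longleftrightarrow> r = r0" unfolding eq using r0 by blast
      thus "(if nv (a - r * c) < 1 \<and> nv (b - r * d) < 1 then 1 else 0) =
        (if r = r0 then (if nv (b - r0 * d) < 1 then 1 else 0) else (0::complex))" by simp
    qed
    thus ?thesis using R(1) r0(1) det by simp
  qed
  show ?thesis
  proof (cases "nv c = 1")
    case True
    thus ?thesis using main[OF le(1,2) True le(4)] False by simp
  next
    case c: False
    hence d: "nv d = 1" using False le by auto
    have det: "nv (b * c - a * d) = nv (a * d - b * c)" by (rule nv_diff_commute)
    have "(\<Sum>r\<in>R. if nv (a - r * c) < 1 \<and> nv (b - r * d) < 1 then 1 else (0::complex)) =
      (\<Sum>r\<in>R. if nv (b - r * d) < 1 \<and> nv (a - r * c) < 1 then 1 else 0)"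
      by (rule sum.cong[OF refl]) (simp add: conj_commute)
    thus ?thesis unfolding main[OF le(2,1) d le(3)] det using d by (simp only: less_irrefl simp_thms if_False)
  qed
qed

text \<open>Inclusion-exclusion over the sublattices of \<open>O\<^sup>2\<close> containing \<open>\<pi> O\<^sup>2\<close> expresses the indicator of
  \<open>GL\<^sub>2(O)\<close> through translates of the indicator of \<open>M\<^sub>2(O)\<close>; modulo the kernel the coefficients
  add up to \<open>1 - (q + 1) / q + q / q\<^sup>2 = 0\<close>. This is why the open orbit does not contribute.\<close>

lemma indK_in_W: "indK \<in> W"
proof -
  obtain R where R: "finite R" "real (card R) = q" "R \<subseteq> {x. nv x \<le> 1}"
    "\<And>x. nv x \<le> 1 \<Longrightarrow> \<exists>!r. r \<in> R \<and> nv (x - r) < 1" using ex_digits by blast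
  \<comment> \<open>These matrices test whether the columns of \<open>M\<close> lie in a given
    sublattice. The \<open>?h r\<close> and \<open>?hi\<close> give the \<open>q + 1\<close>
    sublattices of index \<open>q\<close> containing \<open>\<pi> O^2\<close>, one for each line
    over the residue field; \<open>?hs\<close> gives \<open>\<pi> O^2\<close> itself, whose
    coefficient \<open>q\<close> corrects the overcount.\<close>
  let ?h = "\<lambda>r. mat2 (1 / unif) (- r / unif) 0 1"
  let ?hi = "mat2 1 0 0 (1 / unif)" and ?hs = "mat2 (1 / unif) 0 0 (1 / unif)"
  let ?t = "\<lambda>h::'a mat2. (\<lambda>M. ball1 (h ** M))"
  define Q where "Q = complex_of_real q"
  have Q: "Q \<noteq> 0" by (simp add: Q_def)
  have W: "?t h - cscale (of_real (inverse (nv (det h)))) ball1 \<in> W" if "det h \<noteq> 0" for h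
    using W_translate[OF ball1_schwartz] that by (simp add: GL2_iff)
  have W1: "?t (?h r) - cscale (1 / Q) ball1 \<in> W" for r
    using W[of "?h r"] by (simp add: nv_divide nv_unif Q_def inverse_eq_divide)
  have W2: "?t ?hi - cscale (1 / Q) ball1 \<in> W"
    using W[of ?hi] by (simp add: nv_divide nv_unif Q_def inverse_eq_divide)
  have W3: "?t ?hs - cscale (1 / (Q * Q)) ball1 \<in> W"
    using W[of ?hs] by (simp add: nv_divide nv_mult nv_unif Q_def inverse_eq_divide)
  have point: "indK M = ball1 M - (\<Sum>r\<in>R. ball1 (?h r ** M)) - ball1 (?hi ** M) + Q * ball1 (?hs ** M)" for M
  proof -
    obtain a b c d where M: "M = mat2 a b c d" by (rule mat2_cases)
    have h: "?h r ** M = mat2 ((a - r * c) / unif) ((b - r * d) / unif) c d"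
      "?hi ** M = mat2 a b (c / unif) (d / unif)"
      "?hs ** M = mat2 (a / unif) (b / unif) (c / unif) (d / unif)" for r
      by (simp_all add: M mat2_mult diff_divide_distrib)
    have e: "ball1 (?h r ** M) = (if (nv (a - r * c) < 1 \<and> nv (b - r * d) < 1) \<and> nv c \<le> 1 \<and> nv d \<le> 1 then 1 else 0)"
      "ball1 (?hi ** M) = (if nv a \<le> 1 \<and> nv b \<le> 1 \<and> nv c < 1 \<and> nv d < 1 then 1 else 0)"
      "ball1 (?hs ** M) = (if nv a < 1 \<and> nv b < 1 \<and> nv c < 1 \<and> nv d < 1 then 1 else 0)"
      "ball1 M = (if nv a \<le> 1 \<and> nv b \<le> 1 \<and> nv c \<le> 1 \<and> nv d \<le> 1 then 1 else 0)" for r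
      unfolding ball1_def h mnv_le_iff mat2_nth nv_div_unif unfolding M mat2_nth by auto
    show ?thesis
    proof (cases "nv a \<le> 1 \<and> nv b \<le> 1 \<and> nv c \<le> 1 \<and> nv d \<le> 1")
      case True
      have "nv (a * d - b * c) \<le> 1"
        using True nv_det_le[of M] mnv_le_iff[of nv M 1] mult_mono[of "mn M" 1 "mn M" 1]
        by (simp add: M)
      hence det: "nv (a * d - b * c) = 1 \<longleftrightarrow> \<not> nv (a * d - b * c) < 1" by linarith
      have small: "nv (a * d - b * c) < 1" if "nv c < 1 \<and> nv d < 1"
      proof (rule nv_diff_less)
        show "nv (a * d) < 1" using True that mult_left_le_one_le[of "nv d" "nv a"] by (auto simp: nv_mult)
        show "nv (b * c) < 1" using True that mult_left_le_one_le[of "nv c" "nv b"] by (auto simp: nv_mult)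
      qed
      have K: "indK M = (if nv (a * d - b * c) < 1 then 0 else 1)"
        using True det by (auto simp: indK_def maxK_def M mnv_le_iff)
      have s: "(\<Sum>r\<in>R. ball1 (?h r ** M)) = (\<Sum>r\<in>R. if nv (a - r * c) < 1 \<and> nv (b - r * d) < 1 then 1 else 0)"
        unfolding e using True by (intro sum.cong) auto
      have "(\<Sum>r\<in>R. ball1 (?h r ** M)) =
        (if nv c < 1 \<and> nv d < 1 then (if nv a < 1 \<and> nv b < 1 then Q else 0)
         else if nv (a * d - b * c) < 1 then 1 else 0)"
        unfolding s Q_def using digit_count[OF R] True by blast
      thus ?thesis unfolding K e(2-4) using True small by auto
    next
      case False
      have "\<not> (nv (a - r * c) < 1 \<and> nv (b - r * d) < 1 \<and> nv c \<le> 1 \<and> nv d \<le> 1)" if r: "r \<in> R" for r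
      proof
        assume h: "nv (a - r * c) < 1 \<and> nv (b - r * d) < 1 \<and> nv c \<le> 1 \<and> nv d \<le> 1"
        have "nv r \<le> 1" using R(3) r by auto
        hence "nv (r * c) \<le> 1" "nv (r * d) \<le> 1" using h by (auto simp: nv_mult mult_le_one)
        hence "nv a \<le> 1" "nv b \<le> 1"
          using nv_add_le[of "a - r * c" 1 "r * c"] nv_add_le[of "b - r * d" 1 "r * d"] h by auto
        thus False using False h by auto
      qed
      hence "(\<Sum>r\<in>R. ball1 (?h r ** M)) = 0" unfolding e by (intro sum.neutral) auto
      moreover have "indK M = 0" using False by (auto simp: indK_def maxK_def M mnv_le_iff)
      ultimately show ?thesis using False e(2-4) by auto
    qed
  qed
  have "indK = cscale Q (?t ?hs - cscale (1 / (Q * Q)) ball1)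
      - (\<Sum>r\<in>R. ?t (?h r) - cscale (1 / Q) ball1) - (?t ?hi - cscale (1 / Q) ball1)"
  proof
    fix M
    have "(\<Sum>r\<in>R. ball1 (?h r ** M) - 1 / Q * ball1 M) = (\<Sum>r\<in>R. ball1 (?h r ** M)) - ball1 M"
    proof -
      have "of_nat (card R) = Q" unfolding Q_def using R(2) by (metis of_real_of_nat_eq)
      thus ?thesis using Q by (simp add: sum_subtractf)
    qed
    thus "indK M = (cscale Q (?t ?hs - cscale (1 / (Q * Q)) ball1)
      - (\<Sum>r\<in>R. ?t (?h r) - cscale (1 / Q) ball1) - (?t ?hi - cscale (1 / Q) ball1)) M"
      using Q unfolding point by (simp add: sum_fun_at right_diff_distrib)
  qed
  also have "\<dots> \<in> W"
    by (intro cvec.subspace_diff[OF W_subspace] cvec.subspace_scale[OF W_subspace]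
        cvec.subspace_sum[OF W_subspace] W1 W2 W3)
  finally show ?thesis .
qed

definition indKA :: "'a mat2 \<Rightarrow> 'a mat2 \<Rightarrow> complex" where
  "indKA A M = indK (M ** matrix_inv A)"

lemma indKA_in_W: "A \<in> GL2 \<Longrightarrow> indKA A \<in> W"
  unfolding indKA_def[abs_def] by (rule W_right[OF indK_in_W GL2_inv(1)])

lemma indKA_eq: "indKA A M = (if \<exists>k\<in>maxK. M = k ** A then 1 else 0)" if "A \<in> GL2"
proof -
  have "M ** matrix_inv A \<in> maxK \<longleftrightarrow> (\<exists>k\<in>maxK. M = k ** A)"
  proof
    assume "M ** matrix_inv A \<in> maxK"
    moreover have "M = M ** matrix_inv A ** A"
      using GL2_inv(3)[OF that] by (simp flip: matrix_mul_assoc)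
    ultimately show "\<exists>k\<in>maxK. M = k ** A" by blast
  next
    assume "\<exists>k\<in>maxK. M = k ** A"
    thus "M ** matrix_inv A \<in> maxK" using GL2_inv(2)[OF that] by (auto simp flip: matrix_mul_assoc)
  qed
  thus ?thesis by (simp add: indKA_def indK_def)
qed

lemma indKA_cong:
  assumes "A \<in> GL2" "k \<in> maxK"
  shows "indKA (k ** A) = indKA A"
proof
  fix M
  have "(\<exists>l\<in>maxK. M = l ** (k ** A)) \<longleftrightarrow> (\<exists>l\<in>maxK. M = l ** A)"
  proof
    assume "\<exists>l\<in>maxK. M = l ** (k ** A)"
    thus "\<exists>l\<in>maxK. M = l ** A" using maxK_mult[OF _ assms(2)] by (auto simp: matrix_mul_assoc)
  next
    assume "\<exists>l\<in>maxK. M = l ** A"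
    then obtain l where l: "l \<in> maxK" "M = l ** A" by blast
    have "M = (l ** matrix_inv k) ** (k ** A)"
      using GL2_inv(3)[OF maxK_GL2[OF assms(2)]] l by (metis matrix_mul_assoc matrix_mul_rid)
    thus "\<exists>l\<in>maxK. M = l ** (k ** A)" using maxK_mult[OF l(1) maxK_inv[OF assms(2)]] by blast
  qed
  thus "indKA (k ** A) M = indKA A M"
    using assms indKA_eq GL2_mult[OF maxK_GL2[OF assms(2)] assms(1)] by simp
qed

text \<open>A lower bound on the determinant bounds the inverses by \<open>1 / \<epsilon>\<close>.
  If \<open>A\<close> and \<open>B\<close> in the support are within \<open>\<epsilon> / 2\<close>,
  then \<open>A B^-1\<close> is within 1/2 of the identity, so both lie in one coset of
  \<open>maxK\<close>; hence finitely many cosets meet the support.\<close>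

lemma K_invariant_in_W:
  assumes inv: "\<And>k M. k \<in> maxK \<Longrightarrow> F (k ** M) = F M"
    and supp: "\<And>M. F M \<noteq> 0 \<Longrightarrow> mn M \<le> 1 \<and> nv (det M) \<ge> \<epsilon>" and \<epsilon>: "\<epsilon> > 0"
  shows "F \<in> W"
proof -
  let ?X = "{A. F A \<noteq> 0}"
  have GL: "A \<in> GL2" if "A \<in> ?X" for A using supp[of A] that \<epsilon> by (auto simp: GL2_iff)
  have fin: "finite (indKA ` ?X)"
  proof (rule finite_image_locally_const[of "\<epsilon> / 2" _ 1])
    show "mn M \<le> 1" if "M \<in> ?X" for M using supp that by blast
    fix A B assume A: "A \<in> ?X" and B: "B \<in> ?X" and d: "mn (A - B) \<le> \<epsilon> / 2"
    have iB: "mn (matrix_inv B) \<le> 1 / \<epsilon>"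
      unfolding mn_inv[OF GL[OF B]] using supp[of B] B \<epsilon> by (intro frac_le) auto
    have "mn ((A - B) ** matrix_inv B) \<le> \<epsilon> / 2 * (1 / \<epsilon>)" by (rule mn_mult_le'[OF d iB])
    hence "mn (A ** matrix_inv B - mat 1) < 1"
      using \<epsilon> GL2_inv(2)[OF GL[OF B]] by (simp add: mat2_mult_distribs)
    hence k: "A ** matrix_inv B \<in> maxK" by (rule maxK_near_1)
    have "A = (A ** matrix_inv B) ** B" using GL2_inv(3)[OF GL[OF B]] by (simp flip: matrix_mul_assoc)
    thus "indKA A = indKA B" using indKA_cong[OF GL[OF B] k] by simp
  qed (use \<epsilon> in simp)
  have "F = (\<Sum>k\<in>indKA ` ?X. cscale (F (inv_into ?X indKA k)) k)"
  proof (rule finite_decomposition[OF fin])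
    fix M assume "F M \<noteq> 0"
    moreover from this have "indKA M M \<noteq> 0"
      using indKA_eq[OF GL, of M M] bexI[OF _ maxK_1, of "\<lambda>k. M = k ** M"] by simp
    ultimately show "\<exists>A\<in>?X. indKA A M \<noteq> 0" by blast
  next
    fix A B M assume A: "A \<in> ?X" and B: "B \<in> ?X" and nz: "indKA A M \<noteq> 0" "indKA B M \<noteq> 0"
    obtain k where k: "k \<in> maxK" "M = k ** A" using nz(1) indKA_eq[OF GL[OF A]] by (auto split: if_splits)
    obtain l where l: "l \<in> maxK" "M = l ** B" using nz(2) indKA_eq[OF GL[OF B]] by (auto split: if_splits)
    show "indKA A = indKA B"
      using indKA_cong[OF GL[OF A] k(1)] indKA_cong[OF GL[OF B] l(1)] k l by simp
  next
    fix A M assume A: "A \<in> ?X" and nz: "indKA A M \<noteq> 0"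
    then obtain k where "k \<in> maxK" "M = k ** A" using indKA_eq[OF GL[OF A]] by (auto split: if_splits)
    thus "F M = F A * indKA A M" using inv indKA_eq[OF GL[OF A]] by auto
  qed
  also have "\<dots> \<in> W"
    by (intro cvec.subspace_sum[OF W_subspace] cvec.subspace_scale[OF W_subspace]) (use GL indKA_in_W in auto)
  finally show ?thesis .
qed

text \<open>All translates by \<open>maxK\<close> agree with \<open>F\<close> modulo
  \<open>W\<close>, as the determinants are units. Support in norm 1 makes the translate depend on
  \<open>k\<close> in a uniformly locally constant way, so there are finitely many and their mean is
  available.\<close>

lemma average_over_K:
  assumes F: "F \<in> schwartz nv" and supp: "\<And>M. F M \<noteq> 0 \<Longrightarrow> mn M = 1"
  shows "\<exists>F' \<in> schwartz nv. F' - F \<in> W \<and> (\<forall>M. F' M \<noteq> 0 \<longrightarrow> mn M = 1) \<and>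
    (\<forall>k\<in>maxK. \<forall>M. F' (k ** M) = F' M)"
proof -
  obtain r s where s: "s > 0" "mlevel F r s" using F unfolding schwartz_iff by blast
  define O' where "O' = (\<lambda>k M. F (k ** M)) ` maxK"
  have fin: "finite O'" unfolding O'_def
  proof (rule finite_image_locally_const[OF s(1), of _ 1])
    show "mn k \<le> 1" if "k \<in> maxK" for k using that by (simp add: maxK_def)
    fix k l assume kl: "k \<in> maxK" "l \<in> maxK" "mn (k - l) \<le> s"
    show "(\<lambda>M. F (k ** M)) = (\<lambda>M. F (l ** M))"
    proof
      fix M
      show "F (k ** M) = F (l ** M)"
      proof (cases "mn M = 1")
        case True
        have "mn ((k - l) ** M) \<le> s * 1" by (rule mn_mult_le') (use kl True in auto)
        thus ?thesis by (intro mlevel_close[OF s(2)]) (simp add: mat2_mult_distribs)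
      next
        case False
        hence "F (k ** M) = 0" "F (l ** M) = 0"
          using supp[of "k ** M"] supp[of "l ** M"] mn_maxK_left kl by auto
        thus ?thesis by simp
      qed
    qed
  qed
  have ne: "O' \<noteq> {}" using maxK_1 by (auto simp: O'_def)
  define n where "n = complex_of_nat (card O')"
  have n: "n \<noteq> 0" using fin ne by (simp add: n_def)
  define F' where "F' = cscale (1 / n) (\<Sum>O')"
  have "\<phi> \<in> schwartz nv" if "\<phi> \<in> O'" for \<phi>
    using that schwartz_comp_left[OF F maxK_GL2] by (auto simp: O'_def)
  hence sch: "F' \<in> schwartz nv" unfolding F'_def
    by (intro cvec.subspace_scale[OF schwartz_subspace] cvec.subspace_sum[OF schwartz_subspace])
  have dW: "\<phi> - F \<in> W" if \<phi>: "\<phi> \<in> O'" for \<phi>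
  proof -
    obtain k where k: "k \<in> maxK" "\<phi> = (\<lambda>M. F (k ** M))" using \<phi> by (auto simp: O'_def)
    show ?thesis using W_translate[OF F maxK_GL2[OF k(1)]] k by (simp add: maxK_def)
  qed
  have "F' - F = cscale (1 / n) (\<Sum>\<phi>\<in>O'. \<phi> - F)"
    using n by (auto simp: fun_eq_iff F'_def sum_fun_at sum_subtractf n_def right_diff_distrib)
  also have "\<dots> \<in> W"
    by (intro cvec.subspace_scale[OF W_subspace] cvec.subspace_sum[OF W_subspace] dW)
  finally have W: "F' - F \<in> W" .
  have "mn M = 1" if "F' M \<noteq> 0" for M
  proof -
    have "(\<Sum>\<phi>\<in>O'. \<phi> M) \<noteq> 0" using that by (auto simp: F'_def sum_fun_at)
    then obtain \<phi> where "\<phi> \<in> O'" "\<phi> M \<noteq> 0" by (metis sum.neutral)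
    then obtain k where "k \<in> maxK" "F (k ** M) \<noteq> 0" by (auto simp: O'_def)
    thus ?thesis using supp mn_maxK_left by metis
  qed
  moreover have "F' (l ** M) = F' M" if l: "l \<in> maxK" for l M
  proof -
    let ?\<tau> = "\<lambda>\<phi> :: 'a mat2 \<Rightarrow> complex. \<lambda>M. \<phi> (l ** M)"
    have "?\<tau> ` O' \<subseteq> O'"
    proof clarify
      fix \<phi> assume "\<phi> \<in> O'"
      then obtain k where "k \<in> maxK" "\<phi> = (\<lambda>M. F (k ** M))" by (auto simp: O'_def)
      thus "?\<tau> \<phi> \<in> O'" using maxK_mult[OF _ l] by (auto simp: O'_def matrix_mul_assoc)
    qed
    moreover have "inj_on ?\<tau> O'"
    proof (rule inj_onI)
      fix \<phi> \<psi> :: "'a mat2 \<Rightarrow> complex" assume e: "?\<tau> \<phi> = ?\<tau> \<psi>"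
      have "\<phi> N = \<psi> N" for N
        using fun_cong[OF e, of "matrix_inv l ** N"] GL2_inv(2)[OF maxK_GL2[OF l]]
        by (simp add: matrix_mul_assoc)
      thus "\<phi> = \<psi>" by auto
    qed
    ultimately have "(\<Sum>\<phi>\<in>O'. ?\<tau> \<phi>) = \<Sum>O'" using sum_invariant[OF fin] by blast
    hence "(\<Sum>\<phi>\<in>O'. ?\<tau> \<phi>) M = (\<Sum>O') M" by simp
    thus ?thesis by (simp add: F'_def sum_fun_at)
  qed
  ultimately show ?thesis using sch W by blast
qed

lemma mn_add_absorb: "mn N < mn M \<Longrightarrow> mn (M + N) = mn M"
  using mn_add_le[of M "mn M" N] mn_diff_le[of "M + N" "max (mn (M + N)) (mn N)" N]
  by auto

text \<open>A central scalar moves each shell of constant norm to the unit shell, at the cost of a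
  nonzero constant modulo \<open>W\<close>. Vanishing at the origin leaves only finitely many
  shells.\<close>

lemma fold_to_unit_sphere:
  assumes f: "f \<in> schwartz nv" and f0: "f 0 = 0"
  shows "\<exists>F \<in> schwartz nv. F - f \<in> W \<and> (\<forall>M. F M \<noteq> 0 \<longrightarrow> mn M = 1)"
proof -
  obtain r s where s: "s > 0" "mlevel f r s" using f unfolding schwartz_iff by blast
  \<comment> \<open>Within the invariance radius \<open>s\<close> of the origin \<open>f\<close>
    equals \<open>f 0\<close>, which is 0.\<close>
  have shell: "s < mn M \<and> mn M \<le> r" if "f M \<noteq> 0" for M
    using that s(2) f0 mlevel_close[OF s(2), of M 0] unfolding mlevel_def by force
  obtain n where n: "max r (inverse s) < q ^ n" using real_arch_pow[OF q_gt_1] by blast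
  have ns: "inverse (q ^ n) < s" using less_imp_inverse_less[of "inverse s" "q ^ n"] n s(1) by simp
  define I where "I = {- int n..int n}"
  define g where "g k M = (if mn M = q powi k then f M else 0)" for k M
  have qp: "q powi k > 0" for k by simp
  have f_sum: "f = (\<Sum>k\<in>I. g k)"
  proof
    fix M
    show "f M = (\<Sum>k\<in>I. g k) M"
    proof (cases "f M = 0")
      case True
      hence "g k M = 0" for k by (simp add: g_def)
      thus ?thesis using True by (simp add: sum_fun_at)
    next
      case False
      hence sh: "s < mn M" "mn M \<le> r" using shell by auto
      hence "M \<noteq> 0" using s(1) by auto
      then obtain k where k: "mn M = q powi k" using mn_value by blast
      have "q powi (- int n) < q powi k" using sh ns by (simp add: k power_int_minus)
      moreover have "q powi k < q powi (int n)" using sh n by (simp add: k)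
      ultimately have "k \<in> I" unfolding q_powi_less_iff I_def by auto
      moreover have "g l M = (if l = k then f M else 0)" for l
        unfolding g_def k using q_powi_le_iff[of l k] q_powi_le_iff[of k l] by (metis order_antisym order_refl)
      ultimately show ?thesis by (simp add: sum_fun_at I_def)
    qed
  qed
  have gs: "g k \<in> schwartz nv" for k
  proof -
    have "g k (M + N) = g k M" if N: "mn N \<le> min s (q powi k / 2)" for M N
    proof -
      have "mn N < q powi k" using N qp[of k] by linarith
      hence "mn (M + N) = q powi k \<longleftrightarrow> mn M = q powi k"
        using mn_add_absorb[of N M] mn_add_absorb[of "- N" "M + N"] by auto
      thus ?thesis using N s(2) unfolding g_def mlevel_def by auto
    qed
    hence "mlevel (g k) r (min s (q powi k / 2))"
      using s(2) unfolding mlevel_def by (auto simp: g_def)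
    thus ?thesis unfolding schwartz_iff using s(1) qp[of k] by (intro exI[of _ r] exI[of _ "min s (q powi k / 2)"]) auto
  qed
  have "\<exists>F \<in> schwartz nv. F - g k \<in> W \<and> (\<forall>M. F M \<noteq> 0 \<longrightarrow> mn M = 1)" for k
  proof -
    define t where "t = unif powi (- k)"
    have t: "nv t = q powi k" unfolding t_def by (rule nv_unif_powi)
    let ?h = "mat2 t 0 0 t"
    have t0: "t \<noteq> 0" by (simp add: t_def)
    have h: "?h \<in> GL2" using t0 by (simp add: GL2_iff)
    let ?c = "complex_of_real (inverse (nv (det ?h)))"
    have c: "?c \<noteq> 0" using t0 by simp
    let ?F = "cscale (1 / ?c) (\<lambda>M. g k (?h ** M))"
    have "cscale (1 / ?c) ((\<lambda>M. g k (?h ** M)) - cscale ?c (g k)) \<in> W"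
      by (rule cvec.subspace_scale[OF W_subspace W_translate[OF gs h]])
    also have "cscale (1 / ?c) ((\<lambda>M. g k (?h ** M)) - cscale ?c (g k)) = ?F - g k"
      using c by (auto simp: fun_eq_iff right_diff_distrib)
    finally have "?F - g k \<in> W" .
    moreover have "?F \<in> schwartz nv"
      by (rule cvec.subspace_scale[OF schwartz_subspace schwartz_comp_left[OF gs h]])
    moreover have "mn M = 1" if "?F M \<noteq> 0" for M
    proof -
      have "nv t * mn M = nv t * 1" using that by (simp add: g_def mn_scalar t split: if_splits)
      thus ?thesis using t0 by simp
    qed
    ultimately show ?thesis by blast
  qed
  then obtain F where F: "\<And>k. F k \<in> schwartz nv" "\<And>k. F k - g k \<in> W" "\<And>k M. F k M \<noteq> 0 \<Longrightarrow> mn M = 1"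
    by metis
  have "(\<Sum>k\<in>I. F k) \<in> schwartz nv" by (intro cvec.subspace_sum[OF schwartz_subspace] F)
  moreover have "(\<Sum>k\<in>I. F k - g k) \<in> W" by (intro cvec.subspace_sum[OF W_subspace] F)
  moreover have "mn M = 1" if "(\<Sum>k\<in>I. F k) M \<noteq> 0" for M
    using that F(3) unfolding sum_fun_at by (metis sum.neutral)
  ultimately show ?thesis unfolding f_sum by (intro bexI[of _ "\<Sum>k\<in>I. F k"]) (auto simp: sum_subtractf)
qed

lemma integ2_unit_sphere:
  "sch2 (\<lambda>x y. if max (nv x) (nv y) = 1 then 1 else 0)" (is ?A)
  "integ2 (\<lambda>x y. if max (nv x) (nv y) = 1 then 1 else 0) = of_real (1 - 1 / (q * q))" (is ?B)
proof -
  let ?b = "\<lambda>a x. if nv x \<le> nv (a :: 'a) then 1 else (0::complex)"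
  have e: "(\<lambda>x y. if max (nv x) (nv y) = 1 then 1 else 0) =
    (\<lambda>x y. ?b 1 x * ?b 1 y + (-1) * (?b unif x * ?b unif y))"
  proof (intro ext)
    fix x y
    have u: "nv z \<le> nv unif \<longleftrightarrow> nv z < 1" for z by (simp add: nv_unif nv_less_1_iff)
    show "(if max (nv x) (nv y) = 1 then 1 else 0) = ?b 1 x * ?b 1 y + (-1) * (?b unif x * ?b unif y)"
      unfolding u nv_1 by (cases "nv x < 1"; cases "nv y < 1") (auto simp: max_def)
  qed
  have s: "sch1 (?b 1)" "sch1 (?b unif)" by (rule sch1_ball; simp)+
  show ?A unfolding e by (intro sch2_add sch2_cmult sch2_prod s)
  have "integ2 (\<lambda>x y. ?b 1 x * ?b 1 y + (-1) * (?b unif x * ?b unif y)) =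
      integ (?b 1) * integ (?b 1) + (-1) * (integ (?b unif) * integ (?b unif))"
    unfolding integ2_add[OF sch2_prod[OF s(1,1)] sch2_cmult[OF sch2_prod[OF s(2,2)]]]
      integ2_cmult[OF sch2_prod[OF s(2,2)]] integ2_prod[OF s(1,1)] integ2_prod[OF s(2,2)] by (rule refl)
  also have "\<dots> = of_real (1 - 1 / (q * q))"
    unfolding integ_ball[OF one_neq_zero] integ_ball[OF unif_nz] by (simp add: nv_unif)
  finally show ?B unfolding e .
qed

lemma q_square_nz: "complex_of_real (1 - 1 / (q * q)) \<noteq> 0"
proof -
  have "1 < q * q" using q_gt_1 less_1_mult by blast
  hence "1 / (q * q) < 1" by simp
  thus ?thesis by (metis less_irrefl of_real_eq_0_iff right_minus_eq)
qed

lemma kerT_subset_W: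
  assumes f: "f \<in> schwartz nv" and Tf: "T f = 0"
  shows "f \<in> W"
proof -
  \<comment> \<open>Scaling fixes the value at the origin but counts as multiplication by
    \<open>q^-2\<close> in the coinvariants. The difference \<open>u\<close> lies in
    \<open>W\<close> and has value \<open>1 - q^-2\<close> at 0, so a multiple of it removes
    \<open>f 0\<close>.\<close>
  define u where "u = (\<lambda>M. ball1 (mat2 (1 / unif) 0 0 (1 / unif) ** M)) - cscale (of_real (1 / (q * q))) ball1"
  have u: "u \<in> W" using W_translate[OF ball1_schwartz, of "mat2 (1 / unif) 0 0 (1 / unif)"]
    by (simp add: GL2_iff u_def nv_divide nv_mult nv_unif inverse_eq_divide)
  have u0: "u 0 \<noteq> 0" using q_square_nz by (simp add: u_def ball1_def)
  define f1 where "f1 = f - cscale (f 0 / u 0) u"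
  have cu: "cscale (f 0 / u 0) u \<in> W" using cvec.subspace_scale[OF W_subspace u] .
  have f1: "f1 \<in> schwartz nv" "f1 0 = 0" "f - f1 \<in> W"
    using cvec.subspace_diff[OF schwartz_subspace f] cu W_schwartz u0 by (auto simp: f1_def)
  obtain F2 where F2: "F2 \<in> schwartz nv" "F2 - f1 \<in> W" "\<And>M. F2 M \<noteq> 0 \<Longrightarrow> mn M = 1"
    using fold_to_unit_sphere[OF f1(1,2)] by blast
  obtain F where F: "F \<in> schwartz nv" "F - F2 \<in> W" "\<And>M. F M \<noteq> 0 \<Longrightarrow> mn M = 1"
    "\<And>k M. k \<in> maxK \<Longrightarrow> F (k ** M) = F M"
    using average_over_K[OF F2(1,3)] by blast
  have "(f - f1) - (F2 - f1) - (F - F2) \<in> W"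
    using f1(3) F2(2) F(2) cvec.subspace_diff[OF W_subspace] by blast
  also have "(f - f1) - (F2 - f1) - (F - F2) = f - F" by simp
  finally have fF: "f - F \<in> W" .
  hence "T (f - F) = 0" using W_kerT by blast
  hence TF: "T F = 0" using T_diff[OF f F(1)] Tf by simp
  \<comment> \<open>A primitive column \<open>v\<close> extends to an element of
    \<open>maxK\<close>, so \<open>F\<close> is constant on the matrices \<open>v (c, d)\<close>
    with \<open>v\<close> primitive and vanishes on the other multiples. The column integral is
    therefore this constant times the volume \<open>1 - q^-2\<close>.\<close>
  have row0: "F (mat2 c d 0 0) = 0" if cd: "max (nv c) (nv d) = 1" for c d
  proof -
    have "T F (row_mat c d) = 0" using TF by simp
    hence I0: "integ2 (row_fun F c d) = 0" using nv_det_row_mat[of c d] cd by (simp add: T_def)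
    have "row_fun F c d = (\<lambda>x y. F (mat2 c d 0 0) * (if max (nv x) (nv y) = 1 then 1 else 0))"
    proof (intro ext)
      fix x y
      have mx: "max (nv (z * c)) (nv (z * d)) = nv z" for z
        using cd by (simp add: nv_mult flip: max_mult_distrib_left) (metis max_mult_distrib_left mult.right_neutral nv_nonneg)
      show "row_fun F c d x y = F (mat2 c d 0 0) * (if max (nv x) (nv y) = 1 then 1 else 0)"
      proof (cases "max (nv x) (nv y) = 1")
        case True
        have "\<exists>k\<in>maxK. mat2 (x * c) (x * d) (y * c) (y * d) = k ** mat2 c d 0 0"
        proof (cases "nv x = 1")
          case x: True
          show ?thesis using True x
            by (intro bexI[of _ "mat2 x 0 y 1"]) (auto simp: mat2_mult maxK_def mnv_mat2)
        next
          case False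
          hence "nv y = 1" using True by (auto simp: max_def split: if_splits)
          thus ?thesis using True
            by (intro bexI[of _ "mat2 x 1 y 0"]) (auto simp: mat2_mult maxK_def mnv_mat2)
        qed
        thus ?thesis using True F(4) by (auto simp: row_fun_def)
      next
        case False
        have "mn (mat2 (x * c) (x * d) (y * c) (y * d)) = max (nv x) (nv y)" by (simp add: mnv_mat2 mx)
        thus ?thesis using False F(3)[of "mat2 (x * c) (x * d) (y * c) (y * d)"] by (auto simp: row_fun_def)
      qed
    qed
    hence "F (mat2 c d 0 0) * of_real (1 - 1 / (q * q)) = 0"
      using I0 integ2_cmult[OF integ2_unit_sphere(1), of "F (mat2 c d 0 0)"] integ2_unit_sphere(2) by (simp only:)
    thus ?thesis using q_square_nz by (metis mult_eq_0_iff)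
  qed
  obtain r s where s: "s > 0" "mlevel F r s" using F(1) unfolding schwartz_iff by blast
  \<comment> \<open>Subtracting a multiple of the primitive first row from the second leaves one
    entry, the determinant up to a unit. If it is at most \<open>s\<close>, the result cannot be
    distinguished by \<open>F\<close> from a matrix with zero second row.\<close>
  have top: "F (mat2 a b c d) = 0" if "max (nv a) (nv b) = 1" "nv c \<le> 1" "nv d \<le> 1" "nv (a * d - b * c) \<le> s" for a b c d
  proof -
    have "\<exists>k\<in>maxK. mn (k ** mat2 a b c d - mat2 a b 0 0) \<le> s"
    proof (cases "nv a = 1")
      case True
      hence a: "a \<noteq> 0" by auto
      have "k \<in> maxK" if "k = mat2 1 0 (- c / a) 1" for k
        using that \<open>nv c \<le> 1\<close> True by (simp add: maxK_def mnv_mat2 nv_divide)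
      moreover have "mat2 1 0 (- c / a) 1 ** mat2 a b c d - mat2 a b 0 0 = mat2 0 0 0 ((a * d - b * c) / a)"
        using a by (simp add: mat2_mult mat2_diff field_simps)
      ultimately show ?thesis using that(4) s(1) True by (intro bexI[of _ "mat2 1 0 (- c / a) 1"]) (auto simp: mnv_mat2 nv_divide)
    next
      case False
      hence nb: "nv b = 1" using that(1) by (auto simp: max_def split: if_splits)
      hence b: "b \<noteq> 0" by auto
      have "k \<in> maxK" if "k = mat2 1 0 (- d / b) 1" for k
        using that \<open>nv d \<le> 1\<close> nb by (simp add: maxK_def mnv_mat2 nv_divide)
      moreover have "mat2 1 0 (- d / b) 1 ** mat2 a b c d - mat2 a b 0 0 = mat2 0 0 (- (a * d - b * c) / b) 0"
        using b by (simp add: mat2_mult mat2_diff field_simps)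
      moreover have "nv (- (a * d - b * c) / b) \<le> s" using that(4) nb unfolding nv_divide nv_minus by simp
      ultimately show ?thesis using s(1) by (intro bexI[of _ "mat2 1 0 (- d / b) 1"]) (auto simp: mnv_mat2)
    qed
    thus ?thesis using F(4) mlevel_close[OF s(2)] row0[OF that(1)] by metis
  qed
  have det: "nv (det M) \<ge> s" if M: "F M \<noteq> 0" for M
  proof (rule ccontr)
    assume c: "\<not> nv (det M) \<ge> s"
    obtain x y z w where e: "M = mat2 x y z w" by (rule mat2_cases)
    have m: "max (max (nv x) (nv y)) (max (nv z) (nv w)) = 1" using F(3)[OF M] by (simp add: e mnv_mat2)
    hence le: "nv x \<le> 1" "nv y \<le> 1" "nv z \<le> 1" "nv w \<le> 1" by (simp_all add: max_def split: if_splits)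
    show False
    proof (cases "max (nv x) (nv y) = 1")
      case True
      thus False using top[of x y z w] le c M by (simp add: e)
    next
      case False
      \<comment> \<open>Some entry has norm 1, so if the first row is not primitive the second one
        is; the row swap belongs to \<open>maxK\<close>.\<close>
      hence "max (nv z) (nv w) = 1" using m by (auto simp: max_def split: if_splits)
      moreover have "nv (z * y - w * x) = nv (x * w - y * z)" using nv_diff_commute[of "x * w" "y * z"] by (simp add: mult.commute)
      ultimately have "F (mat2 z w x y) = 0" using top[of z w x y] le c by (simp add: e)
      moreover have "mat2 0 1 1 0 ** M = mat2 z w x y" by (simp add: e mat2_mult)
      moreover have "mat2 0 1 1 0 \<in> maxK" by (simp add: maxK_def mnv_mat2)
      ultimately show False using F(4)[of "mat2 0 1 1 0" M] M by simp
    qed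
  qed
  have "F \<in> W" by (rule K_invariant_in_W[of F s]) (use F det s in auto)
  hence "(f - F) + F \<in> W" using fF cvec.subspace_add[OF W_subspace] by blast
  thus ?thesis by simp
qed

section \<open>The invariant functional\<close>

definition prim_part :: "('a \<Rightarrow> 'a \<Rightarrow> complex) \<Rightarrow> 'a \<Rightarrow> 'a \<Rightarrow> complex" where
  "prim_part F c d = (if max (nv c) (nv d) = 1 then F c d else 0)"

text \<open>Primitive rows map onto the projective line with the units as fibres, so integrating
  over them gives the total mass of the density up to a fixed factor.\<close>

definition mass :: "('a mat2 \<Rightarrow> complex) \<Rightarrow> complex" where
  "mass f = integ2 (prim_part (dens f))"

lemma dens_lift: "c \<noteq> 0 \<or> d \<noteq> 0 \<Longrightarrow> dens (lift F) c d = F c d"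
  using nv_det_row_mat[of c d] max_nv_pos[of c d] by (simp add: dens_def lift_def)

lemma prim_part_dens_lift: "prim_part (dens (lift F)) = prim_part F"
proof (intro ext)
  fix c d
  show "prim_part (dens (lift F)) c d = prim_part F c d"
    using dens_lift[of c d F] max_nv_pos[of c d] by (auto simp: prim_part_def)
qed

lemma prim_part_level2:
  assumes "rsmooth F"
  shows "\<exists>s>0. s < 1 \<and> level2 (prim_part F) 1 s"
proof -
  obtain s where s: "s > 0" "s < 1" "\<And>c d x y. max (nv c) (nv d) = 1 \<Longrightarrow> nv x \<le> s \<Longrightarrow> nv y \<le> s \<Longrightarrow> F (c + x) (d + y) = F c d"
    using rsmooth_level[OF assms] by blast
  have "level2 (prim_part F) 1 s" unfolding level2_def
  proof (intro conjI allI impI)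
    fix x y assume "prim_part F x y \<noteq> 0"
    thus "nv x \<le> 1" "nv y \<le> 1" by (auto simp: prim_part_def split: if_splits)
  next
    fix x y u v assume uv: "nv u \<le> s" "nv v \<le> s"
    have "max (nv (x + u)) (nv (y + v)) = 1 \<longleftrightarrow> max (nv x) (nv y) = 1"
      using max_nv_add[of u x y v] max_nv_add[of "- u" "x + u" "y + v" "- v"] uv s(2) by auto
    thus "prim_part F (x + u) (y + v) = prim_part F x y" using s(3)[OF _ uv] by (auto simp: prim_part_def)
  qed
  thus ?thesis using s by blast
qed

lemma sch2_prim_part: "rsmooth F \<Longrightarrow> sch2 (prim_part F)"
  using prim_part_level2 unfolding sch2_def by blast

lemma sch2_prim_part_dens: "f \<in> I_half nv \<Longrightarrow> sch2 (prim_part (dens f))"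
  by (intro sch2_prim_part rsmooth_dens)

lemma mass_add:
  assumes "f \<in> I_half nv" "g \<in> I_half nv"
  shows "mass (f + g) = mass f + mass g"
proof -
  have "prim_part (dens (f + g)) = (\<lambda>c d. prim_part (dens f) c d + prim_part (dens g) c d)"
    by (auto simp: fun_eq_iff prim_part_def dens_def add_divide_distrib)
  thus ?thesis using integ2_add[OF sch2_prim_part_dens[OF assms(1)] sch2_prim_part_dens[OF assms(2)]] by (simp add: mass_def)
qed

lemma mass_cscale:
  assumes "f \<in> I_half nv"
  shows "mass (cscale c f) = c * mass f"
proof -
  have "prim_part (dens (cscale c f)) = (\<lambda>x y. c * prim_part (dens f) x y)"
    by (auto simp: fun_eq_iff prim_part_def dens_def)
  thus ?thesis using integ2_cmult[OF sch2_prim_part_dens[OF assms]] by (simp add: mass_def)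
qed

lemma mass_diff:
  assumes "f \<in> I_half nv" "g \<in> I_half nv"
  shows "mass (f - g) = mass f - mass g"
  using mass_add[OF assms(1), of "cscale (-1) g"] mass_cscale[OF assms(2), of "-1"]
    cvec.subspace_scale[OF I_half_subspace assms(2), of "-1"] by simp

lemma sch2_sum: "(\<And>i. i \<in> I \<Longrightarrow> sch2 (\<phi> i)) \<Longrightarrow> sch2 (\<lambda>x y. \<Sum>i\<in>I. \<phi> i x y)"
proof (induction I rule: infinite_finite_induct)
  case (insert i I)
  thus ?case using sch2_add[of "\<phi> i" "\<lambda>x y. \<Sum>i\<in>I. \<phi> i x y"] by simp
qed (use sch2_prod[OF sch1_zero sch1_zero] in simp_all)

lemma integ2_sum:
  "(\<And>i. i \<in> I \<Longrightarrow> sch2 (\<phi> i)) \<Longrightarrow> integ2 (\<lambda>x y. \<Sum>i\<in>I. \<phi> i x y) = (\<Sum>i\<in>I. integ2 (\<phi> i))"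
proof (induction I rule: infinite_finite_induct)
  case (insert i I)
  thus ?case using integ2_add[of "\<phi> i" "\<lambda>x y. \<Sum>i\<in>I. \<phi> i x y"] sch2_sum[of I \<phi>] by simp
qed (simp_all add: integ2_zero)

lemma dens_right:
  assumes f: "f \<in> I_half nv" and h: "h \<in> GL2" and cd: "c \<noteq> 0 \<or> d \<noteq> 0"
  shows "dens (right_transl h f) c d = of_real (nv (det h)) *
    dens f (c * h $ 1 $ 1 + d * h $ 2 $ 1) (c * h $ 1 $ 2 + d * h $ 2 $ 2)"
proof -
  have "f (row_mat c d ** h) = lift (dens f) (row_mat c d ** h)" unfolding lift_dens[OF f] ..
  thus ?thesis using nv_det_row_mat[of c d] max_nv_pos[of c d] cd
    unfolding dens_def[of "right_transl h f"] by (simp add: right_transl_def lift_def mult_row2 det_mul nv_mult)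
qed

text \<open>Both integrals are cut along the shells on which the other norm is constant; homogeneity
  lets the scalar of norm \<open>q\<^sup>k\<close> interchange the two kinds of shells.\<close>

lemma norm_change:
  assumes hom: "homog F" and sm: "rsmooth F" and D: "a * d' - b * c' \<noteq> 0"
  shows "integ2 (\<lambda>x y. if max (nv (a * x + b * y)) (nv (c' * x + d' * y)) = 1 \<and> (x \<noteq> 0 \<or> y \<noteq> 0) then F x y else 0)
    = integ2 (prim_part F)"
proof -
  define N where "N x y = max (nv (a * x + b * y)) (nv (c' * x + d' * y))" for x y
  define C where "C = max (max (nv a) (nv b)) (max (nv c') (nv d'))"
  have C: "nv a \<le> C" "nv b \<le> C" "nv c' \<le> C" "nv d' \<le> C" by (auto simp: C_def)
  have C0: "C \<ge> 0" using C(1) nv_nonneg[of a] by linarith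
  have N_le: "N x y \<le> C * t" if "nv x \<le> t" "nv y \<le> t" for x y t
    unfolding N_def using that by (auto intro!: nv_add_le nv_mult_le C)
  define \<delta> where "\<delta> = nv (a * d' - b * c')"
  have \<delta>: "\<delta> > 0" using D by (simp add: \<delta>_def)
  have N_ge: "\<delta> * max (nv x) (nv y) \<le> C * N x y" for x y
  proof -
    have "(a * d' - b * c') * x = d' * (a * x + b * y) - b * (c' * x + d' * y)"
      "(a * d' - b * c') * y = a * (c' * x + d' * y) - c' * (a * x + b * y)"
      by (simp_all add: algebra_simps)
    hence "nv ((a * d' - b * c') * x) \<le> C * N x y" "nv ((a * d' - b * c') * y) \<le> C * N x y"
      by (simp_all only:) (auto intro!: nv_diff_le nv_mult_le C simp: N_def)
    thus ?thesis by (auto simp: nv_mult \<delta>_def max_def)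
  qed
  have N_scale: "N (t * x) (t * y) = nv t * N x y" for t x y
  proof -
    have "a * (t * x) + b * (t * y) = t * (a * x + b * y)" "c' * (t * x) + d' * (t * y) = t * (c' * x + d' * y)"
      by (simp_all add: algebra_simps)
    thus ?thesis unfolding N_def by (simp add: nv_mult max_mult_distrib_left)
  qed
  have m_scale: "max (nv (t * x)) (nv (t * y)) = nv t * max (nv x) (nv y)" for t x y
    by (simp add: nv_mult max_mult_distrib_left)
  have N_add: "N (x + u) (y + v) = N x y" if "N u v < N x y" for x y u v
  proof -
    have "a * (x + u) + b * (y + v) = (a * x + b * y) + (a * u + b * v)"
      "c' * (x + u) + d' * (y + v) = (c' * x + d' * y) + (c' * u + d' * v)" by (simp_all add: algebra_simps)
    thus ?thesis using that max_nv_add unfolding N_def by auto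
  qed
  have N_uminus: "N (- u) (- v) = N u v" for u v using N_scale[of "-1" u v] by simp
  \<comment> \<open>\<open>A k\<close> is the part of the standard unit shell where the new norm is
    \<open>q^k\<close>; \<open>B k\<close> is the part of the new unit shell where the standard norm
    is \<open>q^-k\<close>. A scalar of norm \<open>q^k\<close> carries the second region to the
    first, and the degree -2 of \<open>F\<close> offsets the Jacobian.\<close>
  define A where "A k x y = (if N x y = q powi k then prim_part F x y else 0)" for k x y
  define B where "B k x y = (if N x y = 1 \<and> max (nv x) (nv y) = q powi (- k) then F x y else 0)" for k x y
  obtain s where s: "s > 0" "s < 1" "level2 (prim_part F) 1 s" using prim_part_level2[OF sm] by blast
  have A_sch: "sch2 (A k)" for k
  proof -
    define s' where "s' = min s (q powi k / (2 * (C + 1)))"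
    have s': "s' > 0" "s' \<le> s" using s(1) C0 by (auto simp: s'_def)
    have "C * s' < q powi k"
    proof -
      have "C * s' \<le> (C + 1) * (q powi k / (2 * (C + 1)))" using C0 s'
        by (intro mult_mono) (auto simp: s'_def)
      also have "\<dots> = q powi k / 2" using C0 by (simp add: field_simps)
      also have "\<dots> < q powi k" by simp
      finally show ?thesis .
    qed
    hence Nu: "N u v < q powi k" if "nv u \<le> s'" "nv v \<le> s'" for u v
      using N_le[OF that] by linarith
    have "A k (x + u) (y + v) = A k x y" if uv: "nv u \<le> s'" "nv v \<le> s'" for x y u v
    proof -
      have "N (x + u) (y + v) = q powi k \<longleftrightarrow> N x y = q powi k"
        using N_add[of u v x y] N_add[of "- u" "- v" "x + u" "y + v"] Nu[OF uv] N_uminus[of u v] by auto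
      moreover have "prim_part F (x + u) (y + v) = prim_part F x y"
        using s(3) uv s'(2) unfolding level2_def by (meson order_trans)
      ultimately show ?thesis by (simp add: A_def)
    qed
    moreover have "nv x \<le> 1 \<and> nv y \<le> 1" if "A k x y \<noteq> 0" for x y
      using that by (auto simp: A_def prim_part_def split: if_splits)
    ultimately have "level2 (A k) 1 s'" unfolding level2_def by blast
    thus ?thesis unfolding sch2_def using s'(1) by blast
  qed
  have AB: "B k = (\<lambda>x y. of_real (q powi k * q powi k) * A k (unif powi (- k) * x + 0 * y) (0 * x + unif powi (- k) * y))" for k
  proof (intro ext)
    fix x y
    let ?t = "unif powi (- k)"
    have t: "nv ?t = q powi k" by (rule nv_unif_powi)
    have qp: "q powi k > 0" by simp
    have e1: "q powi k * z = q powi k \<longleftrightarrow> z = 1" and e2: "q powi k * z = 1 \<longleftrightarrow> z = q powi (- k)" for z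
      using qp by (auto simp: power_int_minus field_simps)
    show "B k x y = of_real (q powi k * q powi k) * A k (?t * x + 0 * y) (0 * x + ?t * y)"
    proof (cases "N x y = 1 \<and> max (nv x) (nv y) = q powi (- k)")
      case True
      hence "x \<noteq> 0 \<or> y \<noteq> 0" using max_nv_pos[of x y] by auto
      hence "F (?t * x) (?t * y) = F x y / of_real (q powi k * q powi k)"
        using hom unfolding homog_def t[symmetric] by simp
      thus ?thesis using True qp unfolding B_def A_def prim_part_def by (simp add: N_scale m_scale t e1 e2)
    next
      case False
      thus ?thesis unfolding B_def A_def prim_part_def by (auto simp: N_scale m_scale t e1 e2)
    qed
  qed
  have B_int: "sch2 (B k) \<and> integ2 (B k) = integ2 (A k)" for k
  proof -
    let ?t = "unif powi (- k)"
    have t: "nv ?t = q powi k" by (rule nv_unif_powi)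
    have D': "?t * ?t - 0 * 0 \<noteq> 0" by simp
    note l = sch2_linear[OF A_sch D', of k] integ2_linear[OF A_sch D', of k]
    have "integ2 (B k) = of_real (q powi k * q powi k) * (integ2 (A k) / of_real (nv (?t * ?t - 0 * 0)))"
      unfolding AB integ2_cmult[OF l(1)] l(2) ..
    also have "\<dots> = integ2 (A k)" using t by (simp add: nv_mult)
    finally show ?thesis unfolding AB using sch2_cmult[OF l(1)] by simp
  qed
  \<comment> \<open>The two comparisons confine the new norm on the standard unit shell to
    \<open>[\<delta>/C, C]\<close> and the standard norm on the new unit shell to
    \<open>[1/C, C/\<delta>]\<close>, so finitely many \<open>k\<close> occur.\<close>
  obtain n where n: "max (max C (C / \<delta>)) 1 < q ^ n" using real_arch_pow[OF q_gt_1] by blast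
  define I where "I = {- int n..int n}"
  have val: "\<exists>k. z = q powi k" if "z > 0" "z = max (nv u) (nv v)" for z u v
    using that nv_value[of u] nv_value[of v] by (auto simp: max_def split: if_splits)
  have range: "k \<in> I" if "z = q powi k" "z < q ^ n" "inverse (q ^ n) < z" for z k
  proof -
    have "q powi k < q powi (int n)" "q powi (- int n) < q powi k" using that by (auto simp: power_int_minus)
    thus ?thesis unfolding q_powi_less_iff I_def by auto
  qed
  have pick: "(\<Sum>k\<in>I. if k = k0 then w else 0) = w" if "k0 \<in> I" for k0 and w :: complex
    using that by (simp add: I_def)
  have uniq: "q powi k0 = q powi k \<longleftrightarrow> k = k0" for k k0
    using q_powi_le_iff by (metis order_antisym order_refl)
  have sumA: "prim_part F = (\<lambda>x y. \<Sum>k\<in>I. A k x y)"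
  proof (intro ext)
    fix x y
    show "prim_part F x y = (\<Sum>k\<in>I. A k x y)"
    proof (cases "max (nv x) (nv y) = 1")
      case True
      have l: "\<delta> \<le> C * N x y" using N_ge[of x y] True by simp
      have "C * N x y > 0" using l \<delta> by linarith
      hence Npos: "N x y > 0" and Cpos: "C > 0" using C0 by (auto simp: zero_less_mult_iff)
      obtain k0 where k0: "N x y = q powi k0" using val[OF Npos] unfolding N_def by blast
      have "N x y \<le> C * 1" using True by (intro N_le) auto
      hence up: "N x y < q ^ n" using n by simp
      have "inverse (q ^ n) < inverse (C / \<delta>)" using n Cpos \<delta> by (intro less_imp_inverse_less) auto
      also have "\<dots> \<le> N x y" using l Cpos by (simp add: field_simps)
      finally have "k0 \<in> I" using range[OF k0 up] by blast
      thus ?thesis unfolding A_def k0 uniq by (simp add: pick)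
    next
      case False
      hence "prim_part F x y = 0" "A k x y = 0" for k by (simp_all add: A_def prim_part_def)
      thus ?thesis by simp
    qed
  qed
  have sumB: "(if N x y = 1 \<and> (x \<noteq> 0 \<or> y \<noteq> 0) then F x y else 0) = (\<Sum>k\<in>I. B k x y)" for x y
  proof (cases "N x y = 1 \<and> (x \<noteq> 0 \<or> y \<noteq> 0)")
    case True
    let ?m = "max (nv x) (nv y)"
    have pos: "?m > 0" using True max_nv_pos by blast
    obtain k1 where k1: "?m = q powi k1" using val[OF pos refl] by blast
    have l: "\<delta> * ?m \<le> C" using N_ge[of x y] True by simp
    have l2: "1 \<le> C * ?m" using N_le[of x ?m y] True by simp
    hence Cpos: "C > 0" using C0 by (metis less_eq_real_def mult_zero_left not_one_le_zero)
    have "?m \<le> C / \<delta>" using l unfolding pos_le_divide_eq[OF \<delta>] by (simp only: mult.commute)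
    hence up: "?m < q ^ n" using n by simp
    have "inverse (q ^ n) < inverse C" using n Cpos by (intro less_imp_inverse_less) auto
    also have "\<dots> \<le> ?m" using l2 Cpos by (simp add: field_simps)
    finally have "k1 \<in> I" using range[OF k1 up] by blast
    hence k1I: "- k1 \<in> I" by (auto simp: I_def)
    have "B k x y = (if k = - k1 then F x y else 0)" for k
      unfolding B_def k1 uniq using True by auto
    thus ?thesis using True pick[OF k1I] by simp
  next
    case False
    have "B k x y = 0" for k
    proof (cases "N x y = 1")
      case True
      hence "x = 0" "y = 0" using False by auto
      thus ?thesis using True by (simp add: N_def)
    qed (simp add: B_def)
    thus ?thesis by (simp only: False if_False sum.neutral_const)
  qed
  have "integ2 (\<lambda>x y. if N x y = 1 \<and> (x \<noteq> 0 \<or> y \<noteq> 0) then F x y else 0) = (\<Sum>k\<in>I. integ2 (B k))"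
    unfolding sumB by (rule integ2_sum) (use B_int in blast)
  also have "\<dots> = (\<Sum>k\<in>I. integ2 (A k))" using B_int by simp
  also have "\<dots> = integ2 (prim_part F)" unfolding sumA by (rule integ2_sum[symmetric]) (rule A_sch)
  finally show ?thesis unfolding N_def .
qed

text \<open>After substituting \<open>h\<close>, primitivity becomes the unit shell of the norm
  pulled back along the inverse of \<open>h\<close>. The Jacobian cancels \<open>|det h|\<close>,
  and \<open>norm_change\<close> returns to the standard norm.\<close>

lemma mass_right:
  assumes f: "f \<in> I_half nv" and h: "h \<in> GL2"
  shows "mass (right_transl h f) = mass f"
proof -
  obtain a b c d where hm: "h = mat2 a b c d" by (rule mat2_cases)
  let ?\<Delta> = "a * d - b * c"
  have D: "?\<Delta> \<noteq> 0" using h by (simp add: hm GL2_iff)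
  let ?G = "\<lambda>X Y. if max (nv (d / ?\<Delta> * X + - c / ?\<Delta> * Y)) (nv (- b / ?\<Delta> * X + a / ?\<Delta> * Y)) = 1 \<and> (X \<noteq> 0 \<or> Y \<noteq> 0)
    then dens f X Y else 0"
  have D': "d / ?\<Delta> * (a / ?\<Delta>) - - c / ?\<Delta> * (- b / ?\<Delta>) \<noteq> 0"
  proof -
    have "d / ?\<Delta> * (a / ?\<Delta>) - - c / ?\<Delta> * (- b / ?\<Delta>) = ?\<Delta> / (?\<Delta> * ?\<Delta>)"
      by (simp add: diff_divide_distrib[symmetric] mult.commute)
    thus ?thesis using D by simp
  qed
  have inv: "d / ?\<Delta> * (a * x + c * y) + - c / ?\<Delta> * (b * x + d * y) = x"
    "- b / ?\<Delta> * (a * x + c * y) + a / ?\<Delta> * (b * x + d * y) = y" for x y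
    using D by (simp_all add: divide_simps) (simp_all add: algebra_simps)
  have Gh: "prim_part (dens (right_transl h f)) = (\<lambda>x y. of_real (nv ?\<Delta>) * ?G (a * x + c * y) (b * x + d * y))"
  proof (intro ext)
    fix x y
    have nz: "(a * x + c * y \<noteq> 0 \<or> b * x + d * y \<noteq> 0) \<longleftrightarrow> x \<noteq> 0 \<or> y \<noteq> 0"
      using inv[of x y] by (metis add_0 mult_zero_right)
    show "prim_part (dens (right_transl h f)) x y = of_real (nv ?\<Delta>) * ?G (a * x + c * y) (b * x + d * y)"
      unfolding inv nz prim_part_def using dens_right[OF f h, of x y] max_nv_pos[of x y]
      by (auto simp: hm mult.commute)
  qed
  \<comment> \<open>Integrability of \<open>?G\<close> is obtained backwards: its pullback by
    \<open>h\<close> is a multiple of a primitive part known to be integrable, and the inverse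
    substitution gives \<open>?G\<close> back.\<close>
  have s1: "sch2 (\<lambda>x y. of_real (nv ?\<Delta>) * ?G (a * x + c * y) (b * x + d * y))"
    using sch2_prim_part_dens[OF I_half_right[OF f h]] unfolding Gh .
  have s2: "sch2 (\<lambda>x y. ?G (a * x + c * y) (b * x + d * y))"
    using sch2_cmult[OF s1, of "1 / of_real (nv ?\<Delta>)"] D by simp
  have inv': "a * (d / ?\<Delta> * x + - c / ?\<Delta> * y) + c * (- b / ?\<Delta> * x + a / ?\<Delta> * y) = x"
    "b * (d / ?\<Delta> * x + - c / ?\<Delta> * y) + d * (- b / ?\<Delta> * x + a / ?\<Delta> * y) = y" for x y
    using D by (simp_all add: divide_simps) (simp_all add: algebra_simps)
  have s3: "sch2 ?G" using sch2_linear[OF s2 D'] unfolding inv' .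
  have D2: "a * d - c * b \<noteq> 0" using D by (simp add: mult.commute)
  have "mass (right_transl h f) = of_real (nv ?\<Delta>) * integ2 (\<lambda>x y. ?G (a * x + c * y) (b * x + d * y))"
    unfolding mass_def Gh by (rule integ2_cmult[OF s2])
  also have "\<dots> = of_real (nv ?\<Delta>) * (integ2 ?G / of_real (nv (a * d - c * b)))"
    unfolding integ2_linear[OF s3 D2] ..
  also have "\<dots> = integ2 ?G" using D by (simp add: mult.commute)
  also have "\<dots> = mass f" unfolding mass_def by (rule norm_change[OF homog_dens[OF f] rsmooth_dens[OF f] D'])
  finally show ?thesis .
qed

section \<open>Subrepresentations\<close>

definition St :: "('a mat2 \<Rightarrow> complex) set" where
  "St = {f \<in> I_half nv. mass f = 0}"

lemma St_sub: "St \<subseteq> I_half nv" by (auto simp: St_def)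

lemma St_subspace: "cvec.subspace St"
proof (rule cvec.subspaceI)
  show "0 \<in> St" using cvec.subspace_0[OF I_half_subspace]
      mass_cscale[OF cvec.subspace_0[OF I_half_subspace], of 0] by (simp add: St_def)
qed (auto simp: St_def mass_add mass_cscale cvec.subspace_add[OF I_half_subspace]
    cvec.subspace_scale[OF I_half_subspace])

lemma subrep_I_half: "subrep (I_half nv) (I_half nv)"
  by (auto simp: subrep_def csubspace_eq I_half_subspace I_half_right)

lemma subrep_St: "subrep St (I_half nv)"
  unfolding subrep_def csubspace_eq using St_subspace by (auto simp: St_def I_half_right mass_right)

text \<open>The density that is 1 on primitive rows, invariant under \<open>maxK\<close>: the
  spherical vector.\<close>

definition V0 :: "'a \<Rightarrow> 'a \<Rightarrow> complex" where
  "V0 c d = inverse (of_real (max (nv c) (nv d) * max (nv c) (nv d)))"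

text \<open>For primitive \<open>(p1, p2)\<close> the wedge \<open>c p2 - d p1\<close>, divided by
  the norm of \<open>(c, d)\<close>, is the distance of two points of the projective line. So this
  is the invariant density restricted to a disc around \<open>[p1 : p2]\<close>.\<close>

definition disc :: "real \<Rightarrow> 'a \<Rightarrow> 'a \<Rightarrow> 'a \<Rightarrow> 'a \<Rightarrow> complex" where
  "disc \<epsilon> p1 p2 c d = (if nv (c * p2 - d * p1) \<le> \<epsilon> * max (nv c) (nv d) then V0 c d else 0)"

lemma max_nv_scale: "max (nv (t * x)) (nv (t * y)) = nv t * max (nv x) (nv y)"
  by (simp add: nv_mult max_mult_distrib_left)

lemma max_nv_maxK:
  assumes "k \<in> maxK"
  shows "max (nv (c * k $ 1 $ 1 + d * k $ 2 $ 1)) (nv (c * k $ 1 $ 2 + d * k $ 2 $ 2)) = max (nv c) (nv d)"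
proof -
  obtain x y z w where k: "k = mat2 x y z w" by (rule mat2_cases)
  have "max 0 (max (nv a) (nv b)) = max (nv a) (nv b)" for a b by (simp add: max_absorb2 le_max_iff_disj)
  thus ?thesis using mn_maxK_right[OF assms, of "mat2 0 0 c d"]
    by (simp add: k mat2_mult mnv_mat2)
qed

lemma homog_V0: "homog V0"
  unfolding homog_def V0_def max_nv_scale by (simp add: divide_inverse mult.commute mult.left_commute)

lemma rsmooth_V0: "rsmooth V0"
  unfolding rsmooth_def V0_def using max_nv_maxK[OF maxK_near_1] by (intro exI[of _ 1]) simp

lemma homog_disc: "homog (disc \<epsilon> p1 p2)"
  unfolding homog_def
proof (intro allI impI)
  fix b c d :: 'a assume h: "b \<noteq> 0" "c \<noteq> 0 \<or> d \<noteq> 0"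
  have "b * c * p2 - b * d * p1 = b * (c * p2 - d * p1)" by (simp add: algebra_simps)
  hence "nv (b * c * p2 - b * d * p1) \<le> \<epsilon> * (nv b * max (nv c) (nv d)) \<longleftrightarrow>
      nv (c * p2 - d * p1) \<le> \<epsilon> * max (nv c) (nv d)"
    using h by (simp add: nv_mult mult.left_commute[of \<epsilon>])
  thus "disc \<epsilon> p1 p2 (b * c) (b * d) = disc \<epsilon> p1 p2 c d / of_real (nv b * nv b)"
    using homog_V0 h unfolding disc_def max_nv_scale homog_def by simp
qed

lemma rsmooth_disc:
  assumes \<epsilon>: "\<epsilon> > 0" and p: "nv p1 \<le> 1" "nv p2 \<le> 1"
  shows "rsmooth (disc \<epsilon> p1 p2)"
proof -
  have "disc \<epsilon> p1 p2 (c * k $ 1 $ 1 + d * k $ 2 $ 1) (c * k $ 1 $ 2 + d * k $ 2 $ 2) = disc \<epsilon> p1 p2 c d"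
    if k: "mn (k - mat 1) < min 1 \<epsilon>" for k c d
  proof -
    obtain x y z w where e: "k = mat2 x y z w" by (rule mat2_cases)
    have K: "k \<in> maxK" using maxK_near_1 k by simp
    let ?m = "max (nv c) (nv d)"
    have l: "nv (x - 1) \<le> \<epsilon>" "nv y \<le> \<epsilon>" "nv z \<le> \<epsilon>" "nv (w - 1) \<le> \<epsilon>"
      using k by (auto simp: e mat_1_mat2 mat2_diff mnv_mat2)
    have m: "nv (t * u) \<le> \<epsilon> * ?m" if "nv u \<le> \<epsilon>" "nv t \<le> ?m" for t u
      using nv_mult_le[OF that] by (simp only: mult.commute)
    let ?A = "(c * x + d * z) * p2 - (c * y + d * w) * p1" and ?B = "c * p2 - d * p1"
    have "?A - ?B = (c * (x - 1) + d * z) * p2 - (c * y + d * (w - 1)) * p1" by (simp add: algebra_simps)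
    hence d: "nv (?A - ?B) \<le> \<epsilon> * ?m"
      by (simp only:) (intro nv_diff_le nv_mult_le_1 nv_add_le m l p; simp)
    have "nv ?A \<le> \<epsilon> * ?m \<longleftrightarrow> nv ?B \<le> \<epsilon> * ?m"
      using nv_diff_le[OF _ d, of ?A] nv_add_le[OF d, of ?B] by auto
    thus ?thesis using max_nv_maxK[OF K, of c d] unfolding disc_def V0_def by (simp add: e)
  qed
  thus ?thesis unfolding rsmooth_def using \<epsilon> by (intro exI[of _ "min 1 \<epsilon>"]) auto
qed

lemma lift_add: "lift (\<lambda>c d. F c d + G c d) = lift F + lift G"
  by (auto simp: fun_eq_iff lift_def distrib_left)

lemma lift_cmult: "lift (\<lambda>c d. x * F c d) = cscale x (lift F)"
  by (auto simp: fun_eq_iff lift_def)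

lemma lift_diff_scaled: "lift (\<lambda>c d. x * F c d + (-1) * G c d) = cscale x (lift F) - lift G"
  by (auto simp: fun_eq_iff lift_def algebra_simps)

lemma lift_cong: "(\<And>c d. c \<noteq> 0 \<or> d \<noteq> 0 \<Longrightarrow> F c d = G c d) \<Longrightarrow> lift F = lift G"
  using row_nonzero unfolding fun_eq_iff lift_def by (metis mult_zero_left nv_0 of_real_0)

lemma right_transl_lift:
  "right_transl h (lift F) = lift (\<lambda>c d. of_real (nv (det h)) *
     F (c * h $ 1 $ 1 + d * h $ 2 $ 1) (c * h $ 1 $ 2 + d * h $ 2 $ 2))"
  by (auto simp: fun_eq_iff lift_def right_transl_def det_mul nv_mult mult_row2)

abbreviation v0 :: "'a mat2 \<Rightarrow> complex" where "v0 \<equiv> lift V0"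

lemma v0_I_half: "v0 \<in> I_half nv" by (intro lift_in_I_half homog_V0 rsmooth_V0)

lemma mass_v0: "mass v0 = of_real (1 - 1 / (q * q))"
proof -
  have "prim_part V0 = (\<lambda>x y. if max (nv x) (nv y) = 1 then 1 else 0)"
    by (auto simp: fun_eq_iff prim_part_def V0_def)
  thus ?thesis unfolding mass_def prim_part_dens_lift using integ2_unit_sphere(2) by simp
qed

lemma mass_v0_nz: "mass v0 \<noteq> 0" unfolding mass_v0 by (rule q_square_nz)

abbreviation disc0 :: "nat \<Rightarrow> 'a \<Rightarrow> 'a \<Rightarrow> complex" where
  "disc0 m \<equiv> disc (inverse (q ^ Suc m)) 1 0"

lemma disc0_I_half: "lift (disc0 m) \<in> I_half nv"
  by (intro lift_in_I_half homog_disc rsmooth_disc) auto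

text \<open>A radius below 1 forces the first coordinate to dominate, so the maximum may be replaced
  by \<open>nv c\<close>.\<close>

lemma disc0_eq: "disc0 m c d = (if nv d \<le> inverse (q ^ Suc m) * nv c then V0 c d else 0)"
proof -
  define \<epsilon> where "\<epsilon> = inverse (q ^ Suc m)"
  have \<epsilon>: "0 < \<epsilon>" "\<epsilon> < 1" unfolding \<epsilon>_def
    using less_imp_inverse_less[OF one_less_power[OF q_gt_1, of "Suc m"]] by simp_all
  have "nv d \<le> \<epsilon> * max (nv c) (nv d) \<longleftrightarrow> nv d \<le> \<epsilon> * nv c"
  proof (cases "nv c \<le> nv d")
    case True
    have le: "\<epsilon> * nv c \<le> \<epsilon> * nv d" using True \<epsilon> by simp
    show ?thesis
    proof (cases "d = 0")
      case False
      hence "\<epsilon> * nv d < nv d" using \<epsilon> by simp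
      hence "\<not> nv d \<le> \<epsilon> * nv d" "\<not> nv d \<le> \<epsilon> * nv c" using le by linarith+
      thus ?thesis using True by (simp add: max_absorb2)
    qed (use True \<epsilon> in simp)
  qed (simp add: max_def)
  thus ?thesis unfolding disc_def \<epsilon>_def[symmetric] by simp
qed

lemma mass_disc0: "mass (lift (disc0 0)) = of_real ((1 - 1 / q) * (1 / q))"
proof -
  let ?f = "\<lambda>x. if nv x = nv 1 then 1 else (0::complex)" and ?g = "\<lambda>x. if nv x \<le> nv unif then 1 else (0::complex)"
  have s: "sch1 ?f" "sch1 ?g" by (rule sch1_sphere sch1_ball; simp)+
  have "prim_part (disc0 0) = (\<lambda>x y. ?f x * ?g y)"
  proof (intro ext)
    fix x y
    have "max (nv x) (nv y) = 1 \<and> nv y \<le> inverse (q ^ Suc 0) * nv x \<longleftrightarrow> nv x = 1 \<and> nv y \<le> nv unif"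
    proof
      assume h: "max (nv x) (nv y) = 1 \<and> nv y \<le> inverse (q ^ Suc 0) * nv x"
      have "nv x = 1"
      proof (rule ccontr)
        assume c: "nv x \<noteq> 1"
        hence "nv y = 1" "nv x < 1" using h by (auto simp: max_def split: if_splits)
        hence "inverse q * nv x < 1" using q_gt_1 by (simp add: field_simps)
        thus False using h \<open>nv y = 1\<close> by simp
      qed
      thus "nv x = 1 \<and> nv y \<le> nv unif" using h by (simp add: nv_unif inverse_eq_divide)
    next
      assume h: "nv x = 1 \<and> nv y \<le> nv unif"
      hence "nv y < 1" using nv_less_1_iff by (simp add: nv_unif)
      thus "max (nv x) (nv y) = 1 \<and> nv y \<le> inverse (q ^ Suc 0) * nv x"
        using h by (simp add: nv_unif inverse_eq_divide)
    qed
    thus "prim_part (disc0 0) x y = ?f x * ?g y"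
      unfolding prim_part_def disc0_eq V0_def by auto
  qed
  hence "mass (lift (disc0 0)) = integ ?f * integ ?g"
    unfolding mass_def prim_part_dens_lift using integ2_prod[OF s] by simp
  thus ?thesis unfolding integ_sphere[OF one_neq_zero] integ_ball[OF unif_nz] by (simp add: nv_unif)
qed

text \<open>Up to a scalar, \<open>disc_gap m\<close> is the difference between the normalized indicator of the disc of
  radius \<open>q^(-m-1)\<close> around \<open>[1 : 0]\<close> and the normalized \<open>GL\<^sub>2(O)\<close>-invariant density; translation by
  \<open>diag(1, 1/\<pi>)\<close> shrinks the disc.\<close>

definition disc_gap :: "nat \<Rightarrow> 'a mat2 \<Rightarrow> complex" where
  "disc_gap m = cscale (of_real ((q + 1) * q ^ m)) (lift (disc0 m)) - v0"

lemma disc_gap_lift: "disc_gap m = lift (\<lambda>c d. of_real ((q + 1) * q ^ m) * disc0 m c d + (-1) * V0 c d)"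
  unfolding disc_gap_def lift_diff_scaled ..

text \<open>The factor \<open>(q + 1) * q ^ m\<close> is the number of discs of radius
  \<open>q^(-m-1)\<close>. The dilation carries \<open>lift (disc0 m)\<close> to \<open>q\<close>
  times \<open>lift (disc0 (Suc m))\<close>, but it moves \<open>v0\<close> to \<open>v0\<close>
  plus \<open>1 - 1/q\<close> times \<open>disc_gap 0\<close>, whence the correction term.\<close>

lemma disc_gap_step:
  "disc_gap (Suc m) = right_transl (mat2 1 0 0 (1 / unif)) (disc_gap m) + cscale (of_real (1 - 1 / q)) (disc_gap 0)"
  unfolding disc_gap_lift right_transl_lift lift_cmult[symmetric] lift_add[symmetric]
proof (rule lift_cong)
  fix c d :: 'a assume cd: "c \<noteq> 0 \<or> d \<noteq> 0"
  define x y where "x = nv c" and "y = nv d"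
  define P where "P = q ^ m"
  have P: "P \<ge> 1" using q_gt_1 by (simp add: P_def one_le_power)
  have xy: "x \<ge> 0" "y \<ge> 0" by (simp_all add: x_def y_def)
  have yu: "nv (d / unif) = q * y" by (simp add: nv_divide nv_unif y_def)
  have V: "V0 c d = of_real (inverse (max x y * max x y))" "V0 c (d / unif) = of_real (inverse (max x (q * y) * max x (q * y)))"
    by (simp_all add: V0_def yu x_def[symmetric] y_def[symmetric])
  have conds: "disc0 m c (d / unif) = (if q * y \<le> inverse (q * P) * x then V0 c (d / unif) else 0)"
    "disc0 (Suc m) c d = (if y \<le> inverse (q * (q * P)) * x then V0 c d else 0)"
    "disc0 0 c d = (if y \<le> inverse q * x then V0 c d else 0)"
    unfolding disc0_eq by (simp_all add: yu x_def[symmetric] y_def[symmetric] P_def)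
  have cnd: "q * y \<le> inverse (q * P) * x \<longleftrightarrow> y \<le> inverse (q * (q * P)) * x"
    using P by (simp add: field_simps)
  have main: "(q + 1) * (q * P) * (if y \<le> inverse (q * (q * P)) * x then inverse (max x y * max x y) else 0) - inverse (max x y * max x y) =
    q * ((q + 1) * P * (if y \<le> inverse (q * (q * P)) * x then inverse (max x (q * y) * max x (q * y)) else 0) - inverse (max x (q * y) * max x (q * y)))
    + (1 - 1 / q) * ((q + 1) * (if y \<le> inverse q * x then inverse (max x y * max x y) else 0) - inverse (max x y * max x y))"
  proof (cases "y \<le> inverse q * x")
    case True
    have xpos: "x > 0"
    proof (rule ccontr)
      assume "\<not> x > 0"
      hence "x = 0" "y = 0" using True xy by auto
      thus False using cd by (simp add: x_def y_def)
    qed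
    have qyx: "q * y \<le> x" using True by (simp add: field_simps)
    have "y \<le> q * y" using mult_right_mono[of 1 q y] xy q_gt_1 by simp
    hence mx: "max x y = x" "max x (q * y) = x" using qyx by auto
    show ?thesis unfolding mx using True xpos by (auto simp: field_simps)
  next
    case False
    \<comment> \<open>No norm lies strictly between \<open>nv c / q\<close> and \<open>nv c\<close>,
      so outside the disc of index 0 the second coordinate dominates.\<close>
    have "y \<ge> x"
    proof (cases "c = 0")
      case True thus ?thesis using xy by (simp add: x_def)
    next
      case c: False
      show ?thesis using nv_less_iff[OF c, of d] False unfolding x_def[symmetric] y_def[symmetric]
        by (simp add: field_simps)
    qed
    moreover have "q * y \<ge> y" using mult_right_mono[of 1 q y] xy q_gt_1 by simp
    ultimately have mx: "max x y = y" "max x (q * y) = q * y" by auto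
    have ypos: "y > 0"
    proof (rule ccontr)
      assume "\<not> y > 0"
      hence "x = 0" "y = 0" using \<open>y \<ge> x\<close> xy by auto
      thus False using cd by (simp add: x_def y_def)
    qed
    have "1 \<le> q * P" using mult_mono[of 1 q 1 P] P q_gt_1 by simp
    hence "inverse (q * (q * P)) * x \<le> inverse q * x"
      using xy by (intro mult_right_mono le_imp_inverse_le) auto
    hence "\<not> y \<le> inverse (q * (q * P)) * x" using False by linarith
    thus ?thesis unfolding mx using False ypos by (simp add: field_simps)
  qed
  have main': "of_real ((q + 1) * (q * P)) * disc0 (Suc m) c d + (-1) * V0 c d =
    of_real q * (of_real ((q + 1) * P) * disc0 m c (d / unif) + (-1) * V0 c (d / unif))
    + of_real (1 - 1 / q) * (of_real (q + 1) * disc0 0 c d + (-1) * V0 c d)"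
  proof -
    have ofr: "(if B then complex_of_real z else 0) = of_real (if B then z else 0)" for B z by simp
    show ?thesis unfolding conds cnd V ofr
      using arg_cong[OF main, of complex_of_real]
      by (simp only: of_real_add of_real_diff of_real_mult mult_minus1 add_uminus_conv_diff)
  qed
  show "of_real ((q + 1) * q ^ Suc m) * disc0 (Suc m) c d + - 1 * V0 c d =
    of_real (nv (det (mat2 1 0 0 (1 / unif)))) *
     (of_real ((q + 1) * q ^ m) *
       disc0 m (c * mat2 1 0 0 (1 / unif) $ 1 $ 1 + d * mat2 1 0 0 (1 / unif) $ 2 $ 1)
         (c * mat2 1 0 0 (1 / unif) $ 1 $ 2 + d * mat2 1 0 0 (1 / unif) $ 2 $ 2) +
      - 1 * V0 (c * mat2 1 0 0 (1 / unif) $ 1 $ 1 + d * mat2 1 0 0 (1 / unif) $ 2 $ 1)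
         (c * mat2 1 0 0 (1 / unif) $ 1 $ 2 + d * mat2 1 0 0 (1 / unif) $ 2 $ 2)) +
    of_real (1 - 1 / q) * (of_real ((q + 1) * q ^ 0) * disc0 0 c d + - 1 * V0 c d)"
    using main' by (simp add: nv_divide nv_unif P_def)
qed

section \<open>Generating the densities of mass 0 from one disc gap\<close>

lemma subrep_disc_gap:
  assumes U: "subrep U (I_half nv)" and 0: "disc_gap 0 \<in> U"
  shows "disc_gap m \<in> U"
proof (induction m)
  case (Suc m)
  have "mat2 1 0 0 (1 / unif) \<in> (GL2 :: 'a mat2 set)" by (simp add: GL2_iff)
  thus ?case unfolding disc_gap_step using Suc U 0 unfolding subrep_def csubspace_def by blast
qed (rule 0)

lemma subrep_disc:
  assumes U: "subrep U (I_half nv)" and 0: "disc_gap 0 \<in> U" and p: "max (nv p1) (nv p2) = 1"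
  shows "cscale (of_real ((q + 1) * q ^ m)) (lift (disc (inverse (q ^ Suc m)) p1 p2)) - v0 \<in> U"
proof -
  \<comment> \<open>The second column makes the second coordinate of \<open>(c, d) k\<close> equal
    to the wedge \<open>c p2 - d p1\<close>, so \<open>k\<close> carries the disc around
    \<open>[1 : 0]\<close> to the one around \<open>[p1 : p2]\<close>, while \<open>v0\<close> is
    fixed.\<close>
  obtain k where k: "k \<in> maxK" "k $ 1 $ 2 = p2" "k $ 2 $ 2 = - p1"
  proof (cases "nv p1 = 1")
    case True
    thus ?thesis using that[of "mat2 1 p2 0 (- p1)"] p by (simp add: maxK_def mnv_mat2)
  next
    case False
    hence "nv p2 = 1" using p by (auto simp: max_def split: if_splits)
    thus ?thesis using that[of "mat2 0 p2 1 (- p1)"] p by (simp add: maxK_def mnv_mat2)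
  qed
  have dk: "nv (det k) = 1" using k by (simp add: maxK_def)
  have V: "V0 (c * k $ 1 $ 1 + d * k $ 2 $ 1) (c * k $ 1 $ 2 + d * k $ 2 $ 2) = V0 c d" for c d
    unfolding V0_def max_nv_maxK[OF k(1)] ..
  have "nv ((c * k $ 1 $ 1 + d * k $ 2 $ 1) * 0 - (c * k $ 1 $ 2 + d * k $ 2 $ 2) * 1) = nv (c * p2 - d * p1)" for c d
    using nv_minus[of "c * p2 - d * p1"] by (simp add: k)
  hence D: "disc \<epsilon> 1 0 (c * k $ 1 $ 1 + d * k $ 2 $ 1) (c * k $ 1 $ 2 + d * k $ 2 $ 2) = disc \<epsilon> p1 p2 c d" for \<epsilon> c d
    unfolding disc_def max_nv_maxK[OF k(1)] V by simp
  have "right_transl k (disc_gap m) \<in> U"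
    using subrep_disc_gap[OF U 0, of m] U maxK_GL2[OF k(1)] unfolding subrep_def by blast
  also have "right_transl k (disc_gap m) =
    lift (\<lambda>c d. of_real ((q + 1) * q ^ m) * disc (inverse (q ^ Suc m)) p1 p2 c d + (-1) * V0 c d)"
    unfolding disc_gap_lift right_transl_lift D V dk by simp
  finally show ?thesis unfolding lift_diff_scaled .
qed

text \<open>The ultrametric inequality for the projective distance. Multiplying the wedge of
  \<open>w\<close> and \<open>p\<close> by a coordinate of \<open>u\<close> expresses it through the
  two given wedges, and one coordinate of \<open>u\<close> is a unit.\<close>

lemma wedge_close:
  assumes p: "nv p1 \<le> 1" "nv p2 \<le> 1" and u: "max (nv u1) (nv u2) = 1"
    and wu: "nv (w1 * u2 - w2 * u1) \<le> \<epsilon> * max (nv w1) (nv w2)" and up: "nv (u1 * p2 - u2 * p1) \<le> \<epsilon>"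
  shows "nv (w1 * p2 - w2 * p1) \<le> \<epsilon> * max (nv w1) (nv w2)"
proof -
  let ?m = "max (nv w1) (nv w2)"
  have 1: "(w1 * p2 - w2 * p1) * u1 = (w1 * u2 - w2 * u1) * p1 + (u1 * p2 - u2 * p1) * w1"
    "(w1 * p2 - w2 * p1) * u2 = (w1 * u2 - w2 * u1) * p2 + (u1 * p2 - u2 * p1) * w2"
    by (simp_all add: algebra_simps)
  have "nv ((w1 * p2 - w2 * p1) * u1) \<le> \<epsilon> * ?m" unfolding 1(1)
    by (intro nv_add_le nv_mult_le_1[OF wu] nv_mult_le[OF up] p) simp
  moreover have "nv ((w1 * p2 - w2 * p1) * u2) \<le> \<epsilon> * ?m" unfolding 1(2)
    by (intro nv_add_le nv_mult_le_1[OF wu] nv_mult_le[OF up] p) simp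
  ultimately show ?thesis using u by (auto simp: nv_mult max_def split: if_splits)
qed

text \<open>Projectively close primitive vectors agree up to a unit scalar and an additive error of
  norm at most \<open>s\<close>; neither changes \<open>F\<close>.\<close>

lemma density_close_aux:
  assumes hom: "homog F" and F: "\<And>c d x y. max (nv c) (nv d) = 1 \<Longrightarrow> nv x \<le> s \<Longrightarrow> nv y \<le> s \<Longrightarrow> F (c + x) (d + y) = F c d"
    and u: "max (nv u1) (nv u2) = 1" and p: "nv p1 = 1" "nv p2 \<le> 1"
    and s: "0 \<le> s" "s < 1" and up: "nv (u1 * p2 - u2 * p1) \<le> s"
  shows "F u1 u2 = F p1 p2"
proof -
  have p0: "p1 \<noteq> 0" using p by auto
  have le: "nv u1 \<le> 1" "nv u2 \<le> 1" using u by (auto simp: max_def split: if_splits)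
  have u1: "nv u1 = 1"
  proof (rule ccontr)
    assume c: "nv u1 \<noteq> 1"
    hence u2: "nv u2 = 1" "nv u1 < 1" using u le by (auto simp: max_def split: if_splits)
    hence "nv (u1 * p2) < nv (u2 * p1)"
      using p mult_right_le_one_le[of "nv u1" "nv p2"] by (simp add: nv_mult)
    hence "nv (u2 * p1 - u1 * p2) = 1" using nv_diff_absorb[of "u1 * p2" "u2 * p1"] p u2 by (simp add: nv_mult)
    thus False using up s nv_diff_commute[of "u1 * p2" "u2 * p1"] by simp
  qed
  let ?t = "u1 / p1"
  have t: "nv ?t = 1" "?t \<noteq> 0" using u1 p p0 by (auto simp: nv_divide)
  have "u2 - ?t * p2 = - (u1 * p2 - u2 * p1) / p1" using p0 by (simp add: field_simps)
  hence "nv (u2 - ?t * p2) \<le> s" using up p by (simp add: nv_divide nv_diff_commute[of "u2 * p1"])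
  moreover have "max (nv (?t * p1)) (nv (?t * p2)) = 1" unfolding max_nv_scale t(1) using p by simp
  ultimately have "F (?t * p1 + 0) (?t * p2 + (u2 - ?t * p2)) = F (?t * p1) (?t * p2)" using s(1) by (intro F) auto
  moreover have "F (?t * p1) (?t * p2) = F p1 p2 / of_real (nv ?t * nv ?t)"
    using hom t(2) p0 unfolding homog_def by blast
  ultimately have "F (?t * p1 + 0) (?t * p2 + (u2 - ?t * p2)) = F p1 p2" unfolding t(1) by simp
  thus ?thesis using p0 by simp
qed

text \<open>Exchanging the coordinates reduces to the case in which \<open>p1\<close> is a
  unit.\<close>

lemma density_close:
  assumes hom: "homog F" and F: "\<And>c d x y. max (nv c) (nv d) = 1 \<Longrightarrow> nv x \<le> s \<Longrightarrow> nv y \<le> s \<Longrightarrow> F (c + x) (d + y) = F c d"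
    and u: "max (nv u1) (nv u2) = 1" and p: "max (nv p1) (nv p2) = 1"
    and s: "0 \<le> s" "s < 1" and up: "nv (u1 * p2 - u2 * p1) \<le> s"
  shows "F u1 u2 = F p1 p2"
proof (cases "nv p1 = 1")
  case True
  thus ?thesis using density_close_aux[of F s u1 u2 p1 p2] assms by simp
next
  case False
  hence p2: "nv p2 = 1" "nv p1 \<le> 1" using p by (auto simp: max_def split: if_splits)
  show ?thesis
  proof (rule density_close_aux[of "\<lambda>c d. F d c" s u2 u1 p2 p1])
    show "homog (\<lambda>c d. F d c)" using hom unfolding homog_def by blast
    show "nv (u2 * p1 - u1 * p2) \<le> s" using up nv_diff_commute[of "u1 * p2" "u2 * p1"] by simp
  qed (use F u p2 s in \<open>auto simp: max.commute\<close>)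
qed

text \<open>A density is a finite combination of discs at a fine enough scale. Modulo
  \<open>U\<close> every disc of that scale is the same multiple of \<open>v0\<close>, so
  \<open>f\<close> is congruent to a multiple of \<open>v0\<close>, and comparing masses shows that
  this multiple is zero.\<close>

lemma St_subset_if_disc_gap:
  assumes U: "subrep U (I_half nv)" "U \<subseteq> St" and 0: "disc_gap 0 \<in> U"
  shows "St \<subseteq> U"
proof
  fix f assume f: "f \<in> St"
  hence fI: "f \<in> I_half nv" and lf: "mass f = 0" by (auto simp: St_def)
  have Us: "cvec.subspace U" using U(1) by (simp add: subrep_def csubspace_eq)
  define F where "F = dens f"
  have hom: "homog F" using homog_dens[OF fI] by (simp add: F_def)
  have fF: "f = lift F" using lift_dens[OF fI] by (simp add: F_def)
  obtain s where s: "s > 0" "s < 1" "\<And>c d x y. max (nv c) (nv d) = 1 \<Longrightarrow> nv x \<le> s \<Longrightarrow> nv y \<le> s \<Longrightarrow> F (c + x) (d + y) = F c d"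
    using rsmooth_level[OF rsmooth_dens[OF fI]] unfolding F_def by blast
  \<comment> \<open>Discs of radius \<open>q^(-m-1)\<close>, which is at most \<open>s\<close>, are
    so small that the density is a multiple of \<open>V0\<close> on each.\<close>
  obtain m where "inverse s < q ^ m" using real_arch_pow[OF q_gt_1] by blast
  moreover have "q ^ m < q ^ Suc m" using q_gt_1 by simp
  ultimately have m: "inverse s < q ^ Suc m" by linarith
  define \<epsilon> where "\<epsilon> = inverse (q ^ Suc m)"
  have \<epsilon>: "\<epsilon> > 0" "\<epsilon> \<le> s" using less_imp_inverse_less[OF m] s(1) by (simp_all add: \<epsilon>_def)
  let ?X = "{p. max (nv (fst p)) (nv (snd p)) = 1}"
  let ?k = "\<lambda>p. lift (disc \<epsilon> (fst p) (snd p))"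
  have X: "nv p1 \<le> 1" "nv p2 \<le> 1" if "max (nv p1) (nv p2) = 1" for p1 p2
    using that by (auto simp: max_def split: if_splits)
  have same: "disc \<epsilon> u1 u2 = disc \<epsilon> p1 p2"
    if "max (nv u1) (nv u2) = 1" "max (nv p1) (nv p2) = 1" "nv (u1 * p2 - u2 * p1) \<le> \<epsilon>" for u1 u2 p1 p2
  proof (intro ext)
    fix c d
    have "nv (p1 * u2 - p2 * u1) \<le> \<epsilon>" using that(3) nv_diff_commute[of "u1 * p2" "u2 * p1"] by (simp add: mult.commute)
    hence "nv (c * u2 - d * u1) \<le> \<epsilon> * max (nv c) (nv d) \<longleftrightarrow> nv (c * p2 - d * p1) \<le> \<epsilon> * max (nv c) (nv d)"
      using wedge_close[OF X[OF that(2)] that(1), of c d \<epsilon>] wedge_close[OF X[OF that(1)] that(2), of c d \<epsilon>]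
        that(3) by auto
    thus "disc \<epsilon> u1 u2 c d = disc \<epsilon> p1 p2 c d" by (simp add: disc_def)
  qed
  have fin: "finite (?k ` ?X)"
  proof -
    have "finite ((\<lambda>M. ?k (M $ 1 $ 1, M $ 1 $ 2)) ` ((\<lambda>p. mat2 (fst p) (snd p) 0 0) ` ?X))"
    proof (rule finite_image_locally_const[OF \<epsilon>(1), of _ 1])
      fix M assume "M \<in> (\<lambda>p. mat2 (fst p) (snd p) 0 0) ` ?X"
      thus "mn M \<le> 1" by (auto simp: mnv_mat2)
    next
      fix M N assume "M \<in> (\<lambda>p. mat2 (fst p) (snd p) 0 0) ` ?X" "N \<in> (\<lambda>p. mat2 (fst p) (snd p) 0 0) ` ?X"
        and d: "mn (M - N) \<le> \<epsilon>"
      then obtain p1 p2 r1 r2 where e: "M = mat2 p1 p2 0 0" "N = mat2 r1 r2 0 0"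
        and pr: "max (nv p1) (nv p2) = 1" "max (nv r1) (nv r2) = 1" by auto
      have d': "nv (p1 - r1) \<le> \<epsilon>" "nv (p2 - r2) \<le> \<epsilon>" using d by (auto simp: e mat2_diff mnv_mat2)
      have "p1 * r2 - p2 * r1 = (p1 - r1) * r2 - (p2 - r2) * r1" by (simp add: algebra_simps)
      hence "nv (p1 * r2 - p2 * r1) \<le> \<epsilon>" by (simp only:) (intro nv_diff_le nv_mult_le_1 d' X[OF pr(2)])
      thus "?k (M $ 1 $ 1, M $ 1 $ 2) = ?k (N $ 1 $ 1, N $ 1 $ 2)" using same[OF pr] by (simp add: e)
    qed
    thus ?thesis by (simp add: image_image)
  qed
  have prim: "\<exists>b u1 u2. b \<noteq> 0 \<and> c = b * u1 \<and> d = b * u2 \<and> max (nv u1) (nv u2) = 1" if cd: "c \<noteq> 0 \<or> d \<noteq> 0" for c d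
  proof -
    obtain b where b: "max (nv c) (nv d) = nv b" by (metis max_def)
    hence b0: "b \<noteq> 0" using cd max_nv_pos[of c d] by auto
    have "max (nv (inverse b * c)) (nv (inverse b * d)) = 1" unfolding max_nv_scale b using b0 by (simp add: nv_inverse)
    thus ?thesis using b0 by (intro exI[of _ b] exI[of _ "inverse b * c"] exI[of _ "inverse b * d"]) simp
  qed
  have at: "lift (disc \<epsilon> p1 p2) g \<noteq> 0 \<Longrightarrow> \<exists>b u1 u2. det g \<noteq> 0 \<and> b \<noteq> 0 \<and> g $ 2 $ 1 = b * u1 \<and> g $ 2 $ 2 = b * u2 \<and>
      max (nv u1) (nv u2) = 1 \<and> nv (u1 * p2 - u2 * p1) \<le> \<epsilon>" for g p1 p2
  proof -
    assume nz: "lift (disc \<epsilon> p1 p2) g \<noteq> 0"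
    hence det: "det g \<noteq> 0" by (auto simp: lift_def)
    obtain b u1 u2 where u: "b \<noteq> 0" "g $ 2 $ 1 = b * u1" "g $ 2 $ 2 = b * u2" "max (nv u1) (nv u2) = 1"
      using prim[OF row_nonzero[OF det]] by blast
    have "nv (b * u1 * p2 - b * u2 * p1) \<le> \<epsilon> * max (nv (b * u1)) (nv (b * u2))"
      using nz unfolding lift_def disc_def u(2,3) by (auto split: if_splits)
    moreover have "b * u1 * p2 - b * u2 * p1 = b * (u1 * p2 - u2 * p1)" by (simp add: algebra_simps)
    ultimately have "nv (u1 * p2 - u2 * p1) \<le> \<epsilon>" using u by (simp add: nv_mult max_nv_scale[unfolded nv_mult])
    thus ?thesis using det u by blast
  qed
  have dec: "f = (\<Sum>k\<in>?k ` ?X. cscale (F (fst (inv_into ?X ?k k)) (snd (inv_into ?X ?k k))) k)"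
  proof (rule finite_decomposition[OF fin, where c = "\<lambda>p. F (fst p) (snd p)"])
    fix g :: "'a mat2" assume "f g \<noteq> 0"
    hence det: "det g \<noteq> 0" by (auto simp: fF lift_def)
    obtain b u1 u2 where u: "b \<noteq> 0" "g $ 2 $ 1 = b * u1" "g $ 2 $ 2 = b * u2" "max (nv u1) (nv u2) = 1"
      using prim[OF row_nonzero[OF det]] by blast
    have "max (nv (b * u1)) (nv (b * u2)) \<noteq> 0" unfolding max_nv_scale u(4) using u(1) by simp
    moreover have "0 \<le> \<epsilon> * max (nv (b * u1)) (nv (b * u2))"
      using \<epsilon>(1) by (intro mult_nonneg_nonneg) (auto simp: le_max_iff_disj)
    ultimately have "disc \<epsilon> u1 u2 (b * u1) (b * u2) \<noteq> 0" by (simp add: disc_def V0_def mult.assoc mult.commute[of u1])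
    hence "?k (u1, u2) g \<noteq> 0" using det by (simp add: lift_def u(2,3))
    thus "\<exists>p\<in>?X. ?k p g \<noteq> 0" using u(4) by (intro bexI[of _ "(u1, u2)"]) auto
  next
    fix p r and g :: "'a mat2" assume pr: "p \<in> ?X" "r \<in> ?X" and nz: "?k p g \<noteq> 0" "?k r g \<noteq> 0"
    obtain b u1 u2 where u: "b \<noteq> 0" "g $ 2 $ 1 = b * u1" "g $ 2 $ 2 = b * u2" "max (nv u1) (nv u2) = 1"
      "nv (u1 * snd p - u2 * fst p) \<le> \<epsilon>" using at[OF nz(1)] by blast
    obtain b' w1 w2 where w: "b' \<noteq> 0" "g $ 2 $ 1 = b' * w1" "g $ 2 $ 2 = b' * w2" "max (nv w1) (nv w2) = 1"
      "nv (w1 * snd r - w2 * fst r) \<le> \<epsilon>" using at[OF nz(2)] by blast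
    \<comment> \<open>\<open>u\<close> and \<open>w\<close> are primitive multiples of one and the
      same bottom row, so their wedge vanishes and the discs around them coincide.\<close>
    have "nv (b * u1 * (b' * w2) - b * u2 * (b' * w1)) = 0" using u w by (simp add: algebra_simps)
    moreover have "b * u1 * (b' * w2) - b * u2 * (b' * w1) = b * b' * (u1 * w2 - u2 * w1)" by (simp add: algebra_simps)
    ultimately have "nv (u1 * w2 - u2 * w1) \<le> \<epsilon>" using u w \<epsilon> by auto
    hence "disc \<epsilon> u1 u2 = disc \<epsilon> w1 w2" using same u w by blast
    thus "?k p = ?k r" using same[OF u(4), of "fst p" "snd p"] same[OF w(4), of "fst r" "snd r"] u(5) w(5) pr by simp
  next
    fix p and g :: "'a mat2" assume p: "p \<in> ?X" and nz: "?k p g \<noteq> 0"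
    obtain b u1 u2 where u: "b \<noteq> 0" "g $ 2 $ 1 = b * u1" "g $ 2 $ 2 = b * u2" "max (nv u1) (nv u2) = 1"
      "nv (u1 * snd p - u2 * fst p) \<le> \<epsilon>" using at[OF nz] by blast
    have Fp: "F u1 u2 = F (fst p) (snd p)"
      by (rule density_close[OF hom s(3) u(4)]) (use p u(5) \<epsilon> s in auto)
    have nzu: "u1 \<noteq> 0 \<or> u2 \<noteq> 0" using u(4) by auto
    have "disc \<epsilon> (fst p) (snd p) (b * u1) (b * u2) \<noteq> 0" using nz by (auto simp: lift_def u(2,3))
    hence "disc \<epsilon> (fst p) (snd p) (b * u1) (b * u2) = V0 (b * u1) (b * u2)" by (auto simp: disc_def split: if_splits)
    also have "\<dots> = 1 / of_real (nv b * nv b)" unfolding V0_def max_nv_scale u(4) by (simp add: divide_inverse)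
    finally have "F (b * u1) (b * u2) = F (fst p) (snd p) * disc \<epsilon> (fst p) (snd p) (b * u1) (b * u2)"
      using hom u(1) nzu Fp unfolding homog_def by simp
    thus "f g = F (fst p) (snd p) * ?k p g" by (simp add: fF lift_def u(2,3))
  qed
  define \<kappa> where "\<kappa> = complex_of_real ((q + 1) * q ^ m)"
  have "q + 1 > 0" "q ^ m > 0" using q_pos by (auto intro: add_pos_pos)
  hence \<kappa>: "\<kappa> \<noteq> 0" unfolding \<kappa>_def by (metis less_irrefl mult_pos_pos of_real_eq_0_iff)
  let ?c = "\<lambda>k. F (fst (inv_into ?X ?k k)) (snd (inv_into ?X ?k k))"
  \<comment> \<open>The total of the shares of \<open>v0\<close> subtracted from the discs. Its
    value need not be computed: the mass decides that it is 0.\<close>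
  define C where "C = (\<Sum>k\<in>?k ` ?X. ?c k) / \<kappa>"
  have mem: "k - cscale (1 / \<kappa>) v0 \<in> U" if k: "k \<in> ?k ` ?X" for k
  proof -
    obtain p where p: "p \<in> ?X" "k = ?k p" using k by blast
    have "cscale (1 / \<kappa>) (cscale \<kappa> k - v0) \<in> U"
      using subrep_disc[OF U(1) 0, of "fst p" "snd p" m] p unfolding \<kappa>_def \<epsilon>_def
      by (intro cvec.subspace_scale[OF Us]) simp
    also have "cscale (1 / \<kappa>) (cscale \<kappa> k - v0) = k - cscale (1 / \<kappa>) v0"
      using \<kappa> by (auto simp: fun_eq_iff right_diff_distrib)
    finally show ?thesis .
  qed
  have "(\<Sum>k\<in>?k ` ?X. cscale (?c k) (k - cscale (1 / \<kappa>) v0)) \<in> U"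
    by (intro cvec.subspace_sum[OF Us] cvec.subspace_scale[OF Us] mem)
  also have "(\<Sum>k\<in>?k ` ?X. cscale (?c k) (k - cscale (1 / \<kappa>) v0)) = f - cscale C v0"
  proof
    fix g
    have "(\<Sum>k\<in>?k ` ?X. ?c k * (k g - 1 / \<kappa> * v0 g)) = (\<Sum>k\<in>?k ` ?X. ?c k * k g) - (\<Sum>k\<in>?k ` ?X. ?c k) * (1 / \<kappa> * v0 g)"
      by (simp only: right_diff_distrib sum_subtractf sum_distrib_right)
    moreover have "f g = (\<Sum>k\<in>?k ` ?X. ?c k * k g)" by (subst dec) (simp add: sum_fun_at)
    ultimately show "(\<Sum>k\<in>?k ` ?X. cscale (?c k) (k - cscale (1 / \<kappa>) v0)) g = (f - cscale C v0) g"
      by (simp add: sum_fun_at C_def)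
  qed
  finally have fC: "f - cscale C v0 \<in> U" .
  hence "mass (f - cscale C v0) = 0" using U(2) by (auto simp: St_def)
  hence "C * mass v0 = 0"
    using mass_diff[OF fI cvec.subspace_scale[OF I_half_subspace v0_I_half]] mass_cscale[OF v0_I_half] lf by simp
  hence "C = 0" using mass_v0_nz by simp
  thus "f \<in> U" using fC by simp
qed

text \<open>The matrix \<open>diag(unif, 1)\<close> multiplies the value at the identity by
  \<open>1/q\<close> when acting from the left and by 1 when acting from the right. So that value is
  0, and invariance carries this to all of \<open>GL2\<close>.\<close>

lemma I_half_invariant_zero:
  assumes f: "f \<in> I_half nv" and inv: "\<And>h. h \<in> GL2 \<Longrightarrow> right_transl h f = f"
  shows "f = 0"
proof -
  have u: "mat2 unif 0 0 1 \<in> (GL2 :: 'a mat2 set)" by (simp add: GL2_iff)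
  have "f (mat2 unif 0 0 1 ** mat 1) = of_real (nv unif / nv 1) * f (mat 1)"
    by (rule I_half_borel[OF f _ _ GL2_1]) auto
  moreover have "f (mat 1 ** mat2 unif 0 0 1) = f (mat 1)"
    using fun_cong[OF inv[OF u], of "mat 1"] by (simp only: right_transl_def)
  ultimately have "f (mat 1) = of_real (1 / q) * f (mat 1)" by (simp add: nv_unif)
  hence "(1 - complex_of_real (1 / q)) * f (mat 1) = 0" by (simp only: left_diff_distrib mult_1 diff_self)
  moreover have "1 / q \<noteq> 1" using q_gt_1 by simp
  ultimately have 1: "f (mat 1) = 0" by (metis mult_eq_0_iff of_real_eq_1_iff right_minus_eq)
  show ?thesis
  proof
    fix g :: "'a mat2"
    show "f g = 0 g"
    proof (cases "g \<in> GL2")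
      case True
      have "f (mat 1 ** g) = f (mat 1)" using fun_cong[OF inv[OF True], of "mat 1"] by (simp only: right_transl_def)
      thus ?thesis using 1 by simp
    qed (simp add: I_half_off[OF f])
  qed
qed

section \<open>Finding a disc gap in a subrepresentation\<close>

lemma dens_sum: "dens (\<Sum>i\<in>I. f i) c d = (\<Sum>i\<in>I. dens (f i) c d)"
  by (simp add: dens_def sum_fun_at sum_divide_distrib)

text \<open>Smoothness makes the translates by the compact group of these unipotents a finite set
  \<open>O'\<close>. Its sum is taken without dividing by the cardinality; the factor is carried
  along by the user of the lemma.\<close>

lemma unipotent_average:
  assumes f: "f \<in> I_half nv"
  shows "\<exists>O'. finite O' \<and> O' \<noteq> {} \<and> O' \<subseteq> (\<lambda>t. right_transl (mat2 1 t 0 1) f) ` {t. nv t \<le> 1 / q} \<and>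
    (\<forall>t. nv t \<le> 1 / q \<longrightarrow> right_transl (mat2 1 t 0 1) (\<Sum>O') = \<Sum>O')"
proof -
  let ?u = "\<lambda>t. mat2 1 t 0 (1 :: 'a)"
  let ?R = "\<lambda>t. right_transl (?u t)"
  define O' where "O' = (\<lambda>t. ?R t f) ` {t. nv t \<le> 1 / q}"
  have RR: "?R s (?R t g) = ?R (s + t) g" for s t and g :: "'a mat2 \<Rightarrow> complex"
  proof -
    have "M ** ?u s ** ?u t = M ** ?u (s + t)" for M :: "'a mat2"
      by (simp add: mat2_mult add.commute flip: matrix_mul_assoc)
    thus ?thesis by (simp add: right_transl_def fun_eq_iff)
  qed
  have R0: "?R 0 g = g" for g :: "'a mat2 \<Rightarrow> complex"
    unfolding mat_1_mat2[symmetric] by (simp add: right_transl_def)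
  obtain e where e: "e > 0" "\<And>g k. g \<in> GL2 \<Longrightarrow> mn (k - mat 1) < e \<Longrightarrow> f (g ** k) = f g"
    using I_half_smooth[OF f] by blast
  have small: "?R t f = f" if t: "nv t < e" for t
  proof
    fix g :: "'a mat2"
    have k: "mn (?u t - mat 1) < e" using t e(1) by (simp add: mat_1_mat2 mat2_diff mnv_mat2)
    show "?R t f g = f g"
    proof (cases "g \<in> GL2")
      case True
      thus ?thesis using e(2)[OF True k] by (simp add: right_transl_def)
    next
      case False
      hence "g ** ?u t \<notin> GL2" by (simp add: GL2_iff det_mul)
      thus ?thesis using I_half_off[OF f] False by (simp add: right_transl_def)
    qed
  qed
  have fin: "finite O'" unfolding O'_def
  proof (rule finite_image_locally_const_scalar[of "e / 2" _ "1 / q"])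
    fix s t assume "nv (s - t) \<le> e / 2"
    hence "?R (s - t) f = f" using small e(1) by simp
    hence "?R t (?R (s - t) f) = ?R t f" by simp
    thus "?R s f = ?R t f" by (simp add: RR)
  qed (use e in auto)
  have "nv 0 \<le> 1 / q" by simp
  hence ne: "O' \<noteq> {}" unfolding O'_def by blast
  have inv: "?R t (\<Sum>O') = \<Sum>O'" if t: "nv t \<le> 1 / q" for t
  proof -
    have "?R t ` O' \<subseteq> O'" unfolding O'_def using nv_add_le[OF t] RR by fastforce
    moreover have "inj_on (?R t) O'"
    proof (rule inj_onI)
      fix \<phi> \<psi> assume "?R t \<phi> = ?R t \<psi>"
      hence "?R (- t) (?R t \<phi>) = ?R (- t) (?R t \<psi>)" by simp
      thus "\<phi> = \<psi>" by (simp add: RR R0)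
    qed
    ultimately have "(\<Sum>\<phi>\<in>O'. ?R t \<phi>) = \<Sum>O'" using sum_invariant[OF fin] by blast
    thus ?thesis by (simp add: right_transl_def fun_eq_iff sum_fun_at)
  qed
  show ?thesis using fin ne inv O'_def by blast
qed

lemma subrep_sum:
  assumes "subrep U V" "\<And>i. i \<in> I \<Longrightarrow> f i \<in> U" shows "(\<Sum>i\<in>I. f i) \<in> U"
  using assms cvec.subspace_sum[of U I f] by (simp add: subrep_def csubspace_eq)

lemma disc_gap_in_subrep:
  assumes U: "subrep U (I_half nv)" and USt: "U \<subseteq> St" and ne: "U \<noteq> {0}"
  shows "disc_gap 0 \<in> U"
proof -
  have Us: "cvec.subspace U" using U by (simp add: subrep_def csubspace_eq)
  have UI: "f \<in> I_half nv" if "f \<in> U" for f using U that by (auto simp: subrep_def)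
  have Ur: "right_transl h f \<in> U" if "h \<in> GL2" "f \<in> U" for f h using U that by (auto simp: subrep_def)
  obtain f where f: "f \<in> U" "f \<noteq> 0" using ne cvec.subspace_0[OF Us] by blast
  obtain g0 where g0: "f g0 \<noteq> 0" using f(2) by (auto simp: fun_eq_iff)
  have g0G: "g0 \<in> GL2" using I_half_off[OF UI[OF f(1)]] g0 by blast
  \<comment> \<open>This moves a point where \<open>f\<close> is nonzero to the identity, whose
    bottom row is \<open>(0, 1)\<close>.\<close>
  define f1 where "f1 = right_transl g0 f"
  have f1: "f1 \<in> U" unfolding f1_def by (rule Ur[OF g0G f(1)])
  define F1 where "F1 = dens f1"
  have "row_mat 0 1 = (mat 1 :: 'a mat2)" by (simp add: row_mat_def mat_1_mat2)
  hence F10: "F1 0 1 \<noteq> 0" using g0 by (simp add: F1_def dens_def f1_def right_transl_def mat_1_mat2 flip: mat_1_mat2)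
  have hom1: "homog F1" using homog_dens[OF UI[OF f1]] by (simp add: F1_def)
  obtain s where s: "s > 0" "\<And>c d x y. max (nv c) (nv d) = 1 \<Longrightarrow> nv x \<le> s \<Longrightarrow> nv y \<le> s \<Longrightarrow> F1 (c + x) (d + y) = F1 c d"
    using rsmooth_level[OF rsmooth_dens[OF UI[OF f1]]] unfolding F1_def by blast
  \<comment> \<open>The dilation by \<open>a\<close> contracts the disc \<open>|c| <= |d|\<close>
    into the disc of radius \<open>s\<close> around \<open>[0 : 1]\<close>, where the density is
    already a multiple of \<open>V0\<close>.\<close>
  obtain a where a: "a \<noteq> 0" "nv a \<le> s" using ex_nv_le[OF s(1)] by blast
  let ?h = "mat2 a 0 0 1"
  have hG: "?h \<in> GL2" using a by (simp add: GL2_iff)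
  define f2 where "f2 = right_transl ?h f1"
  have f2: "f2 \<in> U" unfolding f2_def by (rule Ur[OF hG f1])
  define c0 where "c0 = of_real (nv a) * F1 0 1"
  have c0: "c0 \<noteq> 0" using a F10 by (simp add: c0_def)
  have V0d: "V0 c d = 1 / of_real (nv d * nv d)" if "nv c \<le> nv d" for c d
    using that by (simp add: V0_def max_absorb2 inverse_eq_divide)
  have f2d: "dens f2 c d = c0 * V0 c d" if d: "d \<noteq> 0" "nv c \<le> nv d" for c d
  proof -
    have "dens f2 c d = of_real (nv a) * F1 (c * a) d"
      unfolding f2_def F1_def using dens_right[OF UI[OF f1] hG, of c d] d by simp
    also have "F1 (c * a) d = F1 (d * (c * a / d)) (d * 1)" using d by simp
    also have "\<dots> = F1 (c * a / d) 1 / of_real (nv d * nv d)"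
      using hom1 d(1) one_neq_zero unfolding homog_def by blast
    also have "F1 (c * a / d) 1 = F1 (0 + c * a / d) (1 + 0)" by simp
    also have "\<dots> = F1 0 1"
    proof (rule s(2))
      have "nv (c / d) \<le> 1" using d by (simp add: nv_divide)
      hence "nv (c / d) * nv a \<le> nv a" by (simp add: mult_left_le_one_le)
      moreover have "nv (c * a / d) = nv (c / d) * nv a" by (simp add: nv_mult nv_divide)
      ultimately show "nv (c * a / d) \<le> s" using a by linarith
    qed (use s(1) in auto)
    finally show ?thesis using V0d[OF d(2)] by (simp add: c0_def)
  qed
  let ?u = "\<lambda>t. mat2 1 t 0 (1 :: 'a)"
  have uG: "?u t \<in> GL2" for t by (simp add: GL2_iff)
  \<comment> \<open>For \<open>|t| <= 1/q\<close> the unipotents preserve the disc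
    \<open>|c| <= |d|\<close> and are transitive on its complement, where \<open>t = - d / c\<close>
    leads to \<open>[1 : 0]\<close>. The sum of translates is thus a multiple of \<open>V0\<close>
    on each of the two pieces.\<close>
  obtain O' where O': "finite O'" "O' \<noteq> {}" "O' \<subseteq> (\<lambda>t. right_transl (?u t) f2) ` {t. nv t \<le> 1 / q}"
    "\<And>t. nv t \<le> 1 / q \<Longrightarrow> right_transl (?u t) (\<Sum>O') = \<Sum>O'"
    using unipotent_average[OF UI[OF f2]] by blast
  define A where "A = \<Sum>O'"
  have "A = (\<Sum>\<phi>\<in>O'. \<phi>)" by (simp add: A_def)
  also have "\<dots> \<in> U" by (rule subrep_sum[OF U]) (use O'(3) Ur[OF uG f2] in blast)
  finally have AU: "A \<in> U" .
  define n where "n = complex_of_nat (card O')"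
  have n: "n \<noteq> 0" using O'(1,2) by (simp add: n_def)
  have lowd: "dens A c d = n * c0 * V0 c d" if d: "d \<noteq> 0" "nv c \<le> nv d" for c d
  proof -
    have "dens \<phi> c d = c0 * V0 c d" if \<phi>: "\<phi> \<in> O'" for \<phi>
    proof -
      obtain t where t: "nv t \<le> 1 / q" "\<phi> = right_transl (?u t) f2" using O'(3) \<phi> by blast
      have "nv c * nv t \<le> nv d * (1 / q)" using t d by (intro mult_mono) auto
      also have "\<dots> < nv d * 1" using d q_gt_1 by (intro mult_strict_left_mono) auto
      finally have "nv (c * t) < nv d" by (simp add: nv_mult)
      hence e: "nv (d + c * t) = nv d" by (rule nv_add_absorb)
      hence "d + c * t \<noteq> 0" using d(1) by (metis nv_eq_0)
      hence "dens f2 c (d + c * t) = c0 * V0 c (d + c * t)" using f2d e d by simp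
      moreover have "V0 c (d + c * t) = V0 c d" by (simp add: V0_def e)
      ultimately show ?thesis using dens_right[OF UI[OF f2] uG, of c d t] d t(2) by (simp add: add.commute)
    qed
    hence "(\<Sum>\<phi>\<in>O'. dens \<phi> c d) = (\<Sum>\<phi>\<in>O'. c0 * V0 c d)" by (intro sum.cong) auto
    thus ?thesis unfolding A_def dens_sum by (simp add: n_def)
  qed
  define c1 where "c1 = dens A 1 0"
  have highd: "dens A c d = c1 * V0 c d" if d: "nv d < nv c" for c d
  proof -
    have "nv c > 0" using d nv_nonneg[of d] by linarith
    hence c: "c \<noteq> 0" by simp
    have "nv (- d / c) < 1" using d c unfolding nv_divide nv_minus by simp
    hence t: "nv (- d / c) \<le> 1 / q" using nv_less_1_iff by blast
    have "dens A c d = dens (right_transl (?u (- d / c)) A) c d" using O'(4)[OF t] by (simp add: A_def)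
    also have "\<dots> = dens A (c * 1) (c * 0)" using dens_right[OF UI[OF AU] uG, of c d "- d / c"] c by simp
    also have "\<dots> = c1 / of_real (nv c * nv c)"
      using homog_dens[OF UI[OF AU]] c one_neq_zero unfolding homog_def c1_def by blast
    finally show ?thesis using d by (simp add: V0_def max_absorb1 divide_inverse)
  qed
  have "A = lift (dens A)" by (rule lift_dens[OF UI[OF AU], symmetric])
  also have "\<dots> = lift (\<lambda>c d. n * c0 * V0 c d + (c1 - n * c0) * disc0 0 c d)"
  proof (rule lift_cong)
    fix c d :: 'a assume cd: "c \<noteq> 0 \<or> d \<noteq> 0"
    have cond: "nv d \<le> inverse (q ^ Suc 0) * nv c \<longleftrightarrow> nv d < nv c"
    proof (cases "c = 0")
      case False
      thus ?thesis using nv_less_iff[OF False, of d] by (simp add: field_simps)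
    next
      case True
      hence "nv d > 0" using cd by simp
      hence "\<not> nv d \<le> 0" "\<not> nv d < 0" by linarith+
      thus ?thesis using True by (simp only: nv_0 mult_zero_right)
    qed
    show "dens A c d = n * c0 * V0 c d + (c1 - n * c0) * disc0 0 c d"
    proof (cases "nv d < nv c")
      case True
      thus ?thesis unfolding disc0_eq cond using highd by (simp add: algebra_simps)
    next
      case False
      hence "d \<noteq> 0" using cd by auto
      thus ?thesis unfolding disc0_eq cond using False lowd[of d c] by simp
    qed
  qed
  finally have Aeq: "A = cscale (n * c0) v0 + cscale (c1 - n * c0) (lift (disc0 0))"
    unfolding lift_add lift_cmult .
  have "mass A = 0" using AU USt by (auto simp: St_def)
  hence "n * c0 * mass v0 + (c1 - n * c0) * mass (lift (disc0 0)) = 0"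
    unfolding Aeq mass_add[OF cvec.subspace_scale[OF I_half_subspace v0_I_half]
        cvec.subspace_scale[OF I_half_subspace disc0_I_half]] mass_cscale[OF v0_I_half] mass_cscale[OF disc0_I_half] .
  moreover define Q where "Q = complex_of_real q"
  moreover have Q0: "Q \<noteq> 0" by (simp add: Q_def)
  moreover have Q1: "Q \<noteq> 1" using q_gt_1 by (metis Q_def less_irrefl of_real_eq_1_iff)
  ultimately have "n * c0 * (1 - 1 / (Q * Q)) + (c1 - n * c0) * ((1 - 1 / Q) * (1 / Q)) = 0"
    unfolding mass_v0 mass_disc0 by simp
  \<comment> \<open>Both masses contain the factor \<open>(Q - 1) / Q^2\<close>. Cancelling it
    leaves coefficients of \<open>disc0 0\<close> and \<open>v0\<close> in the ratio
    \<open>-(q + 1)\<close>, which is that of \<open>disc_gap 0\<close>.\<close>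
  hence "(Q - 1) * (n * c0 * (Q + 1) + (c1 - n * c0)) = 0"
    using Q0 by (simp add: field_simps)
  hence "n * c0 * (Q + 1) + (c1 - n * c0) = 0" using Q1 by (metis mult_eq_0_iff right_minus_eq)
  hence c1: "c1 - n * c0 = - (n * c0) * (Q + 1)"
    unfolding mult_minus_left eq_neg_iff_add_eq_0 by (simp only: add.commute)
  have "cscale (- 1 / (n * c0)) A = disc_gap 0"
    unfolding Aeq c1 disc_gap_def using n c0 by (auto simp: fun_eq_iff Q_def field_simps)
  thus ?thesis using cvec.subspace_scale[OF Us AU] by metis
qed

lemma right_transl_diff_St:
  assumes "f \<in> I_half nv" "h \<in> GL2"
  shows "right_transl h f - f \<in> St"
  using mass_diff[OF I_half_right[OF assms] assms(1)] mass_right[OF assms]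
    cvec.subspace_diff[OF I_half_subspace I_half_right[OF assms] assms(1)] by (simp add: St_def)

text \<open>\<open>right_transl h f - f\<close> always has mass 0. If \<open>U\<close> met
  \<open>St\<close> only in 0, the group would therefore act trivially on \<open>U\<close>, but the
  induced representation has no nonzero invariant vector.\<close>

lemma St_subset:
  assumes U: "subrep U (I_half nv)" and ne: "U \<noteq> {0}"
  shows "St \<subseteq> U"
proof -
  have Us: "cvec.subspace U" using U by (simp add: subrep_def csubspace_eq)
  have sub: "subrep (U \<inter> St) (I_half nv)"
    using U subrep_St by (auto simp: subrep_def csubspace_eq cvec.subspace_inter)
  have "U \<inter> St \<noteq> {0}"
  proof
    assume e: "U \<inter> St = {0}"
    have "f = 0" if f: "f \<in> U" for f
    proof -
      have fI: "f \<in> I_half nv" using U f by (auto simp: subrep_def)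
      have "right_transl h f = f" if h: "h \<in> GL2" for h
      proof -
        have "right_transl h f - f \<in> U" using U f h cvec.subspace_diff[OF Us] by (simp add: subrep_def)
        moreover have "right_transl h f - f \<in> St" by (rule right_transl_diff_St[OF fI h])
        ultimately have "right_transl h f - f = 0" using e by blast
        thus ?thesis by simp
      qed
      thus ?thesis by (rule I_half_invariant_zero[OF fI])
    qed
    thus False using ne cvec.subspace_0[OF Us] by blast
  qed
  from St_subset_if_disc_gap[OF sub _ disc_gap_in_subrep[OF sub _ this]] show ?thesis by blast
qed

section \<open>The list of all subrepresentations\<close>

lemma v0_notin_St: "v0 \<notin> St" using mass_v0_nz by (simp add: St_def)

lemma St_nonzero: "St \<noteq> {0}"
proof
  assume e: "St = {0}"
  have "v0 = 0"
  proof (rule I_half_invariant_zero[OF v0_I_half])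
    fix h :: "'a mat2" assume "h \<in> GL2"
    hence "right_transl h v0 - v0 = 0" using right_transl_diff_St[OF v0_I_half] e by blast
    thus "right_transl h v0 = v0" by simp
  qed
  thus False using v0_notin_St e by simp
qed

text \<open>\<open>St\<close> is the kernel of a linear functional, so any single vector of nonzero
  mass spans the quotient.\<close>

lemma mod_St:
  assumes f: "f \<in> I_half nv" and g: "g \<in> I_half nv" and lg: "mass g \<noteq> 0"
  shows "f - cscale (mass f / mass g) g \<in> St"
proof -
  have cg: "cscale (mass f / mass g) g \<in> I_half nv" by (rule cvec.subspace_scale[OF I_half_subspace g])
  show ?thesis using mass_diff[OF f cg] mass_cscale[OF g] lg cvec.subspace_diff[OF I_half_subspace f cg]
    by (simp add: St_def)
qed

text \<open>A nonzero subrepresentation contains \<open>St\<close>; if it is larger, it has a vector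
  of nonzero mass and codimension one leaves only the whole space.\<close>

lemma subrep_iff: "subrep U (I_half nv) \<longleftrightarrow> U \<in> {{0}, St, I_half nv}"
proof
  assume U: "subrep U (I_half nv)"
  hence Us: "cvec.subspace U" and UI: "U \<subseteq> I_half nv" by (auto simp: subrep_def csubspace_eq)
  show "U \<in> {{0}, St, I_half nv}"
  proof (cases "U = {0} \<or> U = St")
    case False
    hence St: "St \<subseteq> U" "U \<noteq> St" using St_subset[OF U] by auto
    then obtain g where g: "g \<in> U" "g \<notin> St" by blast
    hence gI: "g \<in> I_half nv" and lg: "mass g \<noteq> 0" using UI by (auto simp: St_def)
    have "f \<in> U" if f: "f \<in> I_half nv" for f
    proof -
      have "(f - cscale (mass f / mass g) g) + cscale (mass f / mass g) g \<in> U"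
        using mod_St[OF f gI lg] St(1) g(1) by (intro cvec.subspace_add[OF Us] cvec.subspace_scale[OF Us]) auto
      thus ?thesis by simp
    qed
    thus ?thesis using UI by blast
  qed blast
next
  have "subrep {0} (I_half nv)"
    using cvec.subspace_0[OF I_half_subspace] by (auto simp: subrep_def csubspace_eq right_transl_def fun_eq_iff)
  thus "U \<in> {{0}, St, I_half nv} \<Longrightarrow> subrep U (I_half nv)" using subrep_St subrep_I_half by blast
qed

text \<open>Existence and uniqueness at once: this gives the definite description in
  \<open>steinberg\<close> its value.\<close>

lemma irreducible_iff: "irreducible_subrep U (I_half nv) \<longleftrightarrow> U = St"
proof
  assume "irreducible_subrep U (I_half nv)"
  hence U: "subrep U (I_half nv)" "U \<noteq> {0}" "\<And>U'. subrep U' U \<Longrightarrow> U' = {0} \<or> U' = U"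
    unfolding irreducible_subrep_def by auto
  have "subrep St U" using St_subset[OF U(1,2)] subrep_St by (auto simp: subrep_def)
  thus "U = St" using U(3) St_nonzero by blast
next
  assume U: "U = St"
  have "U' = {0} \<or> U' = St" if "subrep U' St" for U'
  proof -
    have "subrep U' (I_half nv)" using that St_sub by (auto simp: subrep_def)
    thus ?thesis using St_subset[of U'] that by (auto simp: subrep_def)
  qed
  thus "irreducible_subrep U (I_half nv)" unfolding irreducible_subrep_def U using subrep_St St_nonzero by blast
qed

lemma steinberg_eq: "steinberg nv = St"
  unfolding steinberg_def irreducible_iff by simp

lemma theta_trivial:
  "(\<exists>T :: ('a mat2 \<Rightarrow> complex) \<Rightarrow> ('a mat2 \<Rightarrow> complex).
            (\<forall>f\<in>schwartz nv. \<forall>f'\<in>schwartz nv. T (f + f') = T f + T f') \<and>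
            (\<forall>c. \<forall>f\<in>schwartz nv. T (cscale c f) = cscale c (T f)) \<and>
            T ` schwartz nv = I_half nv \<and>
            {f \<in> schwartz nv. T f = 0} = theta_triv_kernel nv \<and>
            (\<forall>h\<in>GL2. \<forall>f\<in>schwartz nv. T (weil nv (mat 1) h f) = right_transl h (T f)))"
proof (rule exI[of _ T], intro conjI ballI allI)
  show "T ` schwartz nv = I_half nv" using T_surj T_in_I_half by blast
  show "{f \<in> schwartz nv. T f = 0} = W" using W_kerT kerT_subset_W by blast
qed (auto simp: T_add T_cscale T_right)

lemma I_half_structure:
  "(\<exists>!U. irreducible_subrep U (I_half nv))
       \<and> (\<forall>U. subrep U (I_half nv) \<longleftrightarrow> U \<in> {{0}, steinberg nv, I_half nv})
       \<and> steinberg nv \<noteq> I_half nv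
       \<and> (\<exists>f0\<in>I_half nv. f0 \<notin> steinberg nv \<and>
            (\<forall>f\<in>I_half nv. \<exists>c::complex. f - cscale c f0 \<in> steinberg nv))
       \<and> (\<forall>h\<in>GL2. \<forall>f\<in>I_half nv. right_transl h f - f \<in> steinberg nv)"
  unfolding steinberg_eq
proof (intro conjI allI ballI)
  show "\<exists>!U. irreducible_subrep U (I_half nv)" unfolding irreducible_iff by blast
  show "St \<noteq> I_half nv" using v0_I_half v0_notin_St by blast
  show "\<exists>f0\<in>I_half nv. f0 \<notin> St \<and> (\<forall>f\<in>I_half nv. \<exists>c. f - cscale c f0 \<in> St)"
    using v0_I_half v0_notin_St mod_St[OF _ v0_I_half mass_v0_nz] by blast
qed (rule subrep_iff, rule right_transl_diff_St)

end

theorem theorem2p11: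
  fixes nv :: "'a::field_char_0 \<Rightarrow> real"
  assumes "nonarch_local_field nv"
  shows "(\<exists>T :: ('a mat2 \<Rightarrow> complex) \<Rightarrow> ('a mat2 \<Rightarrow> complex).
            (\<forall>f\<in>schwartz nv. \<forall>f'\<in>schwartz nv. T (f + f') = T f + T f') \<and>
            (\<forall>c. \<forall>f\<in>schwartz nv. T (cscale c f) = cscale c (T f)) \<and>
            T ` schwartz nv = I_half nv \<and>
            {f \<in> schwartz nv. T f = 0} = theta_triv_kernel nv \<and>
            (\<forall>h\<in>GL2. \<forall>f\<in>schwartz nv. T (weil nv (mat 1) h f) = right_transl h (T f)))
       \<and> (\<exists>!U. irreducible_subrep U (I_half nv))
       \<and> (\<forall>U. subrep U (I_half nv) \<longleftrightarrow> U \<in> {{0}, steinberg nv, I_half nv})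
       \<and> steinberg nv \<noteq> I_half nv
       \<and> (\<exists>f0\<in>I_half nv. f0 \<notin> steinberg nv \<and>
            (\<forall>f\<in>I_half nv. \<exists>c::complex. f - cscale c f0 \<in> steinberg nv))
       \<and> (\<forall>h\<in>GL2. \<forall>f\<in>I_half nv. right_transl h f - f \<in> steinberg nv)"
proof -
  interpret local_field nv by unfold_locales (rule assms)
  show ?thesis using theta_trivial I_half_structure by (rule conjI)
qed

end
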